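(* Let $\mathcal{H}$ be a Hilbert space, $\mathcal{B}$ a von Neumann algebra and $T:B(\mathcal{H})\otimes\mathcal{B}\to B(\mathcal{H})$ a CP-map. Let $A\in B(\mathcal{H})$ and $B\in\mathcal{B}$ be Hermitean, with $A\notin\mathbb{C}\mathbf 1$. Define $\Delta:=\sup\{\|R(P)-P\|\,:\,P\in B(\mathcal{H}),\,0\le P\le\mathbf 1\}$ with $R(X):=T(X\otimes\mathbf 1)$ for $X \in B(\mathcal{H})$, and define $$\delta:=\sup_S\|T(\mathbf 1\otimes\mathbf 1_S(B))-\mathbf 1_S(A)\|,$$ the supremum being over Borel sets $S\subset\mathbb{R}$. Then, for $\delta$ and $\Delta$ in $[0,\frac12]$, we have $$(\tfrac12-\delta)^2+(\tfrac12-\Delta)^2\le\tfrac14.$$ This bound is sharp in the sense that for all $\Delta\in[0,\frac12]$ there exists a $T$ (i.e. a Hilbert space $\mathcal{H}$, a von Neumann algebra $\mathcal{B}$, a CP-map $T:B(\mathcal{H})\otimes\mathcal{B}\to B(\mathcal{H})$ and Hermitean $A\in B(\mathcal{H})$, $B\in\mathcal{B}$ with $A\notin\mathbb{C}\mathbf 1$, such that $\sup\{\|T(P\otimes\mathbf 1)-P\|\,:\,P\in B(\mathcal{H}),\,0\le P\le\mathbf 1\}$ equals the given value $\Delta$ and $\delta\in[0,\frac12]$) for which equality is attained.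
   Context: A CP-map between von Neumann algebras is a linear, unital, completely positive map that is weakly continuous, in the sense that it pulls back normal states to normal states. $B(\mathcal{H})\otimes\mathcal{B}$ is the von Neumann algebra tensor product. $\mathbf 1_S(X)$ denotes the spectral projection of the self-adjoint operator $X$ associated to the Borel set $S$. *)

theory Defs
  imports "HOL-Analysis.Analysis"
begin

section \<open>Complex Hilbert spaces\<close>

text \<open>The inner product is linear in its second argument.\<close>

class complex_hilbert_space = banach +
  fixes scaleC :: "complex \<Rightarrow> 'a \<Rightarrow> 'a"  (infixr \<open>*\<^sub>C\<close> 75)
    and cinner :: "'a \<Rightarrow> 'a \<Rightarrow> complex"
  assumes scaleC_add_right: "c *\<^sub>C (x + y) = c *\<^sub>C x + c *\<^sub>C y"
    and scaleC_add_left: "(c + d) *\<^sub>C x = c *\<^sub>C x + d *\<^sub>C x"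
    and scaleC_scaleC: "c *\<^sub>C d *\<^sub>C x = (c * d) *\<^sub>C x"
    and scaleR_scaleC: "r *\<^sub>R x = complex_of_real r *\<^sub>C x"
    and cinner_add_right: "cinner x (y + z) = cinner x y + cinner x z"
    and cinner_scaleC_right: "cinner x (c *\<^sub>C y) = c * cinner x y"
    and cinner_commute: "cinner y x = cnj (cinner x y)"
    and norm_eq_sqrt_cinner: "norm x = sqrt (Re (cinner x x))"

lemma cinner_same: "cinner x x = complex_of_real ((norm x)\<^sup>2)"
proof -
  have "Im (cinner x x) = 0"
    using arg_cong[OF cinner_commute[of x x], of Im] by simp
  moreover have "Re (cinner x x) = (norm x)\<^sup>2"
    using norm_ge_zero[of x] by (simp add: norm_eq_sqrt_cinner)
  ultimately show ?thesis
    by (simp add: complex_eq_iff)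
qed

lemma norm_scaleC: "norm (c *\<^sub>C x) = cmod c * norm (x :: 'a :: complex_hilbert_space)"
proof -
  have "cinner (c *\<^sub>C x) (c *\<^sub>C x) = c * cnj c * cinner x x"
    by (metis (no_types) cinner_commute cinner_scaleC_right complex_cnj_mult mult.assoc)
  then have "complex_of_real ((norm (c *\<^sub>C x))\<^sup>2) = complex_of_real ((cmod c * norm x)\<^sup>2)"
    by (simp only: cinner_same complex_norm_square[symmetric] of_real_mult[symmetric] power_mult_distrib)
  then have "(norm (c *\<^sub>C x))\<^sup>2 = (cmod c * norm x)\<^sup>2"
    by (simp only: of_real_eq_iff)
  then show ?thesis
    by (simp add: power2_eq_iff_nonneg)
qed

instantiation complex :: complex_hilbert_space
begin

definition scaleC_complex :: "complex \<Rightarrow> complex \<Rightarrow> complex"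
  where "scaleC_complex c x = c * x"

definition cinner_complex :: "complex \<Rightarrow> complex \<Rightarrow> complex"
  where "cinner_complex x y = cnj x * y"

instance
  by standard
    (auto simp: scaleC_complex_def cinner_complex_def algebra_simps scaleR_conv_of_real
      cmod_def power2_eq_square)

end

instantiation vec :: (complex_hilbert_space, finite) complex_hilbert_space
begin

definition scaleC_vec :: "complex \<Rightarrow> 'a ^ 'b \<Rightarrow> 'a ^ 'b"
  where "scaleC_vec c x = (\<chi> i. c *\<^sub>C (x $ i))"

definition cinner_vec :: "'a ^ 'b \<Rightarrow> 'a ^ 'b \<Rightarrow> complex"
  where "cinner_vec x y = (\<Sum>i\<in>UNIV. cinner (x $ i) (y $ i))"

instance
proof
  fix x y z :: "'a ^ 'b" and c d :: complex and r :: real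
  show "c *\<^sub>C (x + y) = c *\<^sub>C x + c *\<^sub>C y"
    by (simp add: scaleC_vec_def vec_eq_iff scaleC_add_right)
  show "(c + d) *\<^sub>C x = c *\<^sub>C x + d *\<^sub>C x"
    by (simp add: scaleC_vec_def vec_eq_iff scaleC_add_left)
  show "c *\<^sub>C d *\<^sub>C x = (c * d) *\<^sub>C x"
    by (simp add: scaleC_vec_def vec_eq_iff scaleC_scaleC)
  show "r *\<^sub>R x = complex_of_real r *\<^sub>C x"
    by (simp add: scaleC_vec_def vec_eq_iff scaleR_scaleC)
  show "cinner x (y + z) = cinner x y + cinner x z"
    by (simp add: cinner_vec_def cinner_add_right sum.distrib)
  show "cinner x (c *\<^sub>C y) = c * cinner x y"
    by (simp add: cinner_vec_def scaleC_vec_def cinner_scaleC_right sum_distrib_left)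
  show "cinner y x = cnj (cinner x y)"
    unfolding cinner_vec_def cnj_sum by (rule sum.cong[OF refl], rule cinner_commute)
  show "norm x = sqrt (Re (cinner x x))"
    by (simp add: norm_vec_def L2_set_def cinner_vec_def cinner_same)
qed

end

section \<open>Operators\<close>

text \<open>Bounded operators are the complex-linear elements of the type of bounded real-linear maps;
  the library norm on that type is the usual operator norm.\<close>

definition bounded_ops :: "('h :: complex_hilbert_space \<Rightarrow>\<^sub>L 'h) set"
  where "bounded_ops = {X. \<forall>c x. blinfun_apply X (c *\<^sub>C x) = c *\<^sub>C blinfun_apply X x}"

lift_definition scalar_op :: "complex \<Rightarrow> ('h :: complex_hilbert_space \<Rightarrow>\<^sub>L 'h)"
  is "\<lambda>c x. c *\<^sub>C x"
  by (rule bounded_linear_intro[where K = "cmod _"])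
    (auto simp: scaleC_add_right scaleR_scaleC scaleC_scaleC mult.commute norm_scaleC)

definition op_scaleC :: "complex \<Rightarrow> ('h :: complex_hilbert_space \<Rightarrow>\<^sub>L 'h) \<Rightarrow> ('h \<Rightarrow>\<^sub>L 'h)"
  where "op_scaleC c X = scalar_op c o\<^sub>L X"

definition adjoint_ops ::
    "('h :: complex_hilbert_space \<Rightarrow>\<^sub>L 'h) \<Rightarrow> ('h \<Rightarrow>\<^sub>L 'h) \<Rightarrow> bool"
  where "adjoint_ops X Y \<longleftrightarrow>
    (\<forall>x y. cinner (blinfun_apply X x) y = cinner x (blinfun_apply Y y))"

definition hermitean :: "('h :: complex_hilbert_space \<Rightarrow>\<^sub>L 'h) \<Rightarrow> bool"
  where "hermitean X \<longleftrightarrow> X \<in> bounded_ops \<and> adjoint_ops X X"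

definition positive_op :: "('h :: complex_hilbert_space \<Rightarrow>\<^sub>L 'h) \<Rightarrow> bool"
  where "positive_op X \<longleftrightarrow>
    X \<in> bounded_ops \<and> (\<forall>x. cinner x (blinfun_apply X x) \<in> \<real>\<^sub>\<ge>\<^sub>0)"

definition op_le ::
    "('h :: complex_hilbert_space \<Rightarrow>\<^sub>L 'h) \<Rightarrow> ('h \<Rightarrow>\<^sub>L 'h) \<Rightarrow> bool"
  where "op_le X Y \<longleftrightarrow> positive_op (Y - X)"

definition projection_op :: "('h :: complex_hilbert_space \<Rightarrow>\<^sub>L 'h) \<Rightarrow> bool"
  where "projection_op P \<longleftrightarrow> hermitean P \<and> P o\<^sub>L P = P"

section \<open>Spectral projections\<close>

definition projection_valued_measure ::
    "(real set \<Rightarrow> ('h :: complex_hilbert_space \<Rightarrow>\<^sub>L 'h)) \<Rightarrow> bool"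
  where "projection_valued_measure E \<longleftrightarrow>
    (\<forall>S\<in>sets borel. projection_op (E S)) \<and>
    E {} = 0 \<and> E UNIV = id_blinfun \<and>
    (\<forall>S\<in>sets borel. \<forall>S'\<in>sets borel. E (S \<inter> S') = E S o\<^sub>L E S') \<and>
    (\<forall>F :: nat \<Rightarrow> real set. range F \<subseteq> sets borel \<and> disjoint_family F \<longrightarrow>
      (\<forall>x. (\<lambda>n. blinfun_apply (E (F n)) x) sums blinfun_apply (E (\<Union>n. F n)) x))"

definition pvm_measure ::
    "(real set \<Rightarrow> ('h :: complex_hilbert_space \<Rightarrow>\<^sub>L 'h)) \<Rightarrow> 'h \<Rightarrow> real measure"
  where "pvm_measure E x =
    measure_of UNIV (sets borel) (\<lambda>S. ennreal (Re (cinner x (blinfun_apply (E S) x))))"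

text \<open>The integral of the identity function with respect to \<open>E\<close> is \<open>X\<close>, in the weak sense.\<close>

definition is_spectral_measure ::
    "('h :: complex_hilbert_space \<Rightarrow>\<^sub>L 'h) \<Rightarrow> (real set \<Rightarrow> ('h \<Rightarrow>\<^sub>L 'h)) \<Rightarrow> bool"
  where "is_spectral_measure X E \<longleftrightarrow> projection_valued_measure E \<and>
    (\<forall>x. integrable (pvm_measure E x) (\<lambda>t. t) \<and>
      cinner x (blinfun_apply X x) = complex_of_real (\<integral>t. t \<partial>pvm_measure E x))"

text \<open>By the spectral theorem, the operator described here exists and is unique whenever \<open>X\<close> is
  Hermitean and \<open>S\<close> is Borel; the values of \<open>E\<close> off the Borel sets are irrelevant.\<close>

definition spectral_projection ::
    "('h :: complex_hilbert_space \<Rightarrow>\<^sub>L 'h) \<Rightarrow> real set \<Rightarrow> ('h \<Rightarrow>\<^sub>L 'h)"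
  where "spectral_projection X S = (THE P. \<exists>E. is_spectral_measure X E \<and> P = E S)"

section \<open>Von Neumann algebras and their tensor product\<close>

definition commutant ::
    "('h :: complex_hilbert_space \<Rightarrow>\<^sub>L 'h) set \<Rightarrow> ('h \<Rightarrow>\<^sub>L 'h) set"
  where "commutant N = {Y \<in> bounded_ops. \<forall>X\<in>N. X o\<^sub>L Y = Y o\<^sub>L X}"

definition von_neumann_algebra :: "('h :: complex_hilbert_space \<Rightarrow>\<^sub>L 'h) set \<Rightarrow> bool"
  where "von_neumann_algebra N \<longleftrightarrow>
    N \<subseteq> bounded_ops \<and> (\<forall>X\<in>N. \<exists>Y\<in>N. adjoint_ops X Y) \<and> commutant (commutant N) = N"

text \<open>\<open>hilbert_tensor t\<close> says that \<open>'m\<close>, with \<open>t x y\<close> in the role of the elementary tensor of \<open>x\<close>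
  and \<open>y\<close>, is the Hilbert space tensor product of \<open>'h\<close> and \<open>'k\<close>; this determines \<open>('m, t)\<close> up to
  a unique unitary. The real span suffices, since the set of elementary tensors is closed under
  complex scalars.\<close>

definition hilbert_tensor ::
    "('h :: complex_hilbert_space \<Rightarrow> 'k :: complex_hilbert_space \<Rightarrow> 'm :: complex_hilbert_space) \<Rightarrow> bool"
  where "hilbert_tensor t \<longleftrightarrow>
    (\<forall>x x' y. t (x + x') y = t x y + t x' y) \<and>
    (\<forall>x y y'. t x (y + y') = t x y + t x y') \<and>
    (\<forall>c x y. t (c *\<^sub>C x) y = c *\<^sub>C t x y) \<and>
    (\<forall>c x y. t x (c *\<^sub>C y) = c *\<^sub>C t x y) \<and>
    (\<forall>x x' y y'. cinner (t x y) (t x' y') = cinner x x' * cinner y y') \<and>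
    closure (span (range (\<lambda>(x, y). t x y))) = UNIV"

definition tensor_op ::
    "('h :: complex_hilbert_space \<Rightarrow> 'k :: complex_hilbert_space \<Rightarrow> 'm :: complex_hilbert_space) \<Rightarrow>
      ('h \<Rightarrow>\<^sub>L 'h) \<Rightarrow> ('k \<Rightarrow>\<^sub>L 'k) \<Rightarrow> ('m \<Rightarrow>\<^sub>L 'm)"
  where "tensor_op t X Y = (THE Z. Z \<in> bounded_ops \<and>
    (\<forall>x y. blinfun_apply Z (t x y) = t (blinfun_apply X x) (blinfun_apply Y y)))"

definition tensor_algebra ::
    "('h :: complex_hilbert_space \<Rightarrow> 'k :: complex_hilbert_space \<Rightarrow> 'm :: complex_hilbert_space) \<Rightarrow>
      ('h \<Rightarrow>\<^sub>L 'h) set \<Rightarrow> ('k \<Rightarrow>\<^sub>L 'k) set \<Rightarrow> ('m \<Rightarrow>\<^sub>L 'm) set"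
  where "tensor_algebra t M N =
    commutant (commutant {tensor_op t X Y | X Y. X \<in> M \<and> Y \<in> N})"

section \<open>Normal states and CP-maps\<close>

text \<open>States and maps are functions on the whole operator type of which only the values on the
  algebra matter.\<close>

definition state_on ::
    "('h :: complex_hilbert_space \<Rightarrow>\<^sub>L 'h) set \<Rightarrow> (('h \<Rightarrow>\<^sub>L 'h) \<Rightarrow> complex) \<Rightarrow> bool"
  where "state_on N \<omega> \<longleftrightarrow>
    (\<forall>X\<in>N. \<forall>Y\<in>N. \<omega> (X + Y) = \<omega> X + \<omega> Y) \<and>
    (\<forall>c. \<forall>X\<in>N. \<omega> (op_scaleC c X) = c * \<omega> X) \<and>
    (\<forall>X\<in>N. positive_op X \<longrightarrow> \<omega> X \<in> \<real>\<^sub>\<ge>\<^sub>0) \<and>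
    \<omega> id_blinfun = 1"

text \<open>Normality: \<open>\<omega>\<close> preserves least upper bounds of increasing nets. The range of such a net
  is an upward directed set.\<close>

definition is_op_lub ::
    "('h :: complex_hilbert_space \<Rightarrow>\<^sub>L 'h) set \<Rightarrow> ('h \<Rightarrow>\<^sub>L 'h) set \<Rightarrow> ('h \<Rightarrow>\<^sub>L 'h) \<Rightarrow> bool"
  where "is_op_lub N D S \<longleftrightarrow> S \<in> N \<and> hermitean S \<and> (\<forall>X\<in>D. op_le X S) \<and>
    (\<forall>Y\<in>N. hermitean Y \<and> (\<forall>X\<in>D. op_le X Y) \<longrightarrow> op_le S Y)"

definition normal_state_on ::
    "('h :: complex_hilbert_space \<Rightarrow>\<^sub>L 'h) set \<Rightarrow> (('h \<Rightarrow>\<^sub>L 'h) \<Rightarrow> complex) \<Rightarrow> bool"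
  where "normal_state_on N \<omega> \<longleftrightarrow> state_on N \<omega> \<and>
    (\<forall>D S. D \<noteq> {} \<and> D \<subseteq> N \<and> (\<forall>X\<in>D. hermitean X) \<and>
      (\<forall>X\<in>D. \<forall>Y\<in>D. \<exists>Z\<in>D. op_le X Z \<and> op_le Y Z) \<and> is_op_lub N D S
      \<longrightarrow> \<omega> S = complex_of_real (SUP X\<in>D. Re (\<omega> X)))"

text \<open>Positivity of the operator matrix \<open>X\<close>, acting on the \<open>n\<close>-fold direct sum of \<open>'h\<close>.\<close>

definition positive_op_matrix ::
    "nat \<Rightarrow> (nat \<Rightarrow> nat \<Rightarrow> ('h :: complex_hilbert_space \<Rightarrow>\<^sub>L 'h)) \<Rightarrow> bool"
  where "positive_op_matrix n X \<longleftrightarrow>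
    (\<forall>x. (\<Sum>i<n. \<Sum>j<n. cinner (x i) (blinfun_apply (X i j) (x j))) \<in> \<real>\<^sub>\<ge>\<^sub>0)"

definition completely_positive ::
    "('m :: complex_hilbert_space \<Rightarrow>\<^sub>L 'm) set \<Rightarrow>
      (('m \<Rightarrow>\<^sub>L 'm) \<Rightarrow> ('h :: complex_hilbert_space \<Rightarrow>\<^sub>L 'h)) \<Rightarrow> bool"
  where "completely_positive N T \<longleftrightarrow>
    (\<forall>n X. (\<forall>i<n. \<forall>j<n. X i j \<in> N) \<and> positive_op_matrix n X
      \<longrightarrow> positive_op_matrix n (\<lambda>i j. T (X i j)))"

definition cp_map ::
    "('m :: complex_hilbert_space \<Rightarrow>\<^sub>L 'm) set \<Rightarrow> ('h :: complex_hilbert_space \<Rightarrow>\<^sub>L 'h) set \<Rightarrow>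
      (('m \<Rightarrow>\<^sub>L 'm) \<Rightarrow> ('h \<Rightarrow>\<^sub>L 'h)) \<Rightarrow> bool"
  where "cp_map N M T \<longleftrightarrow>
    T ` N \<subseteq> M \<and>
    (\<forall>X\<in>N. \<forall>Y\<in>N. T (X + Y) = T X + T Y) \<and>
    (\<forall>c. \<forall>X\<in>N. T (op_scaleC c X) = op_scaleC c (T X)) \<and>
    T id_blinfun = id_blinfun \<and>
    completely_positive N T \<and>
    (\<forall>\<omega>. normal_state_on M \<omega> \<longrightarrow> normal_state_on N (\<lambda>X. \<omega> (T X)))"

section \<open>Disturbance and quality of information transfer\<close>

definition disturbance ::
    "('h :: complex_hilbert_space \<Rightarrow> 'k :: complex_hilbert_space \<Rightarrow> 'm :: complex_hilbert_space) \<Rightarrow>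
      (('m \<Rightarrow>\<^sub>L 'm) \<Rightarrow> ('h \<Rightarrow>\<^sub>L 'h)) \<Rightarrow> real"
  where "disturbance t T =
    (SUP P \<in> {P \<in> bounded_ops. op_le 0 P \<and> op_le P id_blinfun}.
      norm (T (tensor_op t P id_blinfun) - P))"

definition transfer_error ::
    "('h :: complex_hilbert_space \<Rightarrow> 'k :: complex_hilbert_space \<Rightarrow> 'm :: complex_hilbert_space) \<Rightarrow>
      (('m \<Rightarrow>\<^sub>L 'm) \<Rightarrow> ('h \<Rightarrow>\<^sub>L 'h)) \<Rightarrow> ('h \<Rightarrow>\<^sub>L 'h) \<Rightarrow> ('k \<Rightarrow>\<^sub>L 'k) \<Rightarrow> real"
  where "transfer_error t T A B =
    (SUP S \<in> sets borel.
      norm (T (tensor_op t id_blinfun (spectral_projection B S)) - spectral_projection A S))"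

end

theory Submission
  imports Defs "HOL-Probability.Helly_Selection"
begin

text \<open>Put \<open>p = \<one>\<^sub>S(A)\<close> for a set \<open>S\<close> with \<open>p\<close> neither \<open>0\<close> nor \<open>1\<close>, take unit vectors \<open>\<psi>1\<close> and \<open>\<psi>0\<close> in the ranges of
  \<open>p\<close> and \<open>1 - p\<close>, and let \<open>P\<close> project onto the span of \<open>\<psi>1 + \<psi>0\<close>. The commuting projections
  \<open>P \<otimes> 1\<close> and \<open>1 \<otimes> \<one>\<^sub>S(B)\<close> split the unit into four projections, whose images under \<open>T\<close> are positive with
  sum \<open>1\<close>. Cauchy-Schwarz for each of them bounds \<open>2 |\<langle>\<psi>1, R(P) \<psi>0\<rangle>|\<close> by the fidelity of the two outcome
  distributions in the states \<open>\<psi>1\<close> and \<open>\<psi>0\<close>, hence by \<open>2 sqrt (\<delta> (1 - \<delta>))\<close>, while \<open>\<langle>\<psi>1, P \<psi>0\<rangle> = 1/2\<close> bounds it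
  below by \<open>1 - 2 \<Delta>\<close>. Equality holds for \<open>T(X) = V\<^sup>* X V\<close> with \<open>V e\<^sub>i = e\<^sub>i \<otimes> \<phi>\<^sub>i\<close>, where
  \<open>\<langle>\<phi>\<^sub>1, \<phi>\<^sub>2\<rangle> = 1 - 2 \<Delta>\<close> and the vectors \<open>\<phi>\<^sub>i\<close> are mirror images in the diagonal.

  The spectral measure of a contraction \<open>0 \<le> A \<le> 1\<close> comes from the Hausdorff moment problem for
  \<open>\<langle>x, A\<^sup>k (1 - A)\<^sup>l x\<rangle>\<close>.\<close>

text \<open>Much of the length serves to make the ingredients exist.
  \<open>spectral_projection\<close> and \<open>tensor_op\<close> are definite descriptions and both
  figures of merit are suprema, so existence, uniqueness and boundedness come before any use of
  their values. A spectral measure is specified only weakly, by its diagonal forms. Uniqueness is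
  therefore reached by commutation: the measure constructed commutes with whatever commutes with
  \<open>A\<close>, every other spectral measure commutes with \<open>A\<close>, and a commuting
  pair is compared on half-lines. The same property places the spectral projections of
  \<open>B\<close> in the von Neumann algebra, so that \<open>T\<close> may be applied to their
  ampliations. The factor 2 in the fidelity estimate comes from orthogonality of
  \<open>\<psi>1\<close> and \<open>\<psi>0\<close>: the off-diagonal entries of the four positive
  operators sum to 0, so the entry belonging to \<open>P\<close> and the one belonging to its
  complement have equal modulus. For sharpness the delicate point is normality of the compression,
  since least upper bounds are taken inside the algebra; compactness in finite dimension settles
  it.\<close>

section \<open>Inner products, positive forms and operators\<close>

abbreviation rinner :: "'h::complex_hilbert_space \<Rightarrow> 'h \<Rightarrow> real"
  where "rinner x y \<equiv> Re (cinner x y)"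

lemma scaleC_one: "1 *\<^sub>C x = (x :: 'h::complex_hilbert_space)"
  using scaleR_scaleC[of 1 x] by simp

lemma scaleC_zero: "0 *\<^sub>C x = (0 :: 'h::complex_hilbert_space)"
  using scaleR_scaleC[of 0 x] by simp

lemma cinner_add_left: "cinner (x + y) z = cinner x z + cinner y z"
  by (metis cinner_add_right cinner_commute complex_cnj_add)

lemma cinner_scaleC_left: "cinner (c *\<^sub>C x) y = cnj c * cinner x y"
  by (metis cinner_scaleC_right cinner_commute complex_cnj_mult)

lemma cinner_scaleR_right: "cinner x (r *\<^sub>R y) = of_real r * cinner x y"
  by (simp add: scaleR_scaleC cinner_scaleC_right)

lemma cinner_scaleR_left: "cinner (r *\<^sub>R x) y = of_real r * cinner x y"
  by (simp add: scaleR_scaleC cinner_scaleC_left)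

lemma cinner_minus_right: "cinner x (- y) = - cinner x y"
  using cinner_scaleR_right[of x "-1" y] by simp

lemma cinner_minus_left: "cinner (- x) y = - cinner x y"
  using cinner_scaleR_left[of "-1" x y] by simp

lemma cinner_diff_right: "cinner x (y - z) = cinner x y - cinner x z"
  by (simp only: diff_conv_add_uminus cinner_add_right cinner_minus_right)

lemma cinner_diff_left: "cinner (x - y) z = cinner x z - cinner y z"
  by (simp only: diff_conv_add_uminus cinner_add_left cinner_minus_left)

lemma cinner_zero_right: "cinner x 0 = 0"
  using cinner_scaleR_right[of x 0 0] by simp

lemma cinner_zero_left: "cinner 0 x = 0"
  using cinner_scaleR_left[of 0 0 x] by simp

lemmas cinner_linear = cinner_add_left cinner_add_right cinner_diff_left cinner_diff_right
  cinner_minus_left cinner_minus_right cinner_scaleR_left cinner_scaleR_right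
  cinner_zero_left cinner_zero_right cinner_scaleC_left cinner_scaleC_right

lemma cinner_sum_right: "cinner x (\<Sum>i\<in>I. f i) = (\<Sum>i\<in>I. cinner x (f i))"
  by (induction I rule: infinite_finite_induct) (auto simp: cinner_linear)

lemma cinner_sum_left: "cinner (\<Sum>i\<in>I. f i) x = (\<Sum>i\<in>I. cinner (f i) x)"
  by (induction I rule: infinite_finite_induct) (auto simp: cinner_linear)

lemma rinner_commute: "rinner x y = rinner y x"
  by (subst cinner_commute) simp

lemma rinner_same: "rinner x x = (norm x)\<^sup>2"
  by (simp add: cinner_same)

lemma rinner_same_nonneg: "0 \<le> rinner x x"
  by (simp add: rinner_same)

lemma norm_add_sq: "(norm (x + y :: 'h::complex_hilbert_space))\<^sup>2 = (norm x)\<^sup>2 + 2 * rinner x y + (norm y)\<^sup>2"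
  using rinner_commute[of y x] by (simp add: rinner_same[symmetric] cinner_linear)

lemma norm_diff_sq: "(norm (x - y :: 'h::complex_hilbert_space))\<^sup>2 = (norm x)\<^sup>2 - 2 * rinner x y + (norm y)\<^sup>2"
  using norm_add_sq[of x "- y"] by (simp add: cinner_linear)

lemma rinner_eqI:
  assumes "\<And>y. rinner y x = rinner y z"
  shows "x = z"
proof -
  have "rinner (x - z) (x - z) = 0"
    using assms[of "x - z"] by (simp add: cinner_diff_right)
  then show ?thesis
    by (simp add: rinner_same)
qed

lemma cinner_ii: "cinner (\<i> *\<^sub>C x) (\<i> *\<^sub>C y) = cinner x y"
  by (simp add: cinner_linear flip: mult.assoc)

text \<open>For \<open>c > 0\<close> this is the value at the minimum \<open>s = - b / c\<close>.
  The sign of \<open>c\<close> is not given: \<open>c < 0\<close> is impossible because the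
  quadratic would become negative, and \<open>c = 0\<close> forces \<open>b = 0\<close>.\<close>

lemma quadratic_nonneg_discriminant:
  fixes a b c :: real
  assumes "\<And>s. 0 \<le> a + 2 * s * b + s\<^sup>2 * c"
  shows "b\<^sup>2 \<le> a * c"
proof (cases "c = 0")
  case True
  have "b = 0"
  proof (rule ccontr)
    assume "b \<noteq> 0"
    \<comment> \<open>At \<open>s = - (a + 1) / (2 * b)\<close> the affine function takes the value
      -1.\<close>
    then show False
      using assms[of "- (a + 1) / (2 * b)"] True by (simp add: field_simps)
  qed
  then show ?thesis
    using assms[of 0] True by simp
next
  case False
  have "c > 0"
  proof (rule ccontr)
    assume "\<not> c > 0"
    then have "c < 0"
      using False by simp
    \<comment> \<open>Chosen so that \<open>s \<ge> 1\<close> and \<open>- (s * c)\<close> exceeds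
      \<open>\<bar>a\<bar> + 2 * \<bar>b\<bar>\<close>; the quadratic term then dominates the other
      two.\<close>
    define s where "s = (\<bar>a\<bar> + 2 * \<bar>b\<bar> + 1) / - c + 1"
    have s: "1 \<le> s" "- (s * c) = \<bar>a\<bar> + 2 * \<bar>b\<bar> + 1 - c"
      using \<open>c < 0\<close> by (auto simp: s_def field_simps divide_nonneg_neg)
    have "s * (\<bar>a\<bar> + 2 * \<bar>b\<bar> + 1 - c) = s * \<bar>a\<bar> + s * (2 * \<bar>b\<bar>) + s * (1 - c)"
      by (simp add: algebra_simps)
    moreover have "1 * \<bar>a\<bar> \<le> s * \<bar>a\<bar>" "s * (2 * b) \<le> s * (2 * \<bar>b\<bar>)" "0 < s * (1 - c)"
      using s(1) \<open>c < 0\<close> by (intro mult_left_mono mult_right_mono mult_pos_pos; simp)+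
    moreover have "s\<^sup>2 * c = - (s * (\<bar>a\<bar> + 2 * \<bar>b\<bar> + 1 - c))"
      unfolding s(2)[symmetric] by (simp add: power2_eq_square)
    moreover have "2 * s * b = s * (2 * b)" "1 * \<bar>a\<bar> = \<bar>a\<bar>"
      by simp_all
    ultimately show False
      using assms[of s] by linarith
  qed
  then show ?thesis
    using assms[of "- b / c"] by (simp add: field_simps power2_eq_square)
qed

text \<open>Polarization: reality of the diagonal at \<open>x + y\<close> controls the imaginary
  part of the sum of the two cross terms, reality at \<open>x + \<i> y\<close> the real part of
  their difference.\<close>

lemma cinner_positive_form:
  fixes Z :: "'h::complex_hilbert_space \<Rightarrow>\<^sub>L 'h"
  assumes "positive_op Z"
  shows "cinner y (Z x) = cnj (cinner x (Z y))"
proof -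
  have lin: "Z (c *\<^sub>C u) = c *\<^sub>C Z u" for c u
    using assms by (auto simp: positive_op_def bounded_ops_def)
  have im: "Im (cinner u (Z u)) = 0" for u
    using assms by (auto simp: positive_op_def complex_nonneg_Reals_iff)
  have "Im (cinner x (Z y) + cinner y (Z x)) = 0"
    using im[of "x + y"] im[of x] im[of y] by (simp add: blinfun.add_right cinner_linear)
  moreover have "Re (cinner x (Z y) - cinner y (Z x)) = 0"
    using im[of "x + \<i> *\<^sub>C y"] im[of x] im[of y]
    by (simp add: blinfun.add_right cinner_linear lin)
  ultimately show ?thesis
    by (simp add: complex_eq_iff)
qed

lemma positive_op_hermitean:
  assumes "positive_op Z"
  shows "hermitean Z"
  unfolding hermitean_def adjoint_ops_def
proof (intro conjI allI)
  show "Z \<in> bounded_ops"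
    using assms by (simp add: positive_op_def)
  show "cinner (Z x) y = cinner x (Z y)" for x y
    using cinner_positive_form[OF assms, of y x] cinner_commute[of "Z x" y] by simp
qed

text \<open>The form of \<open>Z\<close> is only semidefinite, so the argument goes through the
  discriminant of its restriction to a real line; this bounds the real part, and a phase recovers
  the modulus.\<close>

lemma positive_op_cauchy_schwarz:
  fixes Z :: "'h::complex_hilbert_space \<Rightarrow>\<^sub>L 'h"
  assumes "positive_op Z"
  shows "(cmod (cinner x (Z y)))\<^sup>2 \<le> rinner x (Z x) * rinner y (Z y)"
proof -
  have lin: "Z (c *\<^sub>C u) = c *\<^sub>C Z u" for c u
    using assms by (auto simp: positive_op_def bounded_ops_def)
  have real: "(rinner x (Z y))\<^sup>2 \<le> rinner x (Z x) * rinner y (Z y)" for x y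
  proof (rule quadratic_nonneg_discriminant)
    fix s :: real
    have "0 \<le> rinner (x + s *\<^sub>R y) (Z (x + s *\<^sub>R y))"
      using assms by (auto simp: positive_op_def complex_nonneg_Reals_iff)
    also have "\<dots> = rinner x (Z x) + 2 * s * rinner x (Z y) + s\<^sup>2 * rinner y (Z y)"
      using cinner_positive_form[OF assms, of y x]
      by (simp add: blinfun.add_right blinfun.scaleR_right cinner_linear algebra_simps power2_eq_square)
    finally show "0 \<le> rinner x (Z x) + 2 * s * rinner x (Z y) + s\<^sup>2 * rinner y (Z y)" .
  qed
  \<comment> \<open>Rotating \<open>y\<close> by this phase turns the cross term into its modulus
    and leaves the diagonal term at \<open>y\<close> unchanged.\<close>
  obtain u where u: "cmod u = 1" "u * cinner x (Z y) = of_real (cmod (cinner x (Z y)))"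
  proof (cases "cinner x (Z y) = 0")
    case False
    then show ?thesis
      by (intro that[of "cnj (cinner x (Z y)) / of_real (cmod (cinner x (Z y)))"])
        (auto simp: norm_divide field_simps complex_norm_square[symmetric] power2_eq_square)
  qed (auto intro: that[of 1])
  have uu: "cnj u * u = 1"
    using u(1) complex_norm_square[of u] by (simp add: mult.commute)
  have "cinner x (Z (u *\<^sub>C y)) = of_real (cmod (cinner x (Z y)))"
    by (simp add: lin cinner_linear u(2))
  moreover have "cinner (u *\<^sub>C y) (Z (u *\<^sub>C y)) = cinner y (Z y)"
    using uu by (simp add: lin cinner_linear mult.commute flip: mult.assoc)
  ultimately show ?thesis
    using real[of x "u *\<^sub>C y"] by simp
qed

lemma bounded_opsI: "(\<And>c x. blinfun_apply X (c *\<^sub>C x) = c *\<^sub>C X x) \<Longrightarrow> X \<in> bounded_ops"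
  by (simp add: bounded_ops_def)

lemma bounded_ops_scaleC: "X \<in> bounded_ops \<Longrightarrow> blinfun_apply X (c *\<^sub>C x) = c *\<^sub>C X x"
  by (simp add: bounded_ops_def)

lemma scaleC_diff_right: "c *\<^sub>C (x - y) = c *\<^sub>C x - c *\<^sub>C (y :: 'h::complex_hilbert_space)"
  using scaleC_add_right[of c "x - y" y] by simp

lemma scaleC_zero_right: "c *\<^sub>C 0 = (0 :: 'h::complex_hilbert_space)"
  using scaleC_diff_right[of c 0 0] by simp

lemma scaleC_scaleR: "c *\<^sub>C (r *\<^sub>R x) = r *\<^sub>R (c *\<^sub>C (x :: 'h::complex_hilbert_space))"
  by (simp add: scaleR_scaleC scaleC_scaleC mult.commute)

lemma bounded_ops_id: "id_blinfun \<in> bounded_ops"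
  and bounded_ops_compose: "X \<in> bounded_ops \<Longrightarrow> Y \<in> bounded_ops \<Longrightarrow> X o\<^sub>L Y \<in> bounded_ops"
  and bounded_ops_add: "X \<in> bounded_ops \<Longrightarrow> Y \<in> bounded_ops \<Longrightarrow> X + Y \<in> bounded_ops"
  and bounded_ops_diff: "X \<in> bounded_ops \<Longrightarrow> Y \<in> bounded_ops \<Longrightarrow> X - Y \<in> bounded_ops"
  and bounded_ops_scaleR: "X \<in> bounded_ops \<Longrightarrow> r *\<^sub>R X \<in> bounded_ops"
  by (auto simp: bounded_ops_def blinfun.add_left blinfun.diff_left blinfun.scaleR_left
      scaleC_add_right scaleC_diff_right scaleC_scaleR scaleC_zero_right)

lemma scalar_op_apply: "scalar_op c x = c *\<^sub>C x"
  by (simp add: scalar_op.rep_eq)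

lemma op_scaleC_apply: "op_scaleC c X x = c *\<^sub>C X x"
  by (simp add: op_scaleC_def scalar_op_apply)

lemma positive_op_id: "positive_op id_blinfun"
  by (auto simp: positive_op_def bounded_ops_id cinner_same complex_nonneg_Reals_iff)

lemma cinner_cauchy_schwarz: "cmod (cinner x y) \<le> norm x * norm y"
proof -
  have "(cmod (cinner x y))\<^sup>2 \<le> (norm x * norm y)\<^sup>2"
    using positive_op_cauchy_schwarz[OF positive_op_id, of x y] by (simp add: rinner_same power_mult_distrib)
  then show ?thesis
    by (simp add: power2_le_iff_abs_le)
qed

lemma rinner_cauchy_schwarz: "\<bar>rinner x y\<bar> \<le> norm x * norm y"
  using abs_Re_le_cmod cinner_cauchy_schwarz order_trans by blast

lemma bounded_bilinear_rinner: "bounded_bilinear rinner"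
  by standard (auto simp: cinner_linear intro!: exI[of _ 1] rinner_cauchy_schwarz)

lemma hermitean_cinner: "hermitean X \<Longrightarrow> cinner (X x) y = cinner x (X y)"
  by (simp add: hermitean_def adjoint_ops_def)

lemma hermitean_bounded_ops: "hermitean X \<Longrightarrow> X \<in> bounded_ops"
  by (simp add: hermitean_def)

text \<open>Complex linearity lets \<open>x\<close> be replaced by \<open>\<i> x\<close>, which
  turns the identity of real parts into that of imaginary parts.\<close>

lemma hermiteanI:
  assumes "X \<in> bounded_ops" "\<And>x y. rinner (X x) y = rinner x (X y)"
  shows "hermitean X"
  unfolding hermitean_def adjoint_ops_def
proof (intro conjI allI assms(1))
  fix x y
  have "Im (cinner (X x) y) = rinner (\<i> *\<^sub>C X x) y * - 1 * - 1"
    by (simp add: cinner_linear)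
  also have "\<dots> = Im (cinner x (X y))"
    using assms(2)[of "\<i> *\<^sub>C x" y] by (simp add: cinner_linear bounded_ops_scaleC[OF assms(1)])
  finally show "cinner (X x) y = cinner x (X y)"
    using assms(2)[of x y] by (simp add: complex_eq_iff)
qed

lemma hermitean_id: "hermitean id_blinfun"
  and hermitean_add: "hermitean X \<Longrightarrow> hermitean Y \<Longrightarrow> hermitean (X + Y)"
  and hermitean_diff: "hermitean X \<Longrightarrow> hermitean Y \<Longrightarrow> hermitean (X - Y)"
  and hermitean_scaleR: "hermitean X \<Longrightarrow> hermitean (r *\<^sub>R X)"
  by (auto simp: hermitean_def bounded_ops_id bounded_ops_add bounded_ops_diff
      bounded_ops_scaleR adjoint_ops_def blinfun.add_left blinfun.diff_left blinfun.scaleR_left cinner_linear)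

lemma cinner_hermitean_real:
  assumes "hermitean X"
  shows "Im (cinner x (X x)) = 0"
proof -
  have "cinner x (X x) = cnj (cinner x (X x))"
    using hermitean_cinner[OF assms, of x x] cinner_commute[of x "X x"] by simp
  then show ?thesis
    by (simp add: complex_eq_iff)
qed

lemma positive_opI:
  assumes "hermitean X" "\<And>x. 0 \<le> rinner x (X x)"
  shows "positive_op X"
  using assms by (auto simp: positive_op_def complex_nonneg_Reals_iff hermitean_bounded_ops cinner_hermitean_real)

lemma positive_opD: "positive_op X \<Longrightarrow> 0 \<le> rinner x (X x)"
  by (auto simp: positive_op_def complex_nonneg_Reals_iff)

lemma hermitean_eqI:
  assumes "hermitean X" "hermitean Y" "\<And>x. rinner x (X x) = rinner x (Y x)"
  shows "X = Y"
proof (rule blinfun_eqI, rule rinner_eqI)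
  fix x y
  have polar: "rinner x (Z y) = (rinner (x + y) (Z (x + y)) - rinner x (Z x) - rinner y (Z y)) / 2"
    if "hermitean Z" for x y and Z :: "'a \<Rightarrow>\<^sub>L 'a"
    using hermitean_cinner[OF that, of y x] rinner_commute[of "Z y" x]
    by (simp add: blinfun.add_right cinner_linear)
  show "rinner y (X x) = rinner y (Y x)"
    using polar[OF assms(1), of y x] polar[OF assms(2), of y x] by (simp only: assms(3))
qed

text \<open>Cauchy-Schwarz for the form of \<open>X\<close> at the pair \<open>X x\<close>,
  \<open>x\<close> bounds the fourth power of \<open>norm (X x)\<close> by
  \<open>(norm (X x))\<^sup>2 * (norm x)\<^sup>2\<close>, and one square cancels.\<close>

lemma positive_op_norm_le_one:
  assumes "positive_op X" "\<And>x. rinner x (X x) \<le> (norm x)\<^sup>2"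
  shows "norm X \<le> 1"
proof (rule norm_blinfun_bound)
  fix x
  have "(rinner (X x) (X x))\<^sup>2 \<le> rinner (X x) (X (X x)) * rinner x (X x)"
    using positive_op_cauchy_schwarz[OF assms(1), of "X x" x]
    by (simp add: cinner_same flip: of_real_power)
  also have "\<dots> \<le> (norm (X x))\<^sup>2 * (norm x)\<^sup>2"
    by (intro mult_mono assms(2) positive_opD[OF assms(1)]) auto
  finally have "(norm (X x))\<^sup>2 * (norm (X x))\<^sup>2 \<le> (norm (X x))\<^sup>2 * (norm x)\<^sup>2"
    by (simp add: rinner_same power2_eq_square[of "(norm (X x))\<^sup>2"])
  then have "norm (X x) \<le> norm x"
    by (cases "X x = 0") (auto simp only: mult_le_cancel_left_pos zero_less_power zero_less_norm_iff
        norm_zero norm_ge_zero power2_le_imp_le not_False_eq_True simp_thms)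
  then show "norm (X x) \<le> 1 * norm x"
    by simp
qed simp

section \<open>Riesz representation and operators defined by forms\<close>

lemma riesz_representation:
  fixes f :: "'h::complex_hilbert_space \<Rightarrow> real"
  assumes "bounded_linear f"
  obtains z where "\<And>y. f y = rinner z y"
proof -
  interpret f: bounded_linear f by fact
  obtain K where K: "\<And>y. norm (f y) \<le> norm y * K"
    using f.bounded by blast
  define J where "J y = (norm y)\<^sup>2 - 2 * f y" for y
  have lower: "- K\<^sup>2 \<le> J y" for y
  proof -
    have "0 \<le> (norm y - K)\<^sup>2"
      by simp
    then show ?thesis
      using K[of y] unfolding J_def by (simp add: power2_eq_square algebra_simps)
  qed
  define m where "m = Inf (range J)"
  have m_le: "m \<le> J y" for y
    unfolding m_def using lower by (intro cInf_lower bdd_belowI[of _ "- K\<^sup>2"]) auto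
  have "\<exists>y. J y < m + inverse (real (Suc n))" for n
    using cInf_lessD[of "range J" "m + inverse (real (Suc n))"] unfolding m_def by auto
  then obtain y where y: "\<And>n. J (y n) < m + inverse (real (Suc n))"
    by metis
  \<comment> \<open>Parallelogram law: the midpoint cannot lie below the infimum, so two
    near-minimizers are close to each other.\<close>
  have close: "(norm (y n - y k))\<^sup>2 \<le> 2 * inverse (real (Suc n)) + 2 * inverse (real (Suc k))" for n k
  proof -
    have "(norm (y n - y k))\<^sup>2 = 2 * J (y n) + 2 * J (y k) - 4 * J ((1/2) *\<^sub>R (y n + y k))"
      using rinner_commute[of "y k" "y n"]
      by (simp add: J_def f.scaleR f.add power_mult_distrib norm_add_sq norm_diff_sq cinner_linear
          scaleR_add_right field_simps)
    then show ?thesis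
      using y[of n] y[of k] m_le[of "(1/2) *\<^sub>R (y n + y k)"] by linarith
  qed
  have "Cauchy y"
  proof (rule metric_CauchyI)
    fix e :: real assume "0 < e"
    then obtain N where N: "inverse (real (Suc N)) < e\<^sup>2 / 4"
      using reals_Archimedean[of "e\<^sup>2 / 4"] by auto
    show "\<exists>M. \<forall>n\<ge>M. \<forall>k\<ge>M. dist (y n) (y k) < e"
    proof (intro exI[of _ N] allI impI)
      fix n k assume "N \<le> n" "N \<le> k"
      then have "inverse (real (Suc n)) \<le> inverse (real (Suc N))" "inverse (real (Suc k)) \<le> inverse (real (Suc N))"
        by (auto intro: le_imp_inverse_le)
      then have "(norm (y n - y k))\<^sup>2 < e\<^sup>2"
        using close[of n k] N by linarith
      then show "dist (y n) (y k) < e"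
        using \<open>0 < e\<close> by (simp add: dist_norm power_less_imp_less_base)
    qed
  qed
  then obtain z where z: "y \<longlonglongrightarrow> z"
    by (auto simp: Cauchy_convergent_iff convergent_def)
  have "(\<lambda>n. J (y n)) \<longlonglongrightarrow> J z"
    unfolding J_def by (intro tendsto_intros z f.tendsto)
  moreover have "(\<lambda>n. m + inverse (real (Suc n))) \<longlonglongrightarrow> m + 0"
    by (intro tendsto_intros LIMSEQ_inverse_real_of_nat)
  ultimately have Jz: "J z \<le> m"
    using y by (auto intro: LIMSEQ_le less_imp_le)
  have "f x = rinner z x" for x
  proof -
    \<comment> \<open>First variation at the minimizer: a nonnegative quadratic in \<open>s\<close>
      with constant term 0 has linear term 0.\<close>
    have "(rinner z x - f x)\<^sup>2 \<le> 0 * (norm x)\<^sup>2"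
    proof (rule quadratic_nonneg_discriminant)
      fix s :: real
      have "J z \<le> J (z + s *\<^sub>R x)"
        using Jz m_le by (rule order_trans)
      also have "\<dots> = J z + 2 * s * (rinner z x - f x) + s\<^sup>2 * (norm x)\<^sup>2"
        by (simp add: J_def norm_add_sq f.add f.scaleR cinner_linear power_mult_distrib algebra_simps)
      finally show "0 \<le> 0 + 2 * s * (rinner z x - f x) + s\<^sup>2 * (norm x)\<^sup>2"
        by simp
    qed
    then show ?thesis
      by simp
  qed
  then show thesis
    using that by blast
qed

text \<open>Riesz in the first argument yields a real-linear operator. Since \<open>rinner\<close>
  is itself invariant under simultaneous rotation of both arguments by \<open>\<i>\<close>, the
  hypothesis \<open>ii\<close> makes this operator complex linear.\<close>

lemma form_operator:
  fixes b :: "'h::complex_hilbert_space \<Rightarrow> 'h \<Rightarrow> real"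
  assumes "bounded_bilinear b" and ii: "\<And>x y. b (\<i> *\<^sub>C x) (\<i> *\<^sub>C y) = b x y"
  obtains Z :: "'h \<Rightarrow>\<^sub>L 'h" where "Z \<in> bounded_ops" "\<And>x y. b x y = rinner x (Z y)"
proof -
  interpret b: bounded_bilinear b by fact
  have "\<exists>z. \<forall>x. b x y = rinner x z" for y
    using riesz_representation[OF b.bounded_linear_left[of y]] rinner_commute by metis
  then obtain z where z: "\<And>x y. b x y = rinner x (z y)"
    by metis
  obtain K where K: "\<And>x y. norm (b x y) \<le> norm x * norm y * K" "0 < K"
    using b.pos_bounded by blast
  have "bounded_linear z"
  proof (rule bounded_linear_intro[where K=K])
    show "z (x + y) = z x + z y" for x y
      by (rule rinner_eqI) (simp add: z[symmetric] cinner_add_right b.add_right)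
    show "z (r *\<^sub>R x) = r *\<^sub>R z x" for r x
      by (rule rinner_eqI) (simp add: z[symmetric] cinner_scaleR_right b.scaleR_right)
    fix x
    have "norm (z x) * norm (z x) \<le> norm (z x) * (norm x * K)"
      using K(1)[of "z x" x] by (simp add: z rinner_same power2_eq_square mult.assoc)
    then show "norm (z x) \<le> norm x * K"
      using K(2) by (cases "z x = 0") auto
  qed
  then have Z: "blinfun_apply (Blinfun z) = z"
    by (rule bounded_linear_Blinfun_apply)
  have zi: "z (\<i> *\<^sub>C y) = \<i> *\<^sub>C z y" for y
  proof (rule rinner_eqI)
    fix x :: 'h
    have "\<i> *\<^sub>C (- \<i>) *\<^sub>C x = x"
      by (simp add: scaleC_scaleC scaleC_one)
    then show "rinner x (z (\<i> *\<^sub>C y)) = rinner x (\<i> *\<^sub>C z y)"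
      using ii[of "(- \<i>) *\<^sub>C x" y] by (simp add: z cinner_linear)
  qed
  have "z (c *\<^sub>C y) = c *\<^sub>C z y" for c y
  proof -
    have c: "c *\<^sub>C u = Re c *\<^sub>R u + Im c *\<^sub>R (\<i> *\<^sub>C u)" for u :: 'h
      by (subst complex_eq[of c]) (simp only: scaleC_add_left scaleR_scaleC scaleC_scaleC mult.commute)
    interpret z: bounded_linear z by fact
    show ?thesis
      by (simp only: c z.add z.scaleR zi)
  qed
  then have "Blinfun z \<in> bounded_ops"
    by (intro bounded_opsI) (simp add: Z)
  then show thesis
    using that[of "Blinfun z"] by (simp add: Z z)
qed

lemma adjoint_exists:
  fixes Y :: "'h::complex_hilbert_space \<Rightarrow>\<^sub>L 'h"
  assumes "Y \<in> bounded_ops"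
  obtains Z :: "'h \<Rightarrow>\<^sub>L 'h" where "Z \<in> bounded_ops" "\<And>x y. rinner (Y x) y = rinner x (Z y)"
proof (rule form_operator[of "\<lambda>x y. rinner (Y x) y"])
  show "bounded_bilinear (\<lambda>x y. rinner (Y x) y)"
    by (rule bounded_bilinear.comp1[OF bounded_bilinear_rinner blinfun.bounded_linear_right])
qed (auto simp: bounded_ops_scaleC[OF assms] cinner_ii intro: that)

section \<open>The Hausdorff moment problem\<close>

lemma filterlim_at_top_diff_const:
  assumes "filterlim f at_top F"
  shows "filterlim (\<lambda>x. f x - c :: real) at_top F"
  using filterlim_tendsto_add_at_top[OF tendsto_const[of "- c"] assms] by simp

text \<open>In the model, \<open>g k l\<close> is the integral of t^k (1 - t)^l, \<open>rec\<close>
  is the identity t + (1 - t) = 1, and the claim is the binomial expansion of (t + (1 -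
  t))^n.\<close>

lemma binomial_sum_array:
  fixes g :: "nat \<Rightarrow> nat \<Rightarrow> real"
  assumes rec: "\<And>k l. g k l = g (Suc k) l + g k (Suc l)"
  shows "(\<Sum>j\<le>n. real (n choose j) * g (k + j) (l + (n - j))) = g k l"
proof (induction n arbitrary: k l)
  case 0
  then show ?case by simp
next
  case (Suc n)
  define f where "f j = g (k + j) (l + (Suc n - j))" for j
  have "(\<Sum>j\<le>Suc n. real (Suc n choose j) * f j)
      = f 0 + (\<Sum>j\<le>n. real (Suc n choose Suc j) * f (Suc j))"
    by (subst sum.atMost_Suc_shift) simp
  also have "\<dots> = (f 0 + (\<Sum>j\<le>n. real (n choose Suc j) * f (Suc j)))
      + (\<Sum>j\<le>n. real (n choose j) * f (Suc j))"
    by (simp add: sum.distrib algebra_simps)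
  also have "f 0 + (\<Sum>j\<le>n. real (n choose Suc j) * f (Suc j)) = (\<Sum>j\<le>Suc n. real (n choose j) * f j)"
    by (subst sum.atMost_Suc_shift) simp
  also have "\<dots> = (\<Sum>j\<le>n. real (n choose j) * f j)"
    by simp
  also have "\<dots> = (\<Sum>j\<le>n. real (n choose j) * g (k + j) (Suc l + (n - j)))"
    by (rule sum.cong) (auto simp: f_def Suc_diff_le)
  also have "\<dots> = g k (Suc l)"
    by (rule Suc.IH)
  also have "(\<Sum>j\<le>n. real (n choose j) * f (Suc j))
      = (\<Sum>j\<le>n. real (n choose j) * g (Suc k + j) (l + (n - j)))"
    by (rule sum.cong) (auto simp: f_def)
  also have "\<dots> = g (Suc k) l"
    by (rule Suc.IH)
  finally show ?case
    using rec[of k l] by (simp add: f_def)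
qed

text \<open>The ratios \<open>(k choose m) / (n choose m)\<close> are the coefficients of t^m in the
  Bernstein basis of degree \<open>n\<close>. Hence this discrete moment is exact, and only the
  passage from these ratios to powers of k/n costs an error.\<close>

lemma binomial_ratio_moment:
  fixes g :: "nat \<Rightarrow> nat \<Rightarrow> real"
  assumes rec: "\<And>k l. g k l = g (Suc k) l + g k (Suc l)" and "m \<le> n"
  shows "(\<Sum>k\<le>n. real (n choose k) * g k (n - k) * (real (k choose m) / real (n choose m))) = g m 0"
proof -
  have "(\<Sum>k\<le>n. real (n choose k) * g k (n - k) * (real (k choose m) / real (n choose m)))
      = (\<Sum>k\<in>{m..n}. real (n choose k) * g k (n - k) * (real (k choose m) / real (n choose m)))"
    by (rule sum.mono_neutral_right) auto
  also have "\<dots> = (\<Sum>k\<in>{m..n}. real ((n - m) choose (k - m)) * g k (n - k))"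
  proof (rule sum.cong[OF refl])
    fix k assume k: "k \<in> {m..n}"
    have "(n choose k) * (k choose m) = (n choose m) * ((n - m) choose (k - m))"
      using k by (intro choose_mult) auto
    then have "real (n choose k) * real (k choose m) = real (n choose m) * real ((n - m) choose (k - m))"
      by (metis of_nat_mult)
    moreover have "real (n choose m) \<noteq> 0"
      using \<open>m \<le> n\<close> by simp
    ultimately show "real (n choose k) * g k (n - k) * (real (k choose m) / real (n choose m))
        = real ((n - m) choose (k - m)) * g k (n - k)"
      by (simp add: field_simps)
  qed
  also have "\<dots> = (\<Sum>j\<le>n - m. real ((n - m) choose j) * g (m + j) (0 + (n - m - j)))"
    by (rule sum.reindex_bij_witness[where i="\<lambda>j. m + j" and j="\<lambda>k. k - m"])
      (use \<open>m \<le> n\<close> in auto)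
  also have "\<dots> = g m 0"
    by (rule binomial_sum_array[of g, OF rec])
  finally show ?thesis .
qed

text \<open>Both sides are products of \<open>m\<close> factors, k/n against (k - i)/(n - i), all of
  modulus at most 1; the difference of the products is then at most the sum of the differences of
  the factors.\<close>

lemma power_binomial_ratio_diff:
  assumes "k \<le> n" "2 * m < n"
  shows "\<bar>(real k / real n) ^ m - real (k choose m) / real (n choose m)\<bar> \<le> real m * (real m / (real n - real m))"
proof -
  have ratio: "real (k choose m) / real (n choose m) = (\<Prod>i\<in>{0..<m}. (real k - real i) / (real n - real i))"
    by (simp add: binomial_gbinomial gbinomial_prod_rev prod_dividef)
  have "norm ((\<Prod>i\<in>{0..<m}. real k / real n) - (\<Prod>i\<in>{0..<m}. (real k - real i) / (real n - real i)))
      \<le> (\<Sum>i\<in>{0..<m}. norm (real k / real n - (real k - real i) / (real n - real i)))"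
  proof (rule norm_prod_diff)
    fix i assume i: "i \<in> {0..<m}"
    show "norm (real k / real n) \<le> 1"
      using assms by simp
    \<comment> \<open>The factor is negative for \<open>k < i\<close>; \<open>2 * m < n\<close>
      keeps its modulus at most 1 even then.\<close>
    have "real n - real i > 0" "\<bar>real k - real i\<bar> \<le> real n - real i"
      using i assms by auto
    then show "norm ((real k - real i) / (real n - real i)) \<le> 1"
      by simp
  qed
  also have "\<dots> \<le> (\<Sum>i\<in>{0..<m}. real m / (real n - real m))"
  proof (rule sum_mono)
    fix i assume i: "i \<in> {0..<m}"
    have pos: "real n - real i > 0" "real n > 0" "real n - real m > 0"
      using i assms by auto
    have "real k / real n - (real k - real i) / (real n - real i)
        = (real i / (real n - real i)) * (1 - real k / real n)"
      using pos by (simp add: field_simps)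
    also have "norm \<dots> \<le> real i / (real n - real i) * 1"
      unfolding norm_mult using assms pos by (intro mult_mono) (auto simp: field_simps)
    also have "\<dots> \<le> real m / (real n - real m)"
      using i pos by (simp add: frac_le)
    finally show "norm (real k / real n - (real k - real i) / (real n - real i))
        \<le> real m / (real n - real m)" .
  qed
  finally show ?thesis
    by (simp add: ratio)
qed

lemma hausdorff_moment_problem:
  fixes g :: "nat \<Rightarrow> nat \<Rightarrow> real"
  assumes nonneg: "\<And>k l. 0 \<le> g k l"
    and rec: "\<And>k l. g k l = g (Suc k) l + g k (Suc l)"
    and one: "g 0 0 = 1"
  obtains M where "real_distribution M" "AE t in M. t \<in> {0..1}" "\<And>m. (\<integral>t. t ^ m \<partial>M) = g m 0"
proof -
  txt \<open>\<open>w n k\<close> is the mass that the Bernstein polynomial \<open>(n choose k) t\<^sup>k (1 - t)\<^sup>n\<^sup>-\<^sup>k\<close> would have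
    under the measure sought; placing it at \<open>k / n\<close> gives approximations with nearly the right moments.\<close>
  define w where "w n k = real (n choose k) * g k (n - k)" for n k
  have w_nonneg: "0 \<le> w n k" for n k
    by (simp add: w_def nonneg)
  have w_sum: "(\<Sum>k\<le>n. w n k) = 1" for n
    using binomial_sum_array[of g n 0 0, OF rec] by (simp add: w_def one)
  define \<mu> where "\<mu> n = distr (point_measure {..n} (\<lambda>k. ennreal (w n k))) borel (\<lambda>k. real k / real n)" for n
  have prob: "prob_space (point_measure {..n} (\<lambda>k. ennreal (w n k)))" for n
    by (rule prob_spaceI) (simp add: space_point_measure emeasure_point_measure_finite
        sum_ennreal w_nonneg w_sum)
  have dist: "real_distribution (\<mu> n)" for n
    unfolding \<mu>_def by (rule prob_space.real_distribution_distr[OF prob])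
      (auto simp: measurable_def space_point_measure)
  have integral_\<mu>: "(\<integral>t. f t \<partial>\<mu> n) = (\<Sum>k\<le>n. w n k * f (real k / real n))"
    if "f \<in> borel_measurable borel" for f :: "real \<Rightarrow> real" and n
    unfolding \<mu>_def
    by (subst integral_distr[OF _ that])
      (auto simp: measurable_def space_point_measure lebesgue_integral_point_measure_finite w_nonneg)
  have "AE t in \<mu> n. t \<in> {0..1}" for n
  proof -
    have "AE k in point_measure {..n} (\<lambda>k. ennreal (w n k)). real k / real n \<in> {0..1}"
      by (rule AE_I2) (auto simp: space_point_measure divide_le_eq_1)
    then show ?thesis
      unfolding \<mu>_def by (subst AE_distr_iff) (auto simp: measurable_def space_point_measure)
  qed
  note AE_\<mu> = this
  have tight: "tight \<mu>"
    unfolding tight_def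
  proof (intro conjI allI impI)
    fix \<epsilon> :: real assume "\<epsilon> > 0"
    \<comment> \<open>The interval is open on the left, so it starts at -1 to include a possible
      mass at 0.\<close>
    have "measure (\<mu> n) {-1<..1} = 1" for n
    proof -
      interpret real_distribution "\<mu> n" by (rule dist)
      have "AE t in \<mu> n. t \<in> {-1<..1}"
        using AE_\<mu>[of n] by eventually_elim auto
      then show ?thesis
        by (subst prob_eq_1) auto
    qed
    then show "\<exists>a b. a < b \<and> (\<forall>n. 1 - \<epsilon> < measure (\<mu> n) {a<..b})"
      using \<open>\<epsilon> > 0\<close> by (intro exI[of _ "-1"] exI[of _ 1]) auto
  qed (rule dist)
  obtain r M where r: "strict_mono (r :: nat \<Rightarrow> nat)" and M: "real_distribution M"
    and conv: "weak_conv_m (\<mu> \<circ> id \<circ> r) M"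
    using tight_imp_convergent_subsubsequence[OF tight strict_mono_id] by auto
  interpret M: real_distribution M by (rule M)
  have lim: "(\<lambda>n. \<integral>t. f t \<partial>\<mu> (r n)) \<longlonglongrightarrow> (\<integral>t. f t \<partial>M)"
    if "\<And>x. isCont f x" "\<And>x. norm (f x) \<le> B" for f :: "real \<Rightarrow> real" and B
    using weak_conv_imp_integral_bdd_continuous_conv[OF _ M conv that] dist by (simp add: o_def)
  \<comment> \<open>Weak convergence tests bounded continuous functions only. Clamping to the unit
    interval makes the powers bounded without changing their integrals, since all mass lies
    there.\<close>
  define c where "c t = max 0 (min 1 t)" for t :: real
  have c_cont: "isCont c x" for x
    unfolding c_def by (intro continuous_intros)
  have [measurable]: "c \<in> borel_measurable borel"
    unfolding c_def by measurable
  have c01: "0 \<le> c x" "c x \<le> 1" for x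
    by (auto simp: c_def)
  \<comment> \<open>A bounded continuous function that vanishes exactly on the unit interval: its
    integrals transport the support condition to the weak limit.\<close>
  define d where "d t = min 1 \<bar>t - c t\<bar>" for t :: real
  have d_cont: "isCont d x" for x
    unfolding d_def by (intro continuous_intros c_cont)
  have [measurable]: "d \<in> borel_measurable borel"
    unfolding d_def by measurable
  have d_zero: "d t = 0 \<longleftrightarrow> t \<in> {0..1}" for t
    by (auto simp: d_def c_def min_def max_def)
  have d_bound: "norm (d t) \<le> 1" "0 \<le> d t" for t
    by (auto simp: d_def)
  have "(\<integral>t. d t \<partial>\<mu> n) = 0" for n
    by (rule integral_eq_zero_AE) (use AE_\<mu>[of n] in eventually_elim, simp add: d_zero)
  then have "(\<integral>t. d t \<partial>M) = 0"
    using lim[OF d_cont d_bound(1)] by (simp add: LIMSEQ_const_iff)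
  then have "AE t in M. d t = 0"
    using d_bound by (subst (asm) integral_nonneg_eq_0_iff_AE)
      (auto intro!: M.integrable_const_bound[where B=1])
  then have AE_M: "AE t in M. t \<in> {0..1}"
    by (simp add: d_zero)
  have "(\<integral>t. t ^ m \<partial>M) = g m 0" for m
  proof -
    have "(\<lambda>n. \<integral>t. c t ^ m \<partial>\<mu> n) \<longlonglongrightarrow> g m 0"
    proof (rule Lim_transform_bound[where g="\<lambda>n. real m * (real m / (real n - real m))", THEN LIM_zero_cancel])
      show "(\<lambda>n. real m * (real m / (real n - real m))) \<longlonglongrightarrow> 0"
        by (intro tendsto_mult_right_zero tendsto_divide_0[OF tendsto_const]
            filterlim_at_top_imp_at_infinity filterlim_at_top_diff_const filterlim_real_sequentially)
    next
      show "\<forall>\<^sub>F n in sequentially. norm ((\<integral>t. c t ^ m \<partial>\<mu> n) - g m 0) \<le> norm (real m * (real m / (real n - real m)))"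
        using eventually_gt_at_top[of "2 * m"]
      proof eventually_elim
        case (elim n)
        have "(\<integral>t. c t ^ m \<partial>\<mu> n) = (\<Sum>k\<le>n. w n k * (c (real k / real n)) ^ m)"
          by (rule integral_\<mu>) measurable
        also have "\<dots> = (\<Sum>k\<le>n. w n k * (real k / real n) ^ m)"
          by (rule sum.cong) (use elim in \<open>auto simp: c_def divide_le_eq_1 min_def\<close>)
        finally have 1: "(\<integral>t. c t ^ m \<partial>\<mu> n) = (\<Sum>k\<le>n. w n k * (real k / real n) ^ m)" .
        have 2: "g m 0 = (\<Sum>k\<le>n. w n k * (real (k choose m) / real (n choose m)))"
          using binomial_ratio_moment[of g m n, OF rec] elim by (simp add: w_def)
        have "norm ((\<integral>t. c t ^ m \<partial>\<mu> n) - g m 0)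
            = \<bar>\<Sum>k\<le>n. w n k * ((real k / real n) ^ m - real (k choose m) / real (n choose m))\<bar>"
          unfolding 1 2 by (simp add: sum_subtractf right_diff_distrib)
        also have "\<dots> \<le> (\<Sum>k\<le>n. w n k * (real m * (real m / (real n - real m))))"
        proof (rule order_trans[OF sum_abs sum_mono])
          fix k assume "k \<in> {..n}"
          then show "\<bar>w n k * ((real k / real n) ^ m - real (k choose m) / real (n choose m))\<bar>
              \<le> w n k * (real m * (real m / (real n - real m)))"
            unfolding abs_mult abs_of_nonneg[OF w_nonneg]
            using elim by (intro mult_left_mono power_binomial_ratio_diff w_nonneg) auto
        qed
        also have "\<dots> = real m * (real m / (real n - real m))"
          unfolding sum_distrib_right[symmetric] w_sum by simp
        finally show ?case
          unfolding real_norm_def by (rule order_trans[OF _ abs_ge_self])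
      qed
    qed
    then have "(\<lambda>n. \<integral>t. c t ^ m \<partial>\<mu> (r n)) \<longlonglongrightarrow> g m 0"
      using LIMSEQ_subseq_LIMSEQ[OF _ r] by (fastforce simp: o_def)
    moreover have "(\<lambda>n. \<integral>t. c t ^ m \<partial>\<mu> (r n)) \<longlonglongrightarrow> (\<integral>t. c t ^ m \<partial>M)"
      by (rule lim[of _ 1]) (use c_cont c01 in \<open>auto intro!: continuous_intros power_le_one simp: power_abs\<close>)
    moreover have "(\<integral>t. c t ^ m \<partial>M) = (\<integral>t. t ^ m \<partial>M)"
    proof (rule integral_cong_AE)
      show "AE t in M. c t ^ m = t ^ m"
        using AE_M by eventually_elim (auto simp: c_def min_def)
    qed measurable
    ultimately show ?thesis
      using LIMSEQ_unique by metis
  qed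
  then show thesis
    using that M AE_M by blast
qed

text \<open>Countably additive set functions on the unit interval, given as functionals on bounded Borel
  functions, so that signed measures are covered as well.\<close>

definition bounded_borel :: "(real \<Rightarrow> real) set"
  where "bounded_borel = {f \<in> borel_measurable borel. \<exists>K. \<forall>t\<in>{0..1}. \<bar>f t\<bar> \<le> K}"

definition sigma_functional :: "((real \<Rightarrow> real) \<Rightarrow> real) \<Rightarrow> bool"
  where "sigma_functional \<Lambda> \<longleftrightarrow>
    (\<forall>f\<in>bounded_borel. \<forall>g\<in>bounded_borel. \<Lambda> (\<lambda>t. f t + g t) = \<Lambda> f + \<Lambda> g) \<and>
    (\<forall>c. \<forall>f\<in>bounded_borel. \<Lambda> (\<lambda>t. c * f t) = c * \<Lambda> f) \<and>
    (\<forall>F f K. (\<forall>n. F n \<in> borel_measurable borel) \<and> f \<in> borel_measurable borel \<and>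
        (\<forall>n. \<forall>t\<in>{0..1}. \<bar>F n t\<bar> \<le> K) \<and> (\<forall>t\<in>{0..1}. (\<lambda>n. F n t) \<longlonglongrightarrow> f t)
      \<longrightarrow> (\<lambda>n. \<Lambda> (F n)) \<longlonglongrightarrow> \<Lambda> f)"

lemma bounded_borel_add: "f \<in> bounded_borel \<Longrightarrow> g \<in> bounded_borel \<Longrightarrow> (\<lambda>t. f t + g t) \<in> bounded_borel"
proof -
  assume "f \<in> bounded_borel" "g \<in> bounded_borel"
  moreover from this obtain K L where "\<forall>t\<in>{0..1}. \<bar>f t\<bar> \<le> K" "\<forall>t\<in>{0..1}. \<bar>g t\<bar> \<le> L"
    unfolding bounded_borel_def by blast
  then have "\<forall>t\<in>{0..1}. \<bar>f t + g t\<bar> \<le> K + L"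
    by (meson abs_triangle_ineq add_mono order_trans)
  ultimately show ?thesis
    unfolding bounded_borel_def by auto
qed

lemma bounded_borel_times:
  assumes "f \<in> bounded_borel" "g \<in> bounded_borel"
  shows "(\<lambda>t. f t * g t) \<in> bounded_borel"
proof -
  obtain K L where "\<forall>t\<in>{0..1}. \<bar>f t\<bar> \<le> K" "\<forall>t\<in>{0..1}. \<bar>g t\<bar> \<le> L"
    using assms unfolding bounded_borel_def by blast
  then have "\<forall>t\<in>{0..1}. \<bar>f t * g t\<bar> \<le> \<bar>K\<bar> * \<bar>L\<bar>"
    unfolding abs_mult by (intro ballI mult_mono) (auto intro: order_trans[OF _ abs_ge_self])
  then show ?thesis
    using assms unfolding bounded_borel_def by auto
qed

lemma bounded_borel_const: "(\<lambda>t. c) \<in> bounded_borel"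
  unfolding bounded_borel_def by auto

lemma bounded_borel_cmult: "f \<in> bounded_borel \<Longrightarrow> (\<lambda>t. c * f t) \<in> bounded_borel"
  by (rule bounded_borel_times[OF bounded_borel_const])

text \<open>Bounds are required on the unit interval only, which is what admits the
  monomials.\<close>

lemma bounded_borel_power: "(\<lambda>t. t ^ m) \<in> bounded_borel"
  unfolding bounded_borel_def by (auto intro!: exI[of _ 1] power_le_one simp: power_abs)

lemma bounded_borel_indicator: "S \<in> sets borel \<Longrightarrow> indicator S \<in> bounded_borel"
  unfolding bounded_borel_def by (auto intro!: exI[of _ 1] simp: indicator_def)

lemma sigma_functional_add:
  "sigma_functional \<Lambda> \<Longrightarrow> f \<in> bounded_borel \<Longrightarrow> g \<in> bounded_borel \<Longrightarrow> \<Lambda> (\<lambda>t. f t + g t) = \<Lambda> f + \<Lambda> g"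
  unfolding sigma_functional_def by blast

lemma sigma_functional_cmult:
  "sigma_functional \<Lambda> \<Longrightarrow> f \<in> bounded_borel \<Longrightarrow> \<Lambda> (\<lambda>t. c * f t) = c * \<Lambda> f"
  unfolding sigma_functional_def by blast

lemma sigma_functional_lim:
  assumes "sigma_functional \<Lambda>" "\<And>n. F n \<in> borel_measurable borel" "f \<in> borel_measurable borel"
    "\<And>n t. t \<in> {0..1} \<Longrightarrow> \<bar>F n t\<bar> \<le> K" "\<And>t. t \<in> {0..1} \<Longrightarrow> (\<lambda>n. F n t) \<longlonglongrightarrow> f t"
  shows "(\<lambda>n. \<Lambda> (F n)) \<longlonglongrightarrow> \<Lambda> f"
  using assms unfolding sigma_functional_def by blast

lemma sigma_functional_integral:
  assumes "finite_measure M" "sets M = sets borel" "AE t in M. t \<in> {0..1}"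
  shows "sigma_functional (\<lambda>f. \<integral>t. f t \<partial>M)"
proof -
  interpret finite_measure M by fact
  have int: "integrable M f" if f: "f \<in> bounded_borel" for f
  proof -
    obtain K where "\<forall>t\<in>{0..1}. \<bar>f t\<bar> \<le> K" "f \<in> borel_measurable borel"
      using f unfolding bounded_borel_def by blast
    then show ?thesis
      using assms(3) by (intro integrable_const_bound[where B=K])
        (auto simp: measurable_cong_sets[OF assms(2) refl] elim: eventually_mono)
  qed
  show ?thesis
    unfolding sigma_functional_def
  proof (intro conjI ballI allI impI)
    fix F :: "nat \<Rightarrow> real \<Rightarrow> real" and f K
    assume *: "(\<forall>n. F n \<in> borel_measurable borel) \<and> f \<in> borel_measurable borel \<and>
        (\<forall>n. \<forall>t\<in>{0..1}. \<bar>F n t\<bar> \<le> K) \<and> (\<forall>t\<in>{0..1}. (\<lambda>n. F n t) \<longlonglongrightarrow> f t)"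
    show "(\<lambda>n. \<integral>t. F n t \<partial>M) \<longlonglongrightarrow> (\<integral>t. f t \<partial>M)"
    proof (rule integral_dominated_convergence[where w="\<lambda>_. K"])
      show "AE t in M. (\<lambda>n. F n t) \<longlonglongrightarrow> f t"
        using assms(3) by eventually_elim (use * in auto)
      show "AE t in M. norm (F n t) \<le> K" for n
        using assms(3) by eventually_elim (use * in auto)
    qed (use * in \<open>auto simp: measurable_cong_sets[OF assms(2) refl]\<close>)
  qed (auto simp: int)
qed

lemma sigma_functional_combination:
  assumes "sigma_functional \<Lambda>" "sigma_functional \<Lambda>'"
  shows "sigma_functional (\<lambda>f. a * \<Lambda> f + b * \<Lambda>' f)"
  unfolding sigma_functional_def
proof (intro conjI ballI allI impI)
  fix F :: "nat \<Rightarrow> real \<Rightarrow> real" and f K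
  assume *: "(\<forall>n. F n \<in> borel_measurable borel) \<and> f \<in> borel_measurable borel \<and>
        (\<forall>n. \<forall>t\<in>{0..1}. \<bar>F n t\<bar> \<le> K) \<and> (\<forall>t\<in>{0..1}. (\<lambda>n. F n t) \<longlonglongrightarrow> f t)"
  have "(\<lambda>n. \<Lambda> (F n)) \<longlonglongrightarrow> \<Lambda> f" "(\<lambda>n. \<Lambda>' (F n)) \<longlonglongrightarrow> \<Lambda>' f"
    using * assms unfolding sigma_functional_def by blast+
  then show "(\<lambda>n. a * \<Lambda> (F n) + b * \<Lambda>' (F n)) \<longlonglongrightarrow> a * \<Lambda> f + b * \<Lambda>' f"
    by (intro tendsto_intros)
next
  fix f g assume "f \<in> bounded_borel" "g \<in> bounded_borel"
  then show "a * \<Lambda> (\<lambda>t. f t + g t) + b * \<Lambda>' (\<lambda>t. f t + g t) = (a * \<Lambda> f + b * \<Lambda>' f) + (a * \<Lambda> g + b * \<Lambda>' g)"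
    unfolding sigma_functional_add[OF assms(1) \<open>f \<in> bounded_borel\<close> \<open>g \<in> bounded_borel\<close>]
      sigma_functional_add[OF assms(2) \<open>f \<in> bounded_borel\<close> \<open>g \<in> bounded_borel\<close>]
    by (simp add: algebra_simps)
next
  fix c f assume f: "f \<in> bounded_borel"
  show "a * \<Lambda> (\<lambda>t. c * f t) + b * \<Lambda>' (\<lambda>t. c * f t) = c * (a * \<Lambda> f + b * \<Lambda>' f)"
    unfolding sigma_functional_cmult[OF assms(1) f] sigma_functional_cmult[OF assms(2) f]
    by (simp add: algebra_simps)
qed

text \<open>This is passage to the measure with density \<open>h\<close>. Taking \<open>h\<close> to
  be a power and then an indicator gives multiplicativity of the spectral measure.\<close>

lemma sigma_functional_times:
  assumes "sigma_functional \<Lambda>" and h: "h \<in> bounded_borel"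
  shows "sigma_functional (\<lambda>f. \<Lambda> (\<lambda>t. h t * f t))"
  unfolding sigma_functional_def
proof (intro conjI ballI allI impI)
  fix F :: "nat \<Rightarrow> real \<Rightarrow> real" and f K
  assume *: "(\<forall>n. F n \<in> borel_measurable borel) \<and> f \<in> borel_measurable borel \<and>
        (\<forall>n. \<forall>t\<in>{0..1}. \<bar>F n t\<bar> \<le> K) \<and> (\<forall>t\<in>{0..1}. (\<lambda>n. F n t) \<longlonglongrightarrow> f t)"
  obtain L where L: "\<forall>t\<in>{0..1}. \<bar>h t\<bar> \<le> L" and [measurable]: "h \<in> borel_measurable borel"
    using h unfolding bounded_borel_def by blast
  have [measurable]: "F n \<in> borel_measurable borel" "f \<in> borel_measurable borel" for n
    using * by auto
  show "(\<lambda>n. \<Lambda> (\<lambda>t. h t * F n t)) \<longlonglongrightarrow> \<Lambda> (\<lambda>t. h t * f t)"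
  proof (rule sigma_functional_lim[OF assms(1), where K="\<bar>L\<bar> * \<bar>K\<bar>"])
    show "\<bar>h t * F n t\<bar> \<le> \<bar>L\<bar> * \<bar>K\<bar>" if "t \<in> {0..1}" for n t
      unfolding abs_mult using L * that by (intro mult_mono) (auto intro: order_trans[OF _ abs_ge_self])
    show "(\<lambda>n. h t * F n t) \<longlonglongrightarrow> h t * f t" if "t \<in> {0..1}" for t
      using * that by (intro tendsto_intros) auto
  qed measurable
next
  fix f g assume "f \<in> bounded_borel" "g \<in> bounded_borel"
  then show "\<Lambda> (\<lambda>t. h t * (f t + g t)) = \<Lambda> (\<lambda>t. h t * f t) + \<Lambda> (\<lambda>t. h t * g t)"
    by (simp add: distrib_left sigma_functional_add[OF assms(1)] bounded_borel_times[OF h])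
next
  fix c f assume "f \<in> bounded_borel"
  then show "\<Lambda> (\<lambda>t. h t * (c * f t)) = c * \<Lambda> (\<lambda>t. h t * f t)"
    using sigma_functional_cmult[OF assms(1) bounded_borel_times[OF h], of f c]
    by (simp add: mult.left_commute)
qed

section \<open>Determinacy: moments fix the values on Borel sets\<close>

text \<open>The class of functions annihilated by \<open>\<Lambda>\<close> grows from monomials to
  polynomials, to continuous functions by Stone-Weierstrass, to indicators of half-lines by bounded
  convergence, and to all Borel indicators because half-lines are stable under intersection.\<close>

lemma sigma_functional_zero:
  assumes \<Lambda>: "sigma_functional \<Lambda>" and moments: "\<And>m. \<Lambda> (\<lambda>t. t ^ m) = 0" and S: "S \<in> sets borel"
  shows "\<Lambda> (indicator S) = 0"
proof -
  have one: "\<Lambda> (\<lambda>t. 1) = 0"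
    using moments[of 0] by simp
  have const: "\<Lambda> (\<lambda>t. c) = 0" for c
    using sigma_functional_cmult[OF \<Lambda> bounded_borel_const[of 1], of c] by (simp add: one)
  have poly: "\<Lambda> (\<lambda>t. \<Sum>i\<le>n. a i * t ^ i) = 0" and "(\<lambda>t. \<Sum>i\<le>n. a i * t ^ i) \<in> bounded_borel"
    for a and n :: nat
  proof (induction n)
    case (Suc n)
    {
      case 1
      show ?case
        using Suc sigma_functional_add[OF \<Lambda> Suc(2) bounded_borel_cmult[OF bounded_borel_power], of "a (Suc n)" "Suc n"]
          sigma_functional_cmult[OF \<Lambda> bounded_borel_power, of "a (Suc n)" "Suc n"]
        by (simp add: moments del: power_Suc)
    next
      case 2
      show ?case
        using bounded_borel_add[OF Suc(2) bounded_borel_cmult[OF bounded_borel_power], of "a (Suc n)" "Suc n"]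
        by (simp del: power_Suc)
    }
  qed (simp_all add: const bounded_borel_const)
  have cont: "\<Lambda> f = 0" if f: "continuous_on UNIV f" for f
  proof -
    have "\<exists>p. real_polynomial_function p \<and> (\<forall>t\<in>{0..1}. \<bar>f t - p t\<bar> < inverse (real (Suc n)))" for n
      using Stone_Weierstrass_real_polynomial_function[of "{0..1}" f "inverse (real (Suc n))"]
        continuous_on_subset[OF f] by (metis compact_Icc inverse_positive_iff_positive of_nat_0_less_iff
            subset_UNIV zero_less_Suc)
    then obtain p where p: "\<And>n. real_polynomial_function (p n)"
        "\<And>n t. t \<in> {0..1} \<Longrightarrow> \<bar>f t - p n t\<bar> < inverse (real (Suc n))"
      by metis
    have p0: "\<Lambda> (p n) = 0" and pb: "p n \<in> borel_measurable borel" for n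
    proof -
      obtain a k where "p n = (\<lambda>t. \<Sum>i\<le>k. a i * t ^ i)"
        using p(1)[of n] unfolding real_polynomial_function_iff_sum by blast
      then show "\<Lambda> (p n) = 0" "p n \<in> borel_measurable borel"
        by (simp_all add: poly)
    qed
    have "bounded (f ` {0..1})"
      by (intro compact_imp_bounded compact_continuous_image continuous_on_subset[OF f]) auto
    then obtain K where "\<forall>t\<in>{0..1}. \<bar>f t\<bar> \<le> K"
      unfolding bounded_iff by auto
    then have K: "\<bar>f t\<bar> \<le> K" if "t \<in> {0..1}" for t
      using that by blast
    have "(\<lambda>n. \<Lambda> (p n)) \<longlonglongrightarrow> \<Lambda> f"
    proof (rule sigma_functional_lim[OF \<Lambda>, where K="K + 1"])
      fix n :: nat and t :: real assume t: "t \<in> {0..1}"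
      have "inverse (real (Suc n)) \<le> 1"
        by (simp add: inverse_le_1_iff)
      then show "\<bar>p n t\<bar> \<le> K + 1"
        using K[OF t] p(2)[OF t, of n] by linarith
    next
      fix t :: real assume t: "t \<in> {0..1}"
      have "(\<lambda>n. p n t - f t) \<longlonglongrightarrow> 0"
        by (rule Lim_null_comparison[OF _ LIMSEQ_inverse_real_of_nat])
          (use p(2)[OF t] in \<open>auto intro!: always_eventually less_imp_le simp: abs_minus_commute\<close>)
      then show "(\<lambda>n. p n t) \<longlonglongrightarrow> f t"
        by (rule LIM_zero_cancel)
    qed (use pb f in \<open>auto intro: borel_measurable_continuous_onI\<close>)
    then show ?thesis
      by (simp add: p0 LIMSEQ_const_iff)
  qed
  have half: "\<Lambda> (indicator {..a}) = 0" for a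
  proof -
    \<comment> \<open>Continuous ramps that equal 1 up to \<open>a\<close> and have dropped to 0 at
      \<open>a + 1 / n\<close>.\<close>
    define F where "F n t = max 0 (min 1 (1 - real n * (t - a)))" for n t
    have "(\<lambda>n. \<Lambda> (F n)) \<longlonglongrightarrow> \<Lambda> (indicator {..a})"
    proof (rule sigma_functional_lim[OF \<Lambda>, where K=1])
      fix t
      show "(\<lambda>n. F n t) \<longlonglongrightarrow> indicator {..a} t"
      proof (cases "t \<le> a")
        case True
        then have "F n t = 1" for n
          by (simp add: F_def mult_nonneg_nonpos min_def max_def)
        then show ?thesis
          using True by simp
      next
        case False
        then obtain k where k: "1 < real k * (t - a)"
          using ex_less_of_nat_mult[of "t - a" 1] by auto
        have "F n t = 0" if "k \<le> n" for n
        proof -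
          have "real k * (t - a) \<le> real n * (t - a)"
            using that False by (intro mult_right_mono) auto
          then show ?thesis
            using k by (auto simp: F_def)
        qed
        then have "\<forall>\<^sub>F n in sequentially. F n t = 0"
          using eventually_ge_at_top[of k] by (rule eventually_mono[rotated])
        then show ?thesis
          using False by (auto intro: tendsto_eventually)
      qed
    next
      show "F n \<in> borel_measurable borel" for n
        unfolding F_def by measurable
    qed (auto simp: F_def)
    moreover have "\<Lambda> (F n) = 0" for n
      unfolding F_def by (intro cont continuous_intros)
    ultimately show ?thesis
      by (simp add: LIMSEQ_const_iff)
  qed
  have "Int_stable (range (\<lambda>a::real. {..a}))"
    by (auto simp: Int_stable_def)
  moreover have "range (\<lambda>a::real. {..a}) \<subseteq> Pow UNIV"
    by simp
  moreover have "S \<in> sigma_sets UNIV (range (\<lambda>a::real. {..a}))"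
    using S by (simp add: borel_eq_atMost)
  ultimately show ?thesis
  proof (induction rule: sigma_sets_induct_disjoint)
    case (compl A)
    then have A: "A \<in> sets borel"
      by (simp add: borel_eq_atMost)
    have "indicator (UNIV - A) = (\<lambda>t. 1 + (-1) * indicator A t :: real)"
      by (auto simp: indicator_def fun_eq_iff)
    then show ?case
      using compl A one sigma_functional_add[OF \<Lambda> bounded_borel_const bounded_borel_cmult, of "indicator A" 1 "-1"]
        sigma_functional_cmult[OF \<Lambda>, of "indicator A" "-1"]
      by (simp add: bounded_borel_indicator)
  next
    case (union A)
    then have A: "A i \<in> sets borel" for i
      by (auto simp: borel_eq_atMost)
    have fin: "\<Lambda> (indicator (\<Union>i<n. A i)) = 0" for n
    proof (induction n)
      case 0
      then show ?case
        by (simp add: const)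
    next
      case (Suc n)
      have "indicator (\<Union>i<Suc n. A i) = (\<lambda>t. indicator (\<Union>i<n. A i) t + indicator (A n) t :: real)"
      proof
        fix t
        have "(\<Union>i<n. A i) \<inter> A n = {}"
          using union.hyps(1) unfolding disjoint_family_on_def disjoint_iff
          by (metis UNIV_I UN_E lessThan_iff less_irrefl)
        then show "indicator (\<Union>i<Suc n. A i) t = (indicator (\<Union>i<n. A i) t + indicator (A n) t :: real)"
          by (auto simp: indicator_def lessThan_Suc disjoint_iff)
      qed
      then show ?case
        using A Suc union.IH by (simp add: sigma_functional_add[OF \<Lambda>] bounded_borel_indicator sets.countable_UN)
    qed
    have "(\<lambda>n. \<Lambda> (indicator (\<Union>i<n. A i))) \<longlonglongrightarrow> \<Lambda> (indicator (\<Union>i. A i))"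
    proof (rule sigma_functional_lim[OF \<Lambda>, where K=1])
      show "\<bar>indicator (\<Union>i<n. A i) t\<bar> \<le> (1::real)" for n t
        by (simp add: indicator_def)
    qed (use A in \<open>auto intro: LIMSEQ_indicator_UN\<close>)
    then show ?case
      by (simp add: fin LIMSEQ_const_iff)
  qed (auto simp: half const)
qed

lemma sigma_functional_eq:
  assumes "sigma_functional \<Lambda>" "sigma_functional \<Lambda>'" "\<And>m. \<Lambda> (\<lambda>t. t ^ m) = \<Lambda>' (\<lambda>t. t ^ m)"
    and "S \<in> sets borel"
  shows "\<Lambda> (indicator S) = \<Lambda>' (indicator S)"
  using sigma_functional_zero[OF sigma_functional_combination[OF assms(1,2), of 1 "-1"] _ assms(4)] assms(3)
  by simp

section \<open>The spectral theorem\<close>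

lemma funpow_add_linear:
  fixes f :: "'a::plus \<Rightarrow> 'a"
  assumes "\<And>x y. f (x + y) = f x + f y"
  shows "(f ^^ k) (x + y) = (f ^^ k) x + (f ^^ k) y"
  by (induction k) (auto simp: assms)

lemma funpow_commute:
  assumes "\<And>x. f (g x) = g (f x)"
  shows "(f ^^ k) (g x) = g ((f ^^ k) x)"
  by (induction k) (auto simp: assms)

lemma hermitean_funpow:
  assumes "hermitean A"
  shows "rinner ((blinfun_apply A ^^ k) x) y = rinner x ((blinfun_apply A ^^ k) y)"
  by (induction k arbitrary: x y) (auto simp: hermitean_cinner[OF assms] funpow_commute)

text \<open>The operators \<open>A\<close> and \<open>1 - A\<close> commute and are symmetric, so
  two equal factors can be moved to opposite sides of the inner product. Induction in steps of two
  reduces both exponents to 0 or 1 without any operator square root.\<close>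

lemma contraction_moments_nonneg:
  fixes A :: "'h::complex_hilbert_space \<Rightarrow>\<^sub>L 'h"
  assumes A: "positive_op A" and A': "positive_op (id_blinfun - A)"
  shows "0 \<le> rinner x ((blinfun_apply A ^^ k) ((blinfun_apply (id_blinfun - A) ^^ l) x))"
proof -
  define a where "a = blinfun_apply A"
  define b where "b = blinfun_apply (id_blinfun - A)"
  have ab: "a (b x) = b (a x)" for x
    by (simp add: a_def b_def blinfun.diff_left blinfun.diff_right)
  have sa: "rinner (a x) y = rinner x (a y)" and sb: "rinner (b x) y = rinner x (b y)" for x y
    using A A' by (auto simp: a_def b_def hermitean_cinner positive_op_hermitean)
  have pa: "0 \<le> rinner x (a x)" and pb: "0 \<le> rinner x (b x)" for x
    using A A' by (auto simp: a_def b_def positive_opD)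
  have base: "0 \<le> rinner x ((b ^^ l) x) \<and> 0 \<le> rinner x (a ((b ^^ l) x))" for x l
  proof (induction l arbitrary: x rule: induct_nat_012)
    case 1
    \<comment> \<open>With b = 1 - a this is the identity ab = bab + aba, a sum of two positive
      operators.\<close>
    have "rinner x (a (b x)) = rinner (b x) (a (b x)) + rinner (a x) (b (a x))"
      by (simp add: sb sa ab flip: cinner_add_right plus_complex.sel)
        (simp add: a_def b_def blinfun.diff_left blinfun.diff_right cinner_linear)
    then show ?case
      using pa[of "b x"] pb[of "a x"] pb[of x] by simp
  next
    case (ge2 n)
    have "rinner x ((b ^^ Suc (Suc n)) x) = rinner (b x) ((b ^^ n) (b x))"
      by (simp add: sb funpow_swap1)
    then have "0 \<le> rinner x ((b ^^ Suc (Suc n)) x)"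
      using ge2(1)[of "b x"] by simp
    moreover
    have "rinner x (a ((b ^^ Suc (Suc n)) x)) = rinner (b x) (a ((b ^^ n) (b x)))"
      by (simp add: sb ab[symmetric] funpow_swap1)
    then have "0 \<le> rinner x (a ((b ^^ Suc (Suc n)) x))"
      using ge2(1)[of "b x"] by simp
    ultimately show ?case ..
  qed (auto simp: rinner_same_nonneg pa pb)
  have "0 \<le> rinner x ((a ^^ k) ((b ^^ l) x))"
  proof (induction k arbitrary: x rule: induct_nat_012)
    case (ge2 n)
    have "rinner x ((a ^^ Suc (Suc n)) ((b ^^ l) x)) = rinner (a x) ((a ^^ n) ((b ^^ l) (a x)))"
      by (simp add: sa funpow_swap1 funpow_commute[of b a, OF ab[symmetric]])
    then show ?case
      using ge2(1)[of "a x"] by simp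
  qed (auto simp: base)
  then show ?thesis
    by (simp add: a_def b_def)
qed

lemma contraction_moment_measure:
  fixes A :: "'h::complex_hilbert_space \<Rightarrow>\<^sub>L 'h"
  assumes A: "positive_op A" and A': "positive_op (id_blinfun - A)"
  obtains M where "real_distribution M" "AE t in M. t \<in> {0..1}"
    "\<And>m. (norm x)\<^sup>2 * (\<integral>t. t ^ m \<partial>M) = rinner x ((blinfun_apply A ^^ m) x)"
proof -
  define g where "g u k l = rinner u ((blinfun_apply A ^^ k) ((blinfun_apply (id_blinfun - A) ^^ l) u))" for u k l
  have g: "0 \<le> g u k l" "g u k l = g u (Suc k) l + g u k (Suc l)" for u k l
  proof -
    show "0 \<le> g u k l"
      unfolding g_def by (rule contraction_moments_nonneg[OF A A'])
    define v where "v = (blinfun_apply (id_blinfun - A) ^^ l) u"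
    have "(blinfun_apply A ^^ k) v = (blinfun_apply A ^^ k) (A v + (id_blinfun - A) v)"
      by (simp add: blinfun.diff_left)
    also have "\<dots> = (blinfun_apply A ^^ Suc k) v + (blinfun_apply A ^^ k) ((id_blinfun - A) v)"
      by (simp only: funpow_add_linear[of "blinfun_apply A", OF blinfun.add_right] funpow_Suc_right o_apply)
    finally have eq: "(blinfun_apply A ^^ k) v = (blinfun_apply A ^^ Suc k) v + (blinfun_apply A ^^ k) ((id_blinfun - A) v)" .
    have "g u k l = rinner u ((blinfun_apply A ^^ k) v)"
      by (simp add: g_def v_def)
    also have "\<dots> = rinner u ((blinfun_apply A ^^ Suc k) v) + rinner u ((blinfun_apply A ^^ k) ((id_blinfun - A) v))"
      by (subst eq) (simp add: cinner_add_right)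
    finally show "g u k l = g u (Suc k) l + g u k (Suc l)"
      by (simp add: g_def v_def)
  qed
  show thesis
  proof (cases "x = 0")
    case True
    \<comment> \<open>At the zero vector any probability measure on the unit interval fits; the
      array given is that of the unit mass at 1.\<close>
    obtain M where "real_distribution M" "AE t in M. t \<in> {0..1}"
      by (rule hausdorff_moment_problem[of "\<lambda>k l. of_bool (l = 0)"]) auto
    moreover have "(blinfun_apply A ^^ m) 0 = 0" for m
      by (induction m) (auto simp: blinfun.zero_right)
    ultimately show thesis
      using True by (intro that) (auto simp: cinner_linear)
  next
    case False
    show thesis
    proof (rule hausdorff_moment_problem[of "\<lambda>k l. g x k l / (norm x)\<^sup>2"])
      show "0 \<le> g x k l / (norm x)\<^sup>2" for k l
        using g(1) by simp
      show "g x k l / (norm x)\<^sup>2 = g x (Suc k) l / (norm x)\<^sup>2 + g x k (Suc l) / (norm x)\<^sup>2" for k l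
        by (subst g(2)) (simp add: add_divide_distrib)
      show "g x 0 0 / (norm x)\<^sup>2 = 1"
        using False by (simp add: g_def rinner_same)
    next
      fix M assume "real_distribution M" "AE t in M. t \<in> {0..1}" "\<And>m. (\<integral>t. t ^ m \<partial>M) = g x m 0 / (norm x)\<^sup>2"
      then show thesis
        using False by (intro that[of M]) (auto simp: g_def)
    qed
  qed
qed

text \<open>The measures \<open>M x\<close> are obtained separately for each \<open>x\<close>, so
  the dependence on \<open>x\<close> is not visibly quadratic. Determinacy repairs this: both sides
  of each bilinearity law are functionals with equal moments.\<close>

lemma contraction_form_measures:
  fixes A :: "'h::complex_hilbert_space \<Rightarrow>\<^sub>L 'h"
  assumes A: "positive_op A" and A': "positive_op (id_blinfun - A)"
  obtains m :: "'h \<Rightarrow> 'h \<Rightarrow> (real \<Rightarrow> real) \<Rightarrow> real" and E :: "real set \<Rightarrow> ('h \<Rightarrow>\<^sub>L 'h)" and M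
  where "\<And>x y. sigma_functional (m x y)"
    "\<And>x y k. m x y (\<lambda>t. t ^ k) = rinner x ((blinfun_apply A ^^ k) y)"
    "\<And>S. S \<in> sets borel \<Longrightarrow> E S \<in> bounded_ops"
    "\<And>S x y. S \<in> sets borel \<Longrightarrow> m x y (indicator S) = rinner x (E S y)"
    "\<And>x. real_distribution (M x)"
    "\<And>x. AE t in M x. t \<in> {0..1}"
    "\<And>x f. m x x f = (norm x)\<^sup>2 * (\<integral>t. f t \<partial>M x)"
proof -
  have hA: "hermitean A"
    using A by (rule positive_op_hermitean)
  have "\<exists>M. real_distribution M \<and> (AE t in M. t \<in> {0..1}) \<and>
      (\<forall>m. (norm x)\<^sup>2 * (\<integral>t. t ^ m \<partial>M) = rinner x ((blinfun_apply A ^^ m) x))" for x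
    using contraction_moment_measure[OF A A', of x] by metis
  then obtain M where M: "\<And>x. real_distribution (M x)" "\<And>x. AE t in M x. t \<in> {0..1}"
    "\<And>x k. (norm x)\<^sup>2 * (\<integral>t. t ^ k \<partial>M x) = rinner x ((blinfun_apply A ^^ k) x)"
    by metis
  \<comment> \<open>Polarization of the diagonal measures, scaled by the squared norms because each
    \<open>M\<close> is normalized.\<close>
  define m where "m x y f = (1/4 * (norm (x + y))\<^sup>2) * (\<integral>t. f t \<partial>M (x + y))
      + (- 1/4 * (norm (x - y))\<^sup>2) * (\<integral>t. f t \<partial>M (x - y))" for x y f
  have sM: "sigma_functional (\<lambda>f. \<integral>t. f t \<partial>M x)" for x
  proof -
    interpret real_distribution "M x" by (rule M)
    show ?thesis
      by (rule sigma_functional_integral[OF finite_measure_axioms _ M(2)]) simp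
  qed
  have sm: "sigma_functional (m x y)" for x y
    unfolding m_def by (rule sigma_functional_combination[OF sM sM])
  have lin: "(blinfun_apply A ^^ k) (x + y) = (blinfun_apply A ^^ k) x + (blinfun_apply A ^^ k) y"
    "(blinfun_apply A ^^ k) (x - y) = (blinfun_apply A ^^ k) x - (blinfun_apply A ^^ k) y"
    "(blinfun_apply A ^^ k) (r *\<^sub>R x) = r *\<^sub>R (blinfun_apply A ^^ k) x"
    "(blinfun_apply A ^^ k) (c *\<^sub>C x) = c *\<^sub>C (blinfun_apply A ^^ k) x" for k x y r c
    using bounded_ops_scaleC[OF hermitean_bounded_ops[OF hA]]
    by (induction k) (auto simp: blinfun.add_right blinfun.diff_right blinfun.scaleR_right)
  have moments: "m x y (\<lambda>t. t ^ k) = rinner x ((blinfun_apply A ^^ k) y)" for x y k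
  proof -
    have "rinner y ((blinfun_apply A ^^ k) x) = rinner x ((blinfun_apply A ^^ k) y)"
      using hermitean_funpow[OF hA, of k x y] rinner_commute[of y] by simp
    moreover have "m x y (\<lambda>t. t ^ k) = 1/4 * rinner (x + y) ((blinfun_apply A ^^ k) (x + y))
        - 1/4 * rinner (x - y) ((blinfun_apply A ^^ k) (x - y))"
      unfolding m_def M(3)[symmetric] by simp
    ultimately show ?thesis
      by (simp add: lin cinner_linear field_simps)
  qed
  have meq: "\<Lambda> (indicator S) = m x y (indicator S)"
    if "sigma_functional \<Lambda>" "\<And>k. \<Lambda> (\<lambda>t. t ^ k) = rinner x ((blinfun_apply A ^^ k) y)" "S \<in> sets borel"
    for \<Lambda> S x y
    using sigma_functional_eq[OF that(1) sm _ that(3)] that(2) by (simp add: moments)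
  have "\<exists>Z. Z \<in> bounded_ops \<and> (\<forall>x y. m x y (indicator S) = rinner x (blinfun_apply Z y))"
    if S: "S \<in> sets borel" for S
  proof -
    define b where "b x y = m x y (indicator S)" for x y
    have b_add: "b (x + x') y = b x y + b x' y" for x x' y
      using meq[OF sigma_functional_combination[OF sm[of x y] sm[of x' y], of 1 1] _ S, of "x + x'" y]
      by (simp add: b_def moments cinner_linear)
    have b_add': "b y (x + x') = b y x + b y x'" for x x' y
      using meq[OF sigma_functional_combination[OF sm[of y x] sm[of y x'], of 1 1] _ S, of y "x + x'"]
      by (simp add: b_def moments cinner_linear lin)
    have b_scale: "b (r *\<^sub>R x) y = r * b x y" for x r y
      using meq[OF sigma_functional_combination[OF sm[of x y] sm[of x y], of r 0] _ S, of "r *\<^sub>R x" y]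
      by (simp add: b_def moments cinner_linear)
    have b_scale': "b x (r *\<^sub>R y) = r * b x y" for x r y
      using meq[OF sigma_functional_combination[OF sm[of x y] sm[of x y], of r 0] _ S, of x "r *\<^sub>R y"]
      by (simp add: b_def moments cinner_linear lin)
    \<comment> \<open>Four times the form is a difference of two masses, at most
      \<open>(norm (x + y))\<^sup>2\<close> and \<open>(norm (x - y))\<^sup>2\<close>; the
      parallelogram law does the rest. Rescaling to unit vectors later turns this into
      \<open>norm x * norm y\<close>.\<close>
    have bound: "\<bar>b x y\<bar> \<le> ((norm x)\<^sup>2 + (norm y)\<^sup>2) / 2" for x y
    proof -
      have I: "0 \<le> (\<integral>t. indicator S t \<partial>M x :: real)" "(\<integral>t. indicator S t \<partial>M x) \<le> (1::real)" for x
      proof -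
        interpret real_distribution "M x" by (rule M)
        show "0 \<le> (\<integral>t. indicator S t \<partial>M x :: real)"
          by (intro Bochner_Integration.integral_nonneg) simp
        show "(\<integral>t. indicator S t \<partial>M x) \<le> (1::real)"
          using S by simp
      qed
      have "0 \<le> (norm (x + y))\<^sup>2 * (\<integral>t. indicator S t \<partial>M (x + y))"
          "(norm (x + y))\<^sup>2 * (\<integral>t. indicator S t \<partial>M (x + y)) \<le> (norm (x + y))\<^sup>2"
          "0 \<le> (norm (x - y))\<^sup>2 * (\<integral>t. indicator S t \<partial>M (x - y))"
          "(norm (x - y))\<^sup>2 * (\<integral>t. indicator S t \<partial>M (x - y)) \<le> (norm (x - y))\<^sup>2"
        using I by (auto intro: mult_left_le)
      then show ?thesis
        unfolding b_def m_def mult.assoc using norm_add_sq[of x y] norm_diff_sq[of x y] by argo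
    qed
    have "bounded_bilinear b"
    proof (standard, goal_cases)
      case 5
      have "\<bar>b x y\<bar> \<le> norm x * norm y" for x y
      proof (cases "x = 0 \<or> y = 0")
        case True
        then show ?thesis
          using b_scale[of 0 x y] b_scale'[of x 0 y] by auto
      next
        case False
        have "b x y = norm x * norm y * b (inverse (norm x) *\<^sub>R x) (inverse (norm y) *\<^sub>R y)"
          using False by (simp add: b_scale b_scale' field_simps)
        also have "\<bar>\<dots>\<bar> \<le> norm x * norm y * 1"
          unfolding abs_mult using bound[of "inverse (norm x) *\<^sub>R x" "inverse (norm y) *\<^sub>R y"] False
          by (intro mult_mono) auto
        finally show ?thesis
          by simp
      qed
      then show ?case
        by (intro exI[of _ 1]) auto
    qed (auto simp: b_add b_add' b_scale b_scale')
    moreover have "b (\<i> *\<^sub>C x) (\<i> *\<^sub>C y) = b x y" for x y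
      using meq[OF sm[of "\<i> *\<^sub>C x" "\<i> *\<^sub>C y"] _ S, of x y]
      by (simp add: b_def moments lin cinner_ii)
    ultimately show ?thesis
      using form_operator[of b] unfolding b_def by metis
  qed
  then obtain E where E: "\<And>S. S \<in> sets borel \<Longrightarrow> E S \<in> bounded_ops"
    "\<And>S x y. S \<in> sets borel \<Longrightarrow> m x y (indicator S) = rinner x (blinfun_apply (E S) y)"
    by metis
  show thesis
  \<comment> \<open>The polarization formula at \<open>x = y\<close> involves the measure of
    \<open>x + x\<close>; choosing that measure as witness avoids proving \<open>M\<close> scale
    invariant.\<close>
  proof (rule that[of m E "\<lambda>x. M (x + x)"])
    show "m x x f = (norm x)\<^sup>2 * (\<integral>t. f t \<partial>M (x + x))" for x f
      by (simp add: m_def norm_add_sq rinner_same)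
  qed (use sm moments E M in auto)
qed

section \<open>Projection-valued measures and the spectral measure of a contraction\<close>

lemma pvm_projection: "projection_valued_measure E \<Longrightarrow> S \<in> sets borel \<Longrightarrow> projection_op (E S)"
  and pvm_empty: "projection_valued_measure E \<Longrightarrow> E {} = 0"
  and pvm_UNIV: "projection_valued_measure E \<Longrightarrow> E UNIV = id_blinfun"
  and pvm_Int: "projection_valued_measure E \<Longrightarrow> S \<in> sets borel \<Longrightarrow> S' \<in> sets borel \<Longrightarrow> E (S \<inter> S') = E S o\<^sub>L E S'"
  and pvm_sums: "projection_valued_measure E \<Longrightarrow> range F \<subseteq> sets borel \<Longrightarrow> disjoint_family F \<Longrightarrow>
    (\<lambda>n. blinfun_apply (E (F n)) x) sums blinfun_apply (E (\<Union>n. F n)) x"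
  unfolding projection_valued_measure_def by blast+

lemma projection_op_hermitean: "projection_op P \<Longrightarrow> hermitean P"
  and projection_op_idem: "projection_op P \<Longrightarrow> P (P x) = blinfun_apply P x"
  unfolding projection_op_def by (auto simp flip: blinfun_apply_blinfun_compose)

lemma projection_op_rinner: "projection_op P \<Longrightarrow> rinner x (P x) = (norm (P x))\<^sup>2"
  by (metis hermitean_cinner projection_op_hermitean projection_op_idem rinner_same)

lemma projection_op_positive: "projection_op P \<Longrightarrow> positive_op P"
  by (auto intro!: positive_opI simp: projection_op_rinner projection_op_hermitean)

lemma projection_op_complement:
  assumes "projection_op P"
  shows "projection_op (id_blinfun - P)"
  unfolding projection_op_def
proof
  show "hermitean (id_blinfun - P)"
    by (intro hermitean_diff hermitean_id projection_op_hermitean assms)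
  show "(id_blinfun - P) o\<^sub>L (id_blinfun - P) = id_blinfun - P"
    by (rule blinfun_eqI) (simp add: blinfun.diff_left blinfun.diff_right projection_op_idem[OF assms])
qed

lemma sets_pvm_measure [simp, measurable_cong]: "sets (pvm_measure E x) = sets borel"
  unfolding pvm_measure_def by (subst sets_measure_of) (auto simp: sets.sigma_sets_eq[of borel, simplified])

lemma space_pvm_measure [simp]: "space (pvm_measure E x) = UNIV"
  unfolding pvm_measure_def by (subst space_measure_of) auto

lemma emeasure_pvm_measure:
  assumes E: "projection_valued_measure E" and S: "S \<in> sets borel"
  shows "emeasure (pvm_measure E x) S = ennreal (rinner x (E S x))"
proof -
  have pos: "0 \<le> rinner x (E S x)" if "S \<in> sets borel" for S
    using projection_op_rinner[OF pvm_projection[OF E that]] by simp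
  have "countably_additive (sets borel) (\<lambda>S. ennreal (rinner x (E S x)))"
  proof (rule countably_additiveI)
    fix F :: "nat \<Rightarrow> real set" assume F: "range F \<subseteq> sets borel" "disjoint_family F"
    have "(\<lambda>n. rinner x (E (F n) x)) sums rinner x (E (\<Union>n. F n) x)"
      by (rule bounded_linear.sums[OF bounded_bilinear.bounded_linear_right[OF bounded_bilinear_rinner] pvm_sums[OF E F]])
    then show "(\<Sum>i. ennreal (rinner x (E (F i) x))) = ennreal (rinner x (E (\<Union>n. F n) x))"
      using F by (intro suminf_ennreal_eq pos) auto
  qed
  then show ?thesis
    unfolding pvm_measure_def using S
    by (intro emeasure_measure_of_sigma) (auto simp: positive_def pvm_empty[OF E] cinner_linear
        sets.sigma_algebra_axioms[of borel, simplified])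
qed

lemma measure_pvm_measure:
  assumes "projection_valued_measure E" "S \<in> sets borel"
  shows "measure (pvm_measure E x) S = rinner x (E S x)"
  using assms projection_op_rinner[OF pvm_projection[OF assms]]
  by (simp add: measure_def emeasure_pvm_measure)

lemma finite_measure_pvm_measure: "projection_valued_measure E \<Longrightarrow> finite_measure (pvm_measure E x)"
  by (rule finite_measureI) (simp add: emeasure_pvm_measure)

text \<open>Every algebraic property of \<open>E\<close> is an equality of forms, and each follows
  by comparing moments. The commutation clause is kept because uniqueness and membership in von
  Neumann algebras rest on it.\<close>

lemma contraction_spectral_measure:
  fixes A :: "'h::complex_hilbert_space \<Rightarrow>\<^sub>L 'h"
  assumes A: "positive_op A" and A': "positive_op (id_blinfun - A)"
  obtains E where "is_spectral_measure A E"
    "\<And>Y S. Y \<in> bounded_ops \<Longrightarrow> A o\<^sub>L Y = Y o\<^sub>L A \<Longrightarrow> S \<in> sets borel \<Longrightarrow> E S o\<^sub>L Y = Y o\<^sub>L E S"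
proof (rule contraction_form_measures[OF A A'])
  fix m :: "'h \<Rightarrow> 'h \<Rightarrow> (real \<Rightarrow> real) \<Rightarrow> real" and E :: "real set \<Rightarrow> ('h \<Rightarrow>\<^sub>L 'h)" and M
  assume sm: "\<And>x y. sigma_functional (m x y)"
    and moments: "\<And>x y k. m x y (\<lambda>t. t ^ k) = rinner x ((blinfun_apply A ^^ k) y)"
    and Eb: "\<And>S. S \<in> sets borel \<Longrightarrow> E S \<in> bounded_ops"
    and E: "\<And>S x y. S \<in> sets borel \<Longrightarrow> m x y (indicator S) = rinner x (E S y)"
    and M: "\<And>x. real_distribution (M x)" and AE: "\<And>x. AE t in M x. t \<in> {0..1}"
    and mM: "\<And>x f. m x x f = (norm x)\<^sup>2 * (\<integral>t. f t \<partial>M x)"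
  have hA: "hermitean A"
    using A by (rule positive_op_hermitean)
  have meq: "\<Lambda> (indicator S) = rinner x (E S y)"
    if "sigma_functional \<Lambda>" "\<And>k. \<Lambda> (\<lambda>t. t ^ k) = rinner x ((blinfun_apply A ^^ k) y)" "S \<in> sets borel"
    for \<Lambda> S x y
    using sigma_functional_eq[OF that(1) sm _ that(3)] that by (simp add: moments E)
  have sym: "rinner (E S x) y = rinner x (E S y)" if S: "S \<in> sets borel" for S x y
  proof -
    have "rinner y ((blinfun_apply A ^^ k) x) = rinner x ((blinfun_apply A ^^ k) y)" for k
      using hermitean_funpow[OF hA, of k x y] rinner_commute[of y] by simp
    then have "m y x (indicator S) = rinner x (E S y)"
      by (intro meq sm S) (simp add: moments)
    then show ?thesis
      using rinner_commute[of y] by (simp add: E[OF S])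
  qed
  have Int: "E (S \<inter> S') = E S o\<^sub>L E S'" if S: "S \<in> sets borel" and S': "S' \<in> sets borel" for S S'
  proof (rule blinfun_eqI, rule rinner_eqI)
    fix x y
    \<comment> \<open>The measure of (x, y) with density t^k has the moments of the pair consisting
      of \<open>x\<close> and A^k y.\<close>
    have step: "m x y (\<lambda>t. indicator S t * t ^ k) = rinner (E S x) ((blinfun_apply A ^^ k) y)" for k
    proof -
      have "m x y (\<lambda>t. t ^ k * indicator S t) = rinner x (E S ((blinfun_apply A ^^ k) y))"
        by (rule meq[OF sigma_functional_times[OF sm bounded_borel_power] _ S])
          (simp add: power_add[symmetric] moments funpow_add add.commute[of k])
      then show ?thesis
        by (simp add: sym[OF S] mult.commute)
    qed
    \<comment> \<open>By the previous identity, the measure of (x, y) with density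
      \<open>indicator S\<close> has the moments of the pair \<open>E S x\<close>,
      \<open>y\<close>.\<close>
    have "m x y (\<lambda>t. indicator S t * indicator S' t) = rinner (E S x) (E S' y)"
      by (rule meq[OF sigma_functional_times[OF sm bounded_borel_indicator[OF S]] step S'])
    moreover have "(\<lambda>t. indicator S t * indicator S' t) = (indicator (S \<inter> S') :: real \<Rightarrow> real)"
      by (auto simp: indicator_inter_arith)
    ultimately show "rinner x (E (S \<inter> S') y) = rinner x ((E S o\<^sub>L E S') y)"
      using E[of "S \<inter> S'" x y] S S' by (simp add: sym)
  qed
  have proj: "projection_op (E S)" if "S \<in> sets borel" for S
    unfolding projection_op_def using that by (auto intro!: hermiteanI Eb sym simp: Int[symmetric])
  have E0: "E {} = 0"
  proof (rule blinfun_eqI, rule rinner_eqI)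
    fix x y
    show "rinner x (E {} y) = rinner x (blinfun_apply 0 y)"
      using E[of "{}" x y] sigma_functional_cmult[OF sm bounded_borel_const, of x y 0 0]
      by (simp add: cinner_linear indicator_def[abs_def])
  qed
  have E1: "E UNIV = id_blinfun"
  proof (rule blinfun_eqI, rule rinner_eqI)
    fix x y
    show "rinner x (E UNIV y) = rinner x (id_blinfun y)"
      using E[of UNIV x y] moments[of x y 0] by (simp add: indicator_def[abs_def])
  qed
  have Un: "E (S \<union> S') = E S + E S'" if S: "S \<in> sets borel" "S' \<in> sets borel" "S \<inter> S' = {}" for S S'
  proof (rule blinfun_eqI, rule rinner_eqI)
    fix x y
    have "indicator (S \<union> S') = (\<lambda>t. indicator S t + indicator S' t :: real)"
      using S(3) by (auto simp: indicator_def fun_eq_iff)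
    then show "rinner x (E (S \<union> S') y) = rinner x ((E S + E S') y)"
      using E[of "S \<union> S'" x y] sigma_functional_add[OF sm bounded_borel_indicator[OF S(1)] bounded_borel_indicator[OF S(2)]] S
      by (simp add: E blinfun.add_left cinner_linear)
  qed
  have sums: "(\<lambda>n. E (F n) x) sums E (\<Union>n. F n) x"
    if F: "range F \<subseteq> sets borel" "disjoint_family F" for F :: "nat \<Rightarrow> real set" and x
  proof -
    define U where "U = (\<Union>n. F n)"
    define V where "V n = (\<Union>i<n. F i)" for n
    have Fb: "F n \<in> sets borel" for n
      using F by auto
    then have b: "U \<in> sets borel" "V n \<in> sets borel" for n
      by (auto simp: U_def V_def)
    have fin: "(\<Sum>i<n. E (F i) x) = E (V n) x" for n
    proof (induction n)
      case (Suc n)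
      have "E (V (Suc n)) = E (V n \<union> F n)"
        by (simp add: V_def lessThan_Suc Un_commute)
      also have "\<dots> = E (V n) + E (F n)"
      proof (intro Un b Fb)
        show "V n \<inter> F n = {}"
          using F(2) unfolding V_def disjoint_family_on_def disjoint_iff
          by (metis UNIV_I UN_E lessThan_iff less_irrefl)
      qed
      finally show ?case
        by (simp add: Suc blinfun.add_left)
    qed (simp add: V_def E0)
    have UV: "U \<inter> V n = V n" for n
      by (auto simp: U_def V_def)
    \<comment> \<open>The projections \<open>E (V n)\<close> lie below \<open>E U\<close>, so
      squared distances are differences of scalar masses, and weak convergence becomes strong
      convergence.\<close>
    have dist: "(norm (E (V n) x - E U x))\<^sup>2 = rinner x (E U x) - rinner x (E (V n) x)" for n
    proof -
      have "rinner (E (V n) x) (E U x) = rinner x (E (V n) x)"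
        using arg_cong[OF Int[OF b(1) b(2)[of n]], of "\<lambda>T. blinfun_apply T x"]
          sym[OF b(1)] rinner_commute[of "E (V n) x" "E U x"] by (simp add: UV)
      then show ?thesis
        by (simp add: norm_diff_sq projection_op_rinner proj b)
    qed
    have "(\<lambda>n. m x x (indicator (V n))) \<longlonglongrightarrow> m x x (indicator U)"
    proof (rule sigma_functional_lim[OF sm, where K=1])
      show "\<bar>indicator (V n) t\<bar> \<le> (1::real)" for n t
        by (simp add: indicator_def)
      show "(\<lambda>n. indicator (V n) t) \<longlonglongrightarrow> (indicator U t :: real)" for t
        unfolding U_def V_def by (rule LIMSEQ_indicator_UN)
    qed (use b in auto)
    then have "(\<lambda>n. rinner x (E U x) - rinner x (E (V n) x)) \<longlonglongrightarrow> rinner x (E U x) - rinner x (E U x)"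
      unfolding E[OF b(1)] E[OF b(2)] by (rule tendsto_diff[OF tendsto_const])
    then have "(\<lambda>n. sqrt ((norm (E (V n) x - E U x))\<^sup>2)) \<longlonglongrightarrow> sqrt 0"
      unfolding dist by (intro tendsto_real_sqrt) simp
    then have "(\<lambda>n. E (V n) x - E U x) \<longlonglongrightarrow> 0"
      by (simp add: tendsto_norm_zero_iff)
    then show ?thesis
      unfolding sums_def fin U_def[symmetric] by (rule LIM_zero_cancel)
  qed
  have pvm: "projection_valued_measure E"
    unfolding projection_valued_measure_def using proj E0 E1 Int sums by blast
  have "is_spectral_measure A E"
    unfolding is_spectral_measure_def
  proof (intro conjI allI pvm)
    fix x
    interpret real_distribution "M x" by (rule M)
    \<comment> \<open>The scalar measure of \<open>E\<close> at \<open>x\<close> is the probability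
      measure \<open>M x\<close> scaled to total mass \<open>(norm x)\<^sup>2\<close>, hence again
      supported in the unit interval.\<close>
    have eq: "pvm_measure E x = density (M x) (\<lambda>t. ennreal ((norm x)\<^sup>2))"
    proof (rule measure_eqI)
      fix S assume "S \<in> sets (pvm_measure E x)"
      then have S: "S \<in> sets borel"
        by simp
      have "rinner x (E S x) = (norm x)\<^sup>2 * prob S"
        using E[OF S, of x x] S by (simp add: mM)
      then show "emeasure (pvm_measure E x) S = emeasure (density (M x) (\<lambda>t. ennreal ((norm x)\<^sup>2))) S"
        using S by (simp add: emeasure_pvm_measure[OF pvm] emeasure_density_const emeasure_eq_measure
            ennreal_mult)
    qed simp
    have int: "integrable (M x) (\<lambda>t. t)"
      using AE[of x] by (intro integrable_const_bound[where B=1]) (auto elim: eventually_mono)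
    show "integrable (pvm_measure E x) (\<lambda>t. t)"
      unfolding eq by (subst integrable_density) (simp_all add: int)
    have "(\<integral>t. t \<partial>pvm_measure E x) = (norm x)\<^sup>2 * (\<integral>t. t \<partial>M x)"
      unfolding eq by (subst integral_density) simp_all
    also have "\<dots> = rinner x (A x)"
      using mM[of x "\<lambda>t. t"] moments[of x x 1] by simp
    finally have "(\<integral>t. t \<partial>pvm_measure E x) = rinner x (A x)" .
    then show "cinner x (A x) = complex_of_real (\<integral>t. t \<partial>pvm_measure E x)"
      using cinner_hermitean_real[OF hA, of x] by (simp add: complex_eq_iff)
  qed
  moreover have "E S o\<^sub>L Y = Y o\<^sub>L E S" if Y: "Y \<in> bounded_ops" and AY: "A o\<^sub>L Y = Y o\<^sub>L A" and S: "S \<in> sets borel" for Y S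
  proof (rule adjoint_exists[OF Y], rule blinfun_eqI, rule rinner_eqI)
    fix Z x y assume "\<And>x y. rinner (Y x) y = rinner x (blinfun_apply Z y)"
    then have Z: "rinner (Z x) u = rinner x (Y u)" for u
      by (metis rinner_commute)
    have "A (Y u) = Y (A u)" for u
      using arg_cong[OF AY, of "\<lambda>T. blinfun_apply T u"] by simp
    \<comment> \<open>With \<open>Z\<close> the adjoint of \<open>Y\<close>, the pairs (x, Y y) and
      (Z x, y) have equal moments because \<open>Y\<close> commutes with all powers of
      \<open>A\<close>.\<close>
    then have "m x (Y y) (\<lambda>t. t ^ k) = rinner (Z x) ((blinfun_apply A ^^ k) y)" for k
      by (simp add: moments Z funpow_commute)
    then have "m x (Y y) (indicator S) = rinner (Z x) (E S y)"
      by (intro meq sm S)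
    then show "rinner x ((E S o\<^sub>L Y) y) = rinner x ((Y o\<^sub>L E S) y)"
      by (simp add: E S Z)
  qed
  ultimately show thesis
    using that by blast
qed

lemma pvm_idem: "projection_valued_measure E \<Longrightarrow> S \<in> sets borel \<Longrightarrow> E S (E S x) = blinfun_apply (E S) x"
  by (rule projection_op_idem[OF pvm_projection])

lemma pvm_hermitean: "projection_valued_measure E \<Longrightarrow> S \<in> sets borel \<Longrightarrow> hermitean (E S)"
  by (rule projection_op_hermitean[OF pvm_projection])

lemma borel_Compl: "S \<in> sets borel \<Longrightarrow> - S \<in> sets borel"
  by (metis Compl_eq_Diff_UNIV sets.compl_sets space_borel)

lemma pvm_complement:
  assumes E: "projection_valued_measure E" and S: "S \<in> sets borel"
  shows "E (- S) = id_blinfun - E S"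
proof (rule hermitean_eqI)
  have S': "- S \<in> sets borel"
    by (rule borel_Compl[OF S])
  show "hermitean (E (- S))" "hermitean (id_blinfun - E S)"
    using pvm_hermitean[OF E S'] pvm_hermitean[OF E S] by (auto intro: hermitean_diff hermitean_id)
  fix x
  interpret finite_measure "pvm_measure E x"
    by (rule finite_measure_pvm_measure[OF E])
  have "measure (pvm_measure E x) (UNIV - S) = measure (pvm_measure E x) UNIV - measure (pvm_measure E x) S"
    using finite_measure_compl[of S] S by simp
  then show "rinner x (E (- S) x) = rinner x ((id_blinfun - E S) x)"
    using S S' by (simp add: measure_pvm_measure[OF E] pvm_UNIV[OF E] blinfun.diff_left cinner_linear
        Compl_eq_Diff_UNIV)
qed

lemma pvm_greaterThan:
  assumes E: "projection_valued_measure E"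
  shows "E {a<..} = id_blinfun - E {..a}"
  using pvm_complement[OF E, of "{..a}"] by simp

text \<open>Pulling \<open>E\<close> back along the affine map pushes every scalar measure forward
  along it, so integrals of the identity change by substitution.\<close>

lemma spectral_measure_affine:
  fixes A :: "'h::complex_hilbert_space \<Rightarrow>\<^sub>L 'h"
  assumes "is_spectral_measure A E"
  shows "is_spectral_measure (r *\<^sub>R A + s *\<^sub>R id_blinfun) (\<lambda>S. E ((\<lambda>t. r * t + s) -` S))"
proof -
  let ?h = "\<lambda>t::real. r * t + s"
  have pvm: "projection_valued_measure E"
    using assms by (simp add: is_spectral_measure_def)
  have vim: "?h -` S \<in> sets borel" if "S \<in> sets borel" for S
    using measurable_sets[of ?h borel borel S] that by simp
  have pvm': "projection_valued_measure (\<lambda>S. E (?h -` S))"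
    unfolding projection_valued_measure_def
  proof (intro conjI ballI allI impI)
    fix F :: "nat \<Rightarrow> real set" and x assume F: "range F \<subseteq> sets borel \<and> disjoint_family F"
    have "(\<lambda>n. blinfun_apply (E (?h -` F n)) x) sums blinfun_apply (E (\<Union>n. ?h -` F n)) x"
      by (rule pvm_sums[OF pvm]) (use F vim in \<open>auto simp: disjoint_family_on_def simp flip: vimage_Int\<close>)
    then show "(\<lambda>n. blinfun_apply (E (?h -` F n)) x) sums blinfun_apply (E (?h -` (\<Union>n. F n))) x"
      by (simp add: vimage_UN)
  qed (use pvm_projection[OF pvm] pvm_empty[OF pvm] pvm_UNIV[OF pvm] pvm_Int[OF pvm] vim in auto)
  show ?thesis
    unfolding is_spectral_measure_def
  proof (intro conjI allI pvm')
    fix x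
    interpret finite_measure "pvm_measure E x"
      by (rule finite_measure_pvm_measure[OF pvm])
    have eq: "pvm_measure (\<lambda>S. E (?h -` S)) x = distr (pvm_measure E x) borel ?h"
      by (rule measure_eqI) (auto simp: emeasure_pvm_measure[OF pvm] emeasure_pvm_measure[OF pvm'] emeasure_distr vim)
    have int: "integrable (pvm_measure E x) (\<lambda>t. t)"
      and A: "cinner x (A x) = of_real (\<integral>t. t \<partial>pvm_measure E x)"
      using assms by (auto simp: is_spectral_measure_def)
    show "integrable (pvm_measure (\<lambda>S. E (?h -` S)) x) (\<lambda>t. t)"
      unfolding eq by (subst integrable_distr_eq) (auto simp: int)
    have "(\<integral>t. t \<partial>pvm_measure (\<lambda>S. E (?h -` S)) x) = (\<integral>t. ?h t \<partial>pvm_measure E x)"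
      unfolding eq by (subst integral_distr) auto
    also have "\<dots> = r * (\<integral>t. t \<partial>pvm_measure E x) + s * (norm x)\<^sup>2"
      using int by (simp add: measure_pvm_measure[OF pvm] pvm_UNIV[OF pvm] rinner_same)
    finally show "cinner x ((r *\<^sub>R A + s *\<^sub>R id_blinfun) x)
        = of_real (\<integral>t. t \<partial>pvm_measure (\<lambda>S. E (?h -` S)) x)"
      by (simp add: blinfun.add_left blinfun.scaleR_left cinner_linear A cinner_same)
  qed
qed

lemma spectral_theorem:
  fixes A :: "'h::complex_hilbert_space \<Rightarrow>\<^sub>L 'h"
  assumes A: "hermitean A"
  obtains E where "is_spectral_measure A E"
    "\<And>Y S. Y \<in> bounded_ops \<Longrightarrow> A o\<^sub>L Y = Y o\<^sub>L A \<Longrightarrow> S \<in> sets borel \<Longrightarrow> E S o\<^sub>L Y = Y o\<^sub>L E S"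
proof -
  \<comment> \<open>The summand 1 keeps the scale positive when \<open>A\<close> is 0.\<close>
  define c where "c = norm A + 1"
  have c: "0 < c"
    by (simp add: c_def add_nonneg_pos)
  \<comment> \<open>The affine map that carries the interval from \<open>- c\<close> to
    \<open>c\<close> onto the unit interval.\<close>
  define A' where "A' = (1 / (2 * c)) *\<^sub>R (A + c *\<^sub>R id_blinfun)"
  have A_eq: "A = (2 * c) *\<^sub>R A' + (- c) *\<^sub>R id_blinfun"
    using c by (simp add: A'_def)
  have hA': "hermitean A'"
    unfolding A'_def by (intro hermitean_scaleR hermitean_add A hermitean_id)
  have bound: "\<bar>rinner x (A x)\<bar> \<le> c * (norm x)\<^sup>2" for x
  proof -
    have "\<bar>rinner x (A x)\<bar> \<le> norm x * (norm A * norm x)"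
      by (rule order_trans[OF rinner_cauchy_schwarz mult_left_mono[OF norm_blinfun]]) simp
    also have "\<dots> \<le> c * (norm x)\<^sup>2"
      by (simp add: c_def power2_eq_square algebra_simps)
    finally show ?thesis .
  qed
  have "positive_op A'"
  proof (rule positive_opI[OF hA'])
    fix x
    have "rinner x (A' x) = (rinner x (A x) + c * (norm x)\<^sup>2) / (2 * c)"
      by (simp add: A'_def blinfun.add_left blinfun.scaleR_left cinner_linear rinner_same)
    then show "0 \<le> rinner x (A' x)"
      using bound[of x] c by (simp add: abs_le_iff)
  qed
  moreover have "positive_op (id_blinfun - A')"
  proof (rule positive_opI)
    show "hermitean (id_blinfun - A')"
      by (intro hermitean_diff hermitean_id hA')
    show "0 \<le> rinner x ((id_blinfun - A') x)" for x
      using bound[of x] c by (simp add: A'_def blinfun.diff_left blinfun.add_left blinfun.scaleR_left cinner_linear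
          rinner_same abs_le_iff field_simps)
  qed
  ultimately obtain E' where E': "is_spectral_measure A' E'"
    "\<And>Y S. Y \<in> bounded_ops \<Longrightarrow> A' o\<^sub>L Y = Y o\<^sub>L A' \<Longrightarrow> S \<in> sets borel \<Longrightarrow> E' S o\<^sub>L Y = Y o\<^sub>L E' S"
    using contraction_spectral_measure by blast
  show thesis
  proof (rule that)
    show "is_spectral_measure A (\<lambda>S. E' ((\<lambda>t. 2 * c * t + - c) -` S))"
      by (subst A_eq) (rule spectral_measure_affine[OF E'(1)])
    fix Y :: "'h \<Rightarrow>\<^sub>L 'h" and S :: "real set"
    assume Y: "Y \<in> bounded_ops" "A o\<^sub>L Y = Y o\<^sub>L A" and S: "S \<in> sets borel"
    have "A' o\<^sub>L Y = Y o\<^sub>L A'"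
    proof (rule blinfun_eqI)
      fix x
      have "A (Y x) = Y (A x)"
        using arg_cong[OF Y(2), of "\<lambda>T. blinfun_apply T x"] by simp
      then show "(A' o\<^sub>L Y) x = (Y o\<^sub>L A') x"
        by (simp add: A'_def blinfun.scaleR_left blinfun.scaleR_right blinfun.add_left blinfun.add_right)
    qed
    moreover have "(\<lambda>t. 2 * c * t + - c) -` S \<in> sets borel"
      using measurable_sets[of "\<lambda>t. 2 * c * t + - c" borel borel S] S by simp
    ultimately show "E' ((\<lambda>t. 2 * c * t + - c) -` S) o\<^sub>L Y = Y o\<^sub>L E' ((\<lambda>t. 2 * c * t + - c) -` S)"
      by (intro E'(2) Y)
  qed
qed

section \<open>Uniqueness of the spectral measure\<close>

lemma spectral_measure_pvm: "is_spectral_measure A E \<Longrightarrow> projection_valued_measure E"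
  and spectral_measure_integrable: "is_spectral_measure A E \<Longrightarrow> integrable (pvm_measure E x) (\<lambda>t. t)"
  and spectral_measure_rinner: "is_spectral_measure A E \<Longrightarrow> rinner x (blinfun_apply A x) = (\<integral>t. t \<partial>pvm_measure E x)"
  by (auto simp: is_spectral_measure_def)

lemma pvm_measure_restrict:
  assumes E: "projection_valued_measure E" and S: "S \<in> sets borel"
  shows "pvm_measure E (E S x) = density (pvm_measure E x) (indicator S)"
proof (rule measure_eqI)
  fix S' assume "S' \<in> sets (pvm_measure E (E S x))"
  then have S': "S' \<in> sets borel"
    by simp
  have "rinner (E S x) (E S' (E S x)) = rinner x (E (S \<inter> S' \<inter> S) x)"
    using S S' by (simp add: pvm_Int[OF E] hermitean_cinner[OF pvm_hermitean[OF E S]])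
  also have "S \<inter> S' \<inter> S = S \<inter> S'"
    by auto
  finally show "emeasure (pvm_measure E (E S x)) S' = emeasure (density (pvm_measure E x) (indicator S)) S'"
    using S S' by (subst emeasure_restricted) (auto simp: emeasure_pvm_measure[OF E])
qed simp

text \<open>This concerns an arbitrary spectral measure, known only through diagonal forms. The
  scalar measure at \<open>E R x\<close> is that at \<open>x\<close> restricted to \<open>R\<close>;
  hence the form of \<open>A\<close> splits over \<open>S\<close> and its complement, the cross
  terms vanish, and \<open>A\<close> is block diagonal.\<close>

lemma spectral_measure_commute:
  assumes A: "hermitean A" and AE: "is_spectral_measure A E" and S: "S \<in> sets borel"
  shows "A (E S x) = E S (blinfun_apply A x)"
proof -
  note E = spectral_measure_pvm[OF AE]
  have S': "- S \<in> sets borel"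
    by (rule borel_Compl[OF S])
  have part: "rinner (E R x) (A (E R x)) = (\<integral>t. indicator R t * t \<partial>pvm_measure E x)"
    if R: "R \<in> sets borel" for R x
  proof -
    have "(\<integral>t. t \<partial>density (pvm_measure E x) (\<lambda>t. ennreal (indicator R t)))
        = (\<integral>t. indicator R t *\<^sub>R t \<partial>pvm_measure E x)"
      using R by (intro integral_density) auto
    then show ?thesis
      unfolding spectral_measure_rinner[OF AE] pvm_measure_restrict[OF E R] by (simp add: ennreal_indicator)
  qed
  have split: "rinner (E S x) (A (E S x)) + rinner (E (- S) x) (A (E (- S) x)) = rinner x (A x)" for x
  proof -
    have "integrable (pvm_measure E x) (\<lambda>t. indicator R t * t)" if "R \<in> sets borel" for R
      using integrable_mult_indicator[of R "pvm_measure E x" "\<lambda>t. t"] that spectral_measure_integrable[OF AE]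
      by simp
    then have "(\<integral>t. indicator S t * t \<partial>pvm_measure E x) + (\<integral>t. indicator (- S) t * t \<partial>pvm_measure E x)
        = (\<integral>t. indicator S t * t + indicator (- S) t * t \<partial>pvm_measure E x)"
      using S S' by simp
    also have "\<dots> = (\<integral>t. t \<partial>pvm_measure E x)"
      by (rule Bochner_Integration.integral_cong) (auto simp: indicator_def)
    finally show ?thesis
      using spectral_measure_rinner[OF AE, of x] by (simp only: part[OF S] part[OF S'])
  qed
  have dec: "x = E S x + E (- S) x" for x
    by (simp add: pvm_complement[OF E S] blinfun.diff_left)
  have cross: "rinner (E S x) (A (E (- S) x)) = 0" for x
  proof -
    have "rinner (E (- S) x) (A (E S x)) = rinner (E S x) (A (E (- S) x))"
      using hermitean_cinner[OF A, of "E (- S) x" "E S x"] rinner_commute[of "A (E (- S) x)" "E S x"] by simp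
    moreover have "rinner x (A x) = rinner (E S x + E (- S) x) (A (E S x + E (- S) x))"
      by (simp only: dec[of x, symmetric])
    ultimately show ?thesis
      using split[of x] by (simp add: blinfun.add_right cinner_linear)
  qed
  have orth: "E S (E (- S) u) = 0" "E (- S) (E S u) = 0" for u
    by (simp_all add: pvm_complement[OF E S] blinfun.diff_left blinfun.diff_right pvm_idem[OF E S])
  \<comment> \<open>Inserting the sum of a vector from each block decouples the two
    arguments.\<close>
  have cross': "rinner (E S x) (A (E (- S) y)) = 0" for x y
    using cross[of "E S x + E (- S) y"]
    by (simp add: blinfun.add_right orth pvm_idem[OF E S] pvm_idem[OF E S'])
  have "E S (A (E (- S) y)) = 0" for y
    by (rule rinner_eqI) (use cross' in \<open>simp add: cinner_linear flip: hermitean_cinner[OF pvm_hermitean[OF E S]]\<close>)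
  moreover have "E (- S) (A (E S y)) = 0" for y
  proof (rule rinner_eqI)
    fix x
    have "rinner x (E (- S) (A (E S y))) = rinner (A (E (- S) x)) (E S y)"
      by (simp add: hermitean_cinner[OF A] hermitean_cinner[OF pvm_hermitean[OF E S']])
    then show "rinner x (E (- S) (A (E S y))) = rinner x 0"
      using cross'[of y x] by (simp add: rinner_commute cinner_linear)
  qed
  ultimately have "E S (A (E S x + E (- S) x)) = E S (A (E S x)) + E (- S) (A (E S x))"
    by (simp add: blinfun.add_right)
  then show ?thesis
    by (simp only: dec[symmetric])
qed

text \<open>A vector in the range of \<open>E S\<close> has its scalar measure concentrated on
  \<open>S\<close>, with total mass \<open>(norm x)\<^sup>2\<close>.\<close>

lemma spectral_measure_bounds:
  assumes AE: "is_spectral_measure A E" and S: "S \<in> sets borel" and x: "E S x = x"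
  shows "S \<subseteq> {..a} \<Longrightarrow> rinner x (A x) \<le> a * (norm x)\<^sup>2"
    and "S \<subseteq> {b..} \<Longrightarrow> b * (norm x)\<^sup>2 \<le> rinner x (A x)"
proof -
  note E = spectral_measure_pvm[OF AE]
  interpret finite_measure "pvm_measure E x"
    by (rule finite_measure_pvm_measure[OF E])
  have ae: "AE t in pvm_measure E x. t \<in> S"
  proof (rule AE_I)
    have S': "- S \<in> sets borel"
      by (rule borel_Compl[OF S])
    show "{t \<in> space (pvm_measure E x). t \<notin> S} \<subseteq> - S" "- S \<in> sets (pvm_measure E x)"
      using S' by auto
    show "emeasure (pvm_measure E x) (- S) = 0"
      using S' by (simp add: emeasure_pvm_measure[OF E] pvm_complement[OF E S] blinfun.diff_left x cinner_linear)
  qed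
  have mass: "measure (pvm_measure E x) UNIV = (norm x)\<^sup>2"
    by (simp add: measure_pvm_measure[OF E] pvm_UNIV[OF E] rinner_same)
  show "rinner x (A x) \<le> a * (norm x)\<^sup>2" if "S \<subseteq> {..a}"
  proof -
    have "(\<integral>t. t \<partial>pvm_measure E x) \<le> (\<integral>t. a \<partial>pvm_measure E x)"
      using ae that by (intro integral_mono_AE spectral_measure_integrable[OF AE] integrable_const)
        (auto elim: eventually_mono)
    then show ?thesis
      by (simp add: spectral_measure_rinner[OF AE] mass mult.commute)
  qed
  show "b * (norm x)\<^sup>2 \<le> rinner x (A x)" if "S \<subseteq> {b..}"
  proof -
    have "(\<integral>t. b \<partial>pvm_measure E x) \<le> (\<integral>t. t \<partial>pvm_measure E x)"
      using ae that by (intro integral_mono_AE spectral_measure_integrable[OF AE] integrable_const)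
        (auto elim: eventually_mono)
    then show ?thesis
      by (simp add: spectral_measure_rinner[OF AE] mass mult.commute)
  qed
qed

text \<open>On a vector fixed by both \<open>E {..a}\<close> and \<open>F {b..}\<close> the form of \<open>A\<close> is at most \<open>a\<close> and at
  least \<open>b\<close>, so there is no such vector for \<open>a < b\<close>.\<close>

lemma commuting_spectral_measures_le:
  assumes A: "hermitean A" and E: "is_spectral_measure A E" and F: "is_spectral_measure A F"
    and comm: "\<And>S S' x. S \<in> sets borel \<Longrightarrow> S' \<in> sets borel \<Longrightarrow> E S (F S' x) = F S' (blinfun_apply (E S) x)"
  shows "F {a<..} (E {..a} x) = 0"
proof -
  note pE = spectral_measure_pvm[OF E] and pF = spectral_measure_pvm[OF F]
  define y where "y = E {..a} x"
  have zero: "F {b..} y = 0" if "a < b" for b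
  proof -
    define z where "z = F {b..} y"
    have z: "E {..a} z = z" "F {b..} z = z"
      by (simp_all add: z_def y_def comm pvm_idem[OF pE] pvm_idem[OF pF])
    have "b * (norm z)\<^sup>2 \<le> a * (norm z)\<^sup>2"
      using spectral_measure_bounds(1)[OF E _ z(1), of a] spectral_measure_bounds(2)[OF F _ z(2), of b] by simp
    then show ?thesis
      using that by (simp add: z_def[symmetric] mult_le_cancel_right)
  qed
  \<comment> \<open>Only a strict gap forces the vector to vanish, so the open half-line is
    exhausted by closed half-lines starting beyond \<open>a\<close>.\<close>
  have "emeasure (pvm_measure F y) (\<Union>n. {a + inverse (real (Suc n))..}) = 0"
    by (rule emeasure_UN_eq_0) (auto simp: emeasure_pvm_measure[OF pF] zero cinner_linear)
  moreover have "(\<Union>n. {a + inverse (real (Suc n))..}) = {a<..}"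
  proof (intro set_eqI iffI)
    fix t assume "t \<in> {a<..}"
    then obtain n where "inverse (real (Suc n)) < t - a"
      using reals_Archimedean[of "t - a"] by auto
    then show "t \<in> (\<Union>n. {a + inverse (real (Suc n))..})"
      by (auto intro!: exI[of _ n])
  qed (auto intro: less_le_trans[of a "a + inverse (real (Suc _))"])
  ultimately have "(norm (F {a<..} y))\<^sup>2 \<le> 0"
    by (simp add: emeasure_pvm_measure[OF pF] projection_op_rinner[OF pvm_projection[OF pF]] ennreal_eq_0_iff)
  then show ?thesis
    by (simp add: y_def)
qed

text \<open>On a half-line each projection absorbs the other, so commutation makes them equal. The
  scalar measures then share their distribution functions, and the operators their diagonal
  forms.\<close>

lemma spectral_measure_unique:
  assumes A: "hermitean A" and E: "is_spectral_measure A E" and F: "is_spectral_measure A F"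
    and comm: "\<And>S S' x. S \<in> sets borel \<Longrightarrow> S' \<in> sets borel \<Longrightarrow> E S (F S' x) = F S' (blinfun_apply (E S) x)"
    and S: "S \<in> sets borel"
  shows "E S = F S"
proof -
  note pE = spectral_measure_pvm[OF E] and pF = spectral_measure_pvm[OF F]
  have comm': "F S (E S' x) = E S' (F S x)" if "S \<in> sets borel" "S' \<in> sets borel" for S S' x
    using comm[OF that(2,1)] by simp
  have half: "E {..a} x = F {..a} x" for a x
  proof -
    have "E {..a} x - F {..a} (E {..a} x) = 0" "F {..a} x - E {..a} (F {..a} x) = 0"
      using commuting_spectral_measures_le[OF A E F comm, of a x]
        commuting_spectral_measures_le[OF A F E comm', of a x]
      by (simp_all only: pvm_greaterThan[OF pE] pvm_greaterThan[OF pF] blinfun.diff_left blinfun_apply_id_blinfun id_apply)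
    then show ?thesis
      using comm[of "{..a}" "{..a}" x] by simp
  qed
  have "pvm_measure E x = pvm_measure F x" for x
  proof (rule cdf_unique')
    show "finite_borel_measure (pvm_measure E x)" "finite_borel_measure (pvm_measure F x)"
      by (auto simp: finite_borel_measure_def finite_borel_measure_axioms_def finite_measure_pvm_measure pE pF)
    show "cdf (pvm_measure E x) = cdf (pvm_measure F x)"
      by (auto simp: cdf_def measure_pvm_measure pE pF half)
  qed
  then have "rinner x (E S x) = rinner x (F S x)" for x
    using measure_pvm_measure[OF pE S, of x] measure_pvm_measure[OF pF S, of x] by simp
  then show ?thesis
    by (intro hermitean_eqI pvm_hermitean pE pF S)
qed

section \<open>Spectral projections\<close>

text \<open>An arbitrary spectral measure commutes with \<open>A\<close>, hence with the constructed
  one, hence equals it. This makes the definite description unambiguous.\<close>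

lemma spectral_projection_eq:
  assumes A: "hermitean A" and F: "is_spectral_measure A F" and S: "S \<in> sets borel"
  shows "spectral_projection A S = F S"
proof -
  obtain E where E: "is_spectral_measure A E"
    "\<And>Y S. Y \<in> bounded_ops \<Longrightarrow> A o\<^sub>L Y = Y o\<^sub>L A \<Longrightarrow> S \<in> sets borel \<Longrightarrow> E S o\<^sub>L Y = Y o\<^sub>L E S"
    using spectral_theorem[OF A] by blast
  have unique: "E S = G S" if G: "is_spectral_measure A G" for G
  proof (rule spectral_measure_unique[OF A E(1) G _ S])
    fix R R' :: "real set" and x assume R: "R \<in> sets borel" "R' \<in> sets borel"
    have "A o\<^sub>L G R' = G R' o\<^sub>L A"
      by (rule blinfun_eqI) (simp add: spectral_measure_commute[OF A G R(2)])
    then have "E R o\<^sub>L G R' = G R' o\<^sub>L E R"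
      by (intro E(2) R hermitean_bounded_ops pvm_hermitean spectral_measure_pvm[OF G])
    from arg_cong[OF this, of "\<lambda>T. blinfun_apply T x"] show "E R (G R' x) = G R' (E R x)"
      by simp
  qed
  show ?thesis
    unfolding spectral_projection_def
    by (rule the_equality) (use F unique in \<open>auto, metis\<close>)
qed

lemma spectral_projection_properties:
  fixes A :: "'h::complex_hilbert_space \<Rightarrow>\<^sub>L 'h"
  assumes A: "hermitean A" and S: "S \<in> sets borel"
  shows "projection_op (spectral_projection A S)"
    and "\<And>Y. Y \<in> bounded_ops \<Longrightarrow> A o\<^sub>L Y = Y o\<^sub>L A \<Longrightarrow>
      spectral_projection A S o\<^sub>L Y = Y o\<^sub>L spectral_projection A S"
proof -
  obtain E where E: "is_spectral_measure A E"
    "\<And>Y S. Y \<in> bounded_ops \<Longrightarrow> A o\<^sub>L Y = Y o\<^sub>L A \<Longrightarrow> S \<in> sets borel \<Longrightarrow> E S o\<^sub>L Y = Y o\<^sub>L E S"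
    using spectral_theorem[OF A] by blast
  note eq = spectral_projection_eq[OF A E(1) S]
  show "projection_op (spectral_projection A S)"
    unfolding eq by (rule pvm_projection[OF spectral_measure_pvm[OF E(1)] S])
  show "spectral_projection A S o\<^sub>L Y = Y o\<^sub>L spectral_projection A S"
    if "Y \<in> bounded_ops" "A o\<^sub>L Y = Y o\<^sub>L A" for Y
    unfolding eq by (rule E(2)[OF that S])
qed

text \<open>Whatever commutes with \<open>N\<close> commutes with \<open>A\<close> and so with its
  spectral projections; the double commutant gives membership.\<close>

lemma spectral_projection_in_von_neumann_algebra:
  assumes N: "von_neumann_algebra N" and A: "A \<in> N" "hermitean A" and S: "S \<in> sets borel"
  shows "spectral_projection A S \<in> N"
proof -
  note P = spectral_projection_properties[OF A(2) S]
  have "spectral_projection A S \<in> commutant (commutant N)"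
    unfolding commutant_def[of "commutant N"]
  proof (intro CollectI conjI ballI)
    show "spectral_projection A S \<in> bounded_ops"
      using P(1) by (intro hermitean_bounded_ops projection_op_hermitean)
    fix Y assume "Y \<in> commutant N"
    then have "Y \<in> bounded_ops" "A o\<^sub>L Y = Y o\<^sub>L A"
      using A(1) by (auto simp: commutant_def)
    then show "Y o\<^sub>L spectral_projection A S = spectral_projection A S o\<^sub>L Y"
      using P(2) by simp
  qed
  then show ?thesis
    using N by (simp add: von_neumann_algebra_def)
qed

text \<open>If every half-line had a trivial projection, each real number would bound the Rayleigh
  quotient from above or from below on the whole space. The quotient would be constant and
  \<open>A\<close> scalar.\<close>

lemma nonscalar_spectral_projection:
  fixes A :: "'h::complex_hilbert_space \<Rightarrow>\<^sub>L 'h"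
  assumes A: "hermitean A" and ns: "A \<notin> range scalar_op"
  obtains S where "S \<in> sets borel" "spectral_projection A S \<noteq> 0" "spectral_projection A S \<noteq> id_blinfun"
proof (rule ccontr)
  assume "\<not> thesis"
  then have trivial: "spectral_projection A {..a} = 0 \<or> spectral_projection A {..a} = id_blinfun" for a
    using that[of "{..a}"] by auto
  obtain E where E: "is_spectral_measure A E"
    using spectral_theorem[OF A] by blast
  note pE = spectral_measure_pvm[OF E]
  have half: "(\<forall>x. rinner x (A x) \<le> a * (norm x)\<^sup>2) \<or> (\<forall>x. a * (norm x)\<^sup>2 \<le> rinner x (A x))" for a
  proof (cases "E {..a} = id_blinfun")
    case True
    then show ?thesis
      using spectral_measure_bounds(1)[OF E, of "{..a}" _ a] by auto
  next
    case False
    then have "E {..a} = 0"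
      using trivial[of a] spectral_projection_eq[OF A E, of "{..a}"] by simp
    then have "E {a<..} = id_blinfun"
      by (simp add: pvm_greaterThan[OF pE])
    moreover have "{a<..} \<subseteq> {a..}"
      by auto
    ultimately show ?thesis
      using spectral_measure_bounds(2)[OF E, of "{a<..}" _ a] by auto
  qed
  have "\<exists>c. \<forall>x. rinner x (A x) = c * (norm x)\<^sup>2"
  proof (cases "\<exists>u::'h. u \<noteq> 0")
    case True
    then obtain u :: 'h where u: "u \<noteq> 0"
      by blast
    define q where "q x = rinner x (A x) / (norm x)\<^sup>2" for x
    have "q x \<le> q y" if "x \<noteq> 0" "y \<noteq> 0" for x y
    proof (rule ccontr)
      assume "\<not> q x \<le> q y"
      \<comment> \<open>A number strictly between two values of the quotient is neither an upper nor
        a lower bound.\<close>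
      then obtain a where "q y < a" "a < q x"
        using dense by (metis not_le)
      then show False
        using half[of a] that unfolding q_def
        by (simp add: divide_less_eq less_divide_eq) (meson not_le)
    qed
    then have "q x = q u" if "x \<noteq> 0" for x
      using u that by (simp add: order_antisym)
    then have "rinner x (A x) = q u * (norm x)\<^sup>2" for x
      by (cases "x = 0") (auto simp: q_def cinner_linear field_simps)
    then show ?thesis
      by blast
  next
    \<comment> \<open>On the zero space every operator is scalar, so this case also ends in the
      contradiction.\<close>
    case False
    then have "x = 0" for x :: 'h
      by blast
    then have "rinner x (A x) = 0 * (norm x)\<^sup>2" for x
      by (metis cinner_zero_left mult_zero_left zero_complex.sel(1))
    then show ?thesis
      by blast
  qed
  then obtain c where c: "\<And>x. rinner x (A x) = c * (norm x)\<^sup>2"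
    by blast
  have "A = c *\<^sub>R id_blinfun"
    by (rule hermitean_eqI[OF A hermitean_scaleR[OF hermitean_id]])
      (simp add: c blinfun.scaleR_left cinner_linear cinner_same)
  also have "\<dots> = scalar_op (of_real c)"
    by (rule blinfun_eqI) (simp add: blinfun.scaleR_left scalar_op_apply scaleR_scaleC)
  finally show False
    using ns by blast
qed

section \<open>Ampliations\<close>

text \<open>Gram-Schmidt: a new vector contributes its normalized residual, or nothing if the
  residual vanishes. The result is stated as expansion identities, the form in which tensor sums are
  rearranged.\<close>

lemma orthonormal_expansion:
  fixes Y :: "'k::complex_hilbert_space set"
  assumes "finite Y"
  obtains B where "finite B" "\<And>e e'. e \<in> B \<Longrightarrow> e' \<in> B \<Longrightarrow> cinner e e' = (if e = e' then 1 else 0)"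
    "\<And>y. y \<in> Y \<Longrightarrow> (\<Sum>e\<in>B. cinner e y *\<^sub>C e) = y"
proof -
  have "\<exists>B. finite B \<and> (\<forall>e\<in>B. \<forall>e'\<in>B. cinner e e' = (if e = e' then 1 else 0)) \<and>
    (\<forall>y\<in>Y. (\<Sum>e\<in>B. cinner e y *\<^sub>C e) = y)"
    using assms
  proof (induction Y rule: finite_induct)
    case empty
    then show ?case
      by (intro exI[of _ "{}"]) auto
  next
    case (insert y Y)
    then obtain B where B: "finite B" "\<And>e e'. e \<in> B \<Longrightarrow> e' \<in> B \<Longrightarrow> cinner e e' = (if e = e' then 1 else 0)"
      "\<And>u. u \<in> Y \<Longrightarrow> (\<Sum>e\<in>B. cinner e u *\<^sub>C e) = u"
      by blast
    define r where "r = y - (\<Sum>e\<in>B. cinner e y *\<^sub>C e)"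
    have orth: "cinner e r = 0" if "e \<in> B" for e
    proof -
      have "(\<Sum>e'\<in>B. cinner e' y * cinner e e') = (\<Sum>e'\<in>B. if e' = e then cinner e y else 0)"
        using that by (intro sum.cong) (auto simp: B)
      then show ?thesis
        using that B(1) by (simp add: r_def cinner_linear cinner_sum_right)
    qed
    show ?case
    proof (cases "r = 0")
      case True
      then show ?thesis
        using B by (intro exI[of _ B]) (auto simp: r_def)
    next
      case False
      define f where "f = inverse (norm r) *\<^sub>R r"
      have f: "cinner f f = 1" "\<And>e. e \<in> B \<Longrightarrow> cinner e f = 0" "\<And>e. e \<in> B \<Longrightarrow> cinner f e = 0"
        using False orth cinner_commute[of _ f]
        by (auto simp: f_def cinner_linear cinner_same field_simps power2_eq_square)
      then have "f \<notin> B"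
        by fastforce
      have fin: "cinner f u = cinner f (u - (\<Sum>e\<in>B. cinner e u *\<^sub>C e))" for u
        by (simp add: cinner_linear cinner_sum_right f)
      have fY: "cinner f u = 0" if "u \<in> Y" for u
        using fin[of u] B(3)[OF that] by (simp add: cinner_linear)
      have "cinner f y = of_real (norm r)"
        using fin[of y] False unfolding r_def[symmetric]
        by (simp add: f_def cinner_linear cinner_same field_simps power2_eq_square)
      then have "cinner f y *\<^sub>C f = r"
        using False by (simp add: f_def flip: scaleR_scaleC)
      then show ?thesis
        using B f \<open>f \<notin> B\<close> fY by (intro exI[of _ "insert f B"]) (auto simp: r_def scaleC_zero)
    qed
  qed
  then show thesis
    using that by metis
qed

lemma hilbert_tensor_add_left: "hilbert_tensor t \<Longrightarrow> t (x + x') y = t x y + t x' y"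
  and hilbert_tensor_add_right: "hilbert_tensor t \<Longrightarrow> t x (y + y') = t x y + t x y'"
  and hilbert_tensor_scaleC_left: "hilbert_tensor t \<Longrightarrow> t (c *\<^sub>C x) y = c *\<^sub>C t x y"
  and hilbert_tensor_scaleC_right: "hilbert_tensor t \<Longrightarrow> t x (c *\<^sub>C y) = c *\<^sub>C t x y"
  and hilbert_tensor_cinner: "hilbert_tensor t \<Longrightarrow> cinner (t x y) (t x' y') = cinner x x' * cinner y y'"
  and hilbert_tensor_dense: "hilbert_tensor t \<Longrightarrow> closure (span (range (\<lambda>(x, y). t x y))) = UNIV"
  unfolding hilbert_tensor_def by blast+

lemma hilbert_tensor_scaleR_left: "hilbert_tensor t \<Longrightarrow> t (r *\<^sub>R x) y = r *\<^sub>R t x y"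
  by (simp add: scaleR_scaleC hilbert_tensor_scaleC_left)

lemma hilbert_tensor_zero_left: "hilbert_tensor t \<Longrightarrow> t 0 y = 0"
  using hilbert_tensor_scaleR_left[of t 0 0 y] by simp

lemma hilbert_tensor_zero_right: "hilbert_tensor t \<Longrightarrow> t x 0 = 0"
  using hilbert_tensor_scaleC_right[of t x 0 0] by (simp add: scaleC_zero)

lemma hilbert_tensor_sum_left: "hilbert_tensor t \<Longrightarrow> t (\<Sum>i\<in>I. f i) y = (\<Sum>i\<in>I. t (f i) y)"
  by (induction I rule: infinite_finite_induct) (auto simp: hilbert_tensor_zero_left hilbert_tensor_add_left)

lemma hilbert_tensor_sum_right: "hilbert_tensor t \<Longrightarrow> t x (\<Sum>i\<in>I. f i) = (\<Sum>i\<in>I. t x (f i))"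
  by (induction I rule: infinite_finite_induct) (auto simp: hilbert_tensor_zero_right hilbert_tensor_add_right)

lemma hilbert_tensor_flip:
  assumes "hilbert_tensor t"
  shows "hilbert_tensor (\<lambda>y x. t x y)"
proof -
  have "range (\<lambda>(y, x). t x y) = range (\<lambda>(x, y). t x y)"
    by (auto simp: image_iff)
  then show ?thesis
    using assms unfolding hilbert_tensor_def by (auto simp: mult.commute)
qed

lemma hilbert_tensor_eqI:
  assumes t: "hilbert_tensor t" and "bounded_linear f" "bounded_linear g"
    and eq: "\<And>x y. f (t x y) = g (t x y)"
  shows "f z = (g z :: 'a::real_normed_vector)"
proof -
  interpret f: bounded_linear f by fact
  interpret g: bounded_linear g by fact
  have "span (range (\<lambda>(x, y). t x y)) \<subseteq> {z. f z = g z}"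
  proof (rule span_minimal)
    show "subspace {z. f z = g z}"
      by (auto simp: subspace_def f.add g.add f.scaleR g.scaleR f.zero g.zero)
  qed (auto simp: eq)
  moreover have "closed {z. f z = g z}"
    by (intro closed_Collect_eq linear_continuous_on assms)
  ultimately have "closure (span (range (\<lambda>(x, y). t x y))) \<subseteq> {z. f z = g z}"
    by (rule closure_minimal)
  then show ?thesis
    using hilbert_tensor_dense[OF t] by auto
qed

lemma hilbert_tensor_op_eqI:
  assumes "hilbert_tensor t" "\<And>x y. blinfun_apply Z (t x y) = blinfun_apply Z' (t x y)"
  shows "Z = Z'"
  by (rule blinfun_eqI, rule hilbert_tensor_eqI[OF assms(1)]) (auto intro: blinfun.bounded_linear_right assms)

text \<open>Density of elementary tensors is applied to one argument at a time.\<close>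

lemma hilbert_tensor_hermiteanI:
  assumes t: "hilbert_tensor t" and Z: "Z \<in> bounded_ops"
    and eq: "\<And>x y x' y'. cinner (Z (t x y)) (t x' y') = cinner (t x y) (Z (t x' y'))"
  shows "hermitean Z"
proof (rule hermiteanI[OF Z])
  note bl = bounded_bilinear.bounded_linear_left[OF bounded_bilinear_rinner]
    bounded_bilinear.bounded_linear_right[OF bounded_bilinear_rinner]
  have 1: "rinner (Z u) (t x' y') = rinner u (Z (t x' y'))" for u x' y'
    by (rule hilbert_tensor_eqI[OF t bounded_linear_compose[OF bl(1) blinfun.bounded_linear_right] bl(1)])
      (simp add: eq)
  show "rinner (Z u) v = rinner u (Z v)" for u v
    by (rule hilbert_tensor_eqI[OF t bl(2) bounded_linear_compose[OF bl(2) blinfun.bounded_linear_right]])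
      (simp add: 1)
qed

lemma subspace_closure:
  fixes S :: "'a::real_normed_vector set"
  assumes "subspace S"
  shows "subspace (closure S)"
  unfolding subspace_def
proof (intro conjI ballI allI)
  show "0 \<in> closure S"
    using subspace_0[OF assms] closure_subset by blast
  fix x assume "x \<in> closure S"
  then obtain u where u: "\<And>n. u n \<in> S" "u \<longlonglongrightarrow> x"
    unfolding closure_sequential by blast
  show "x + y \<in> closure S" if "y \<in> closure S" for y
  proof -
    from that obtain v where v: "\<And>n. v n \<in> S" "v \<longlonglongrightarrow> y"
      unfolding closure_sequential by blast
    show ?thesis
      unfolding closure_sequential
      by (intro exI[of _ "\<lambda>n. u n + v n"] conjI allI subspace_add assms u v tendsto_add)
  qed
  show "c *\<^sub>R x \<in> closure S" for c
    unfolding closure_sequential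
    by (intro exI[of _ "\<lambda>n. c *\<^sub>R u n"] conjI allI subspace_scale assms u tendsto_scaleR tendsto_const)
qed

text \<open>Extension by continuity for a relation not known to be single valued: the bound passes
  to the closure of the graph and, at \<open>z = 0\<close>, forces uniqueness of the value;
  completeness makes the domain everything.\<close>

lemma bounded_linear_of_graph:
  fixes G :: "('a::real_normed_vector \<times> 'b::banach) set"
  assumes G: "subspace G" and bound: "\<And>z v. (z, v) \<in> G \<Longrightarrow> norm v \<le> norm z * K"
    and dense: "closure (fst ` G) = UNIV"
  obtains f where "bounded_linear f" "\<And>z v. (z, v) \<in> G \<Longrightarrow> f z = v" "\<And>z. norm (f z) \<le> norm z * K"
proof -
  define C where "C = closure G"
  have C: "subspace C"
    unfolding C_def by (rule subspace_closure[OF G])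
  have "G \<subseteq> {p. norm (snd p) \<le> norm (fst p) * K}"
    using bound by auto
  moreover have "closed {p :: 'a \<times> 'b. norm (snd p) \<le> norm (fst p) * K}"
    by (intro closed_Collect_le continuous_intros)
  ultimately have "C \<subseteq> {p. norm (snd p) \<le> norm (fst p) * K}"
    unfolding C_def by (rule closure_minimal)
  then have C_bound: "norm v \<le> norm z * K" if "(z, v) \<in> C" for z v
    using that by auto
  have unique: "v = v'" if "(z, v) \<in> C" "(z, v') \<in> C" for z v v'
    using subspace_diff[OF C that] C_bound[of 0 "v - v'"] by simp
  have "\<exists>v. (z, v) \<in> C" for z
  proof -
    have "z \<in> closure (fst ` G)"
      by (simp add: dense)
    then obtain u where u: "\<And>n. u n \<in> fst ` G" "u \<longlonglongrightarrow> z"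
      unfolding closure_sequential by blast
    then have "\<forall>n. \<exists>v. (u n, v) \<in> G"
      by (metis imageE prod.collapse)
    then obtain v where v: "\<And>n. (u n, v n) \<in> G"
      by metis
    \<comment> \<open>The sign of \<open>K\<close> is unknown, so a positive constant replaces it
      before dividing.\<close>
    have close: "norm (v m - v n) \<le> norm (u m - u n) * (\<bar>K\<bar> + 1)" for m n
    proof -
      have "(u m - u n, v m - v n) \<in> G"
        using subspace_diff[OF G v v] by simp
      from bound[OF this] show ?thesis
        by (rule order_trans) (intro mult_left_mono, auto)
    qed
    have "Cauchy v"
    proof (rule metric_CauchyI)
      fix e :: real assume "0 < e"
      then have "0 < e / (\<bar>K\<bar> + 1)"
        by (intro divide_pos_pos) auto
      then obtain M where M: "\<And>m n. m \<ge> M \<Longrightarrow> n \<ge> M \<Longrightarrow> norm (u m - u n) < e / (\<bar>K\<bar> + 1)"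
        using metric_CauchyD[OF LIMSEQ_imp_Cauchy[OF u(2)]] unfolding dist_norm by blast
      have "dist (v m) (v n) < e" if "m \<ge> M" "n \<ge> M" for m n
        using close[of m n] M[OF that] by (simp add: dist_norm pos_less_divide_eq)
      then show "\<exists>M. \<forall>m\<ge>M. \<forall>n\<ge>M. dist (v m) (v n) < e"
        by blast
    qed
    then obtain l where "v \<longlonglongrightarrow> l"
      by (auto simp: Cauchy_convergent_iff convergent_def)
    then have "(\<lambda>n. (u n, v n)) \<longlonglongrightarrow> (z, l)"
      by (intro tendsto_Pair u)
    then have "(z, l) \<in> C"
      unfolding C_def closure_sequential using v by (intro exI[of _ "\<lambda>n. (u n, v n)"]) auto
    then show ?thesis ..
  qed
  then obtain f where f: "\<And>z. (z, f z) \<in> C"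
    by metis
  show thesis
  proof (rule that)
    show "bounded_linear f"
    proof (rule bounded_linear_intro)
      show "f (x + y) = f x + f y" for x y
        using unique[OF f[of "x + y"]] subspace_add[OF C f[of x] f[of y]] by simp
      show "f (r *\<^sub>R x) = r *\<^sub>R f x" for r x
        using unique[OF f[of "r *\<^sub>R x"]] subspace_scale[OF C f[of x], of r] by simp
      show "norm (f x) \<le> norm x * K" for x
        by (rule C_bound[OF f])
    qed
    show "f z = v" if "(z, v) \<in> G" for z v
      using unique[OF f[of z], of v] that closure_subset[of G] by (auto simp: C_def)
    show "norm (f z) \<le> norm z * K" for z
      by (rule C_bound[OF f])
  qed
qed

lemma hilbert_tensor_orthogonal_norm:
  assumes t: "hilbert_tensor t" and B: "finite B"
    "\<And>e e'. e \<in> B \<Longrightarrow> e' \<in> B \<Longrightarrow> cinner e e' = (if e = e' then 1 else 0)"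
  shows "(norm (\<Sum>e\<in>B. t (u e) e))\<^sup>2 = (\<Sum>e\<in>B. (norm (u e))\<^sup>2)"
proof -
  have "cinner (\<Sum>e\<in>B. t (u e) e) (\<Sum>e\<in>B. t (u e) e) = (\<Sum>e\<in>B. \<Sum>e'\<in>B. cinner (u e) (u e') * cinner e e')"
    by (simp add: cinner_sum_left cinner_sum_right hilbert_tensor_cinner[OF t]) (rule sum.swap)
  also have "\<dots> = (\<Sum>e\<in>B. \<Sum>e'\<in>B. if e' = e then cinner (u e) (u e) else 0)"
    by (intro sum.cong refl) (auto simp: B)
  also have "\<dots> = (\<Sum>e\<in>B. cinner (u e) (u e))"
    by (simp add: B)
  finally show ?thesis
    by (simp add: rinner_same[symmetric])
qed

text \<open>Expanding the second factors in a finite orthonormal system makes the summands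
  orthogonal, and \<open>X\<close> then acts on each coefficient vector separately.\<close>

lemma ampliation_norm_le:
  assumes t: "hilbert_tensor t" and X: "X \<in> bounded_ops"
  shows "norm (\<Sum>i<n::nat. t (X (x i)) (y i)) \<le> norm (\<Sum>i<n. t (x i) (y i)) * norm X"
proof -
  obtain B where B: "finite B" "\<And>e e'. e \<in> B \<Longrightarrow> e' \<in> B \<Longrightarrow> cinner e e' = (if e = e' then 1 else 0)"
    and yB: "\<And>i. i < n \<Longrightarrow> (\<Sum>e\<in>B. cinner e (y i) *\<^sub>C e) = y i"
  proof (rule orthonormal_expansion[of "y ` {..<n}"])
    fix B assume "finite B" "\<And>e e'. e \<in> B \<Longrightarrow> e' \<in> B \<Longrightarrow> cinner e e' = (if e = e' then 1 else 0)"
      "\<And>u. u \<in> y ` {..<n} \<Longrightarrow> (\<Sum>e\<in>B. cinner e u *\<^sub>C e) = u"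
    then show thesis
      by (intro that[of B]) blast+
  qed simp
  define u where "u e = (\<Sum>i<n. cinner e (y i) *\<^sub>C x i)" for e
  have re: "(\<Sum>i<n. t (x' i) (y i)) = (\<Sum>e\<in>B. t (\<Sum>i<n. cinner e (y i) *\<^sub>C x' i) e)" for x'
  proof -
    have "(\<Sum>i<n. t (x' i) (y i)) = (\<Sum>i<n. t (x' i) (\<Sum>e\<in>B. cinner e (y i) *\<^sub>C e))"
      by (intro sum.cong) (auto simp: yB)
    also have "\<dots> = (\<Sum>i<n. \<Sum>e\<in>B. cinner e (y i) *\<^sub>C t (x' i) e)"
      by (simp add: hilbert_tensor_sum_right[OF t] hilbert_tensor_scaleC_right[OF t])
    also have "\<dots> = (\<Sum>e\<in>B. \<Sum>i<n. cinner e (y i) *\<^sub>C t (x' i) e)"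
      by (rule sum.swap)
    finally show ?thesis
      by (simp add: hilbert_tensor_sum_left[OF t] hilbert_tensor_scaleC_left[OF t])
  qed
  have Xu: "(\<Sum>i<n. cinner e (y i) *\<^sub>C X (x i)) = X (u e)" for e
    by (simp add: u_def blinfun.sum_right bounded_ops_scaleC[OF X])
  have nrm: "(norm (\<Sum>e\<in>B. t (v e) e))\<^sup>2 = (\<Sum>e\<in>B. (norm (v e))\<^sup>2)" for v
    by (rule hilbert_tensor_orthogonal_norm[OF t B(1)]) (rule B(2))
  have "(\<Sum>i<n. t (X (x i)) (y i)) = (\<Sum>e\<in>B. t (X (u e)) e)"
    unfolding Xu[symmetric] by (rule re)
  then have "(norm (\<Sum>i<n. t (X (x i)) (y i)))\<^sup>2 = (\<Sum>e\<in>B. (norm (X (u e)))\<^sup>2)"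
    using nrm by simp
  also have "\<dots> \<le> (\<Sum>e\<in>B. (norm X)\<^sup>2 * (norm (u e))\<^sup>2)"
    by (intro sum_mono) (simp only: power_mult_distrib[symmetric], intro power_mono norm_blinfun norm_ge_zero)
  also have "\<dots> = (norm X)\<^sup>2 * (norm (\<Sum>i<n. t (x i) (y i)))\<^sup>2"
    using re[of x] nrm[of u] by (simp add: u_def sum_distrib_left)
  finally have "(norm (\<Sum>i<n. t (X (x i)) (y i)))\<^sup>2 \<le> (norm (\<Sum>i<n. t (x i) (y i)) * norm X)\<^sup>2"
    by (simp only: power_mult_distrib mult.commute[of "(norm X)\<^sup>2"])
  then show ?thesis
    by (rule power2_le_imp_le) (intro mult_nonneg_nonneg norm_ge_zero)
qed

text \<open>A vector has many expressions as a sum of elementary tensors, so the map is first given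
  as a graph; the norm estimate for finite sums supplies both well-definedness and
  continuity.\<close>

lemma ampliation_exists:
  fixes t :: "'h::complex_hilbert_space \<Rightarrow> 'k::complex_hilbert_space \<Rightarrow> 'm::complex_hilbert_space"
  assumes t: "hilbert_tensor t" and X: "X \<in> bounded_ops"
  obtains Z where "Z \<in> bounded_ops" "\<And>x y. blinfun_apply Z (t x y) = t (X x) y" "norm Z \<le> norm X"
proof -
  define G where "G = span (range (\<lambda>(x, y). (t x y, t (X x) y)))"
  have rep: "\<exists>n x y. p = (\<Sum>i<n::nat. (t (x i) (y i), t (X (x i)) (y i)))" if "p \<in> G" for p
    using that unfolding G_def
  proof (induction p rule: span_induct_alt)
    case base
    show ?case
      by (intro exI[of _ 0]) simp
  next
    case (step c a p)
    then obtain n x y u v where *: "p = (\<Sum>i<n::nat. (t (x i) (y i), t (X (x i)) (y i)))"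
      "a = (t u v, t (X u) v)"
      by auto
    \<comment> \<open>The scalar is absorbed into the first factor, so spans reduce to plain sums of
      graph elements.\<close>
    define x' y' where "x' = x(n := c *\<^sub>R u)" and "y' = y(n := v)"
    have "(\<Sum>i<n. (t (x' i) (y' i), t (X (x' i)) (y' i))) = p"
      unfolding * by (rule sum.cong) (auto simp: x'_def y'_def)
    then have "c *\<^sub>R a + p = (\<Sum>i<Suc n. (t (x' i) (y' i), t (X (x' i)) (y' i)))"
      by (simp add: *(2) x'_def y'_def blinfun.scaleR_right hilbert_tensor_scaleR_left[OF t] add.commute)
    then show ?case
      by blast
  qed
  obtain f where f: "bounded_linear f" "\<And>z v. (z, v) \<in> G \<Longrightarrow> f z = v" "\<And>z. norm (f z) \<le> norm z * norm X"
  proof (rule bounded_linear_of_graph)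
    show "subspace G"
      by (simp add: G_def)
    show "norm v \<le> norm z * norm X" if zv: "(z, v) \<in> G" for z v
    proof -
      obtain n x y where "(z, v) = (\<Sum>i<n::nat. (t (x i) (y i), t (X (x i)) (y i)))"
        using rep[OF zv] by blast
      then have "z = (\<Sum>i<n. t (x i) (y i))" "v = (\<Sum>i<n. t (X (x i)) (y i))"
        by (auto simp: prod_eq_iff fst_sum snd_sum)
      then show ?thesis
        using ampliation_norm_le[OF t X] by simp
    qed
    have "span (range (\<lambda>(x, y). t x y)) \<subseteq> fst ` G"
    proof (rule span_minimal)
      show "subspace (fst ` G)"
        by (intro linear_subspace_image) (auto simp: G_def intro: linear_fst)
      show "range (\<lambda>(x, y). t x y) \<subseteq> fst ` G"
        unfolding G_def by (force intro: span_base rev_image_eqI)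
    qed
    then show "closure (fst ` G) = UNIV"
      using closure_mono hilbert_tensor_dense[OF t] by blast
  qed blast
  define Z where "Z = Blinfun f"
  have Zf: "blinfun_apply Z = f"
    unfolding Z_def by (rule bounded_linear_Blinfun_apply[OF f(1)])
  have Zt: "Z (t x y) = t (X x) y" for x y
    unfolding Zf G_def by (rule f(2)) (auto simp: G_def intro!: span_base)
  show thesis
  proof (rule that)
    show "Z \<in> bounded_ops"
    proof (rule bounded_opsI)
      fix c z
      \<comment> \<open>The extension is only real linear by construction; commutation with scalars
        is checked on elementary tensors.\<close>
      have "(Z o\<^sub>L scalar_op c) = (scalar_op c o\<^sub>L Z)"
        by (rule hilbert_tensor_op_eqI[OF t])
          (simp add: scalar_op_apply Zt bounded_ops_scaleC[OF X] flip: hilbert_tensor_scaleC_left[OF t])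
      from arg_cong[OF this, of "\<lambda>T. blinfun_apply T z"] show "Z (c *\<^sub>C z) = c *\<^sub>C Z z"
        by (simp add: scalar_op_apply)
    qed
    show "norm Z \<le> norm X"
      by (rule norm_blinfun_bound) (auto simp: Zf mult.commute intro: f(3))
  qed (rule Zt)
qed

section \<open>Tensor products of an operator with the identity\<close>

lemma tensor_op_eqI:
  assumes t: "hilbert_tensor t" and "Z \<in> bounded_ops" "\<And>x y. blinfun_apply Z (t x y) = t (blinfun_apply X x) (blinfun_apply Y y)"
  shows "tensor_op t X Y = Z"
  unfolding tensor_op_def
proof (rule the_equality)
  fix W assume "W \<in> bounded_ops \<and> (\<forall>x y. blinfun_apply W (t x y) = t (X x) (Y y))"
  then show "W = Z"
    using assms by (intro hilbert_tensor_op_eqI[OF t]) auto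
qed (simp add: assms(2,3))

lemma tensor_op_left:
  assumes t: "hilbert_tensor t" and X: "X \<in> bounded_ops"
  shows "tensor_op t X id_blinfun \<in> bounded_ops"
    and "blinfun_apply (tensor_op t X id_blinfun) (t x y) = t (blinfun_apply X x) y"
    and "norm (tensor_op t X id_blinfun) \<le> norm X"
proof -
  obtain Z where Z: "Z \<in> bounded_ops" "\<And>x y. blinfun_apply Z (t x y) = t (X x) y" "norm Z \<le> norm X"
    by (rule ampliation_exists[OF t X]) (rule that)
  have "tensor_op t X id_blinfun = Z"
    by (rule tensor_op_eqI[OF t]) (auto simp: Z)
  then show "tensor_op t X id_blinfun \<in> bounded_ops" "blinfun_apply (tensor_op t X id_blinfun) (t x y) = t (blinfun_apply X x) y"
    "norm (tensor_op t X id_blinfun) \<le> norm X"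
    using Z by auto
qed

lemma tensor_op_right:
  assumes t: "hilbert_tensor t" and Y: "Y \<in> bounded_ops"
  shows "tensor_op t id_blinfun Y \<in> bounded_ops"
    and "blinfun_apply (tensor_op t id_blinfun Y) (t x y) = t x (blinfun_apply Y y)"
    and "norm (tensor_op t id_blinfun Y) \<le> norm Y"
proof -
  obtain Z where Z: "Z \<in> bounded_ops" "\<And>x y. blinfun_apply Z (t x y) = t x (Y y)" "norm Z \<le> norm Y"
    by (rule ampliation_exists[OF hilbert_tensor_flip[OF t] Y]) (rule that)
  have "tensor_op t id_blinfun Y = Z"
    by (rule tensor_op_eqI[OF t]) (auto simp: Z)
  then show "tensor_op t id_blinfun Y \<in> bounded_ops" "blinfun_apply (tensor_op t id_blinfun Y) (t x y) = t x (blinfun_apply Y y)"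
    "norm (tensor_op t id_blinfun Y) \<le> norm Y"
    using Z by auto
qed

lemma tensor_op_left_hermitean:
  assumes t: "hilbert_tensor t" and X: "hermitean X"
  shows "hermitean (tensor_op t X id_blinfun)"
  by (rule hilbert_tensor_hermiteanI[OF t])
    (simp_all add: tensor_op_left[OF t] hermitean_bounded_ops[OF X] hilbert_tensor_cinner[OF t] hermitean_cinner[OF X])

lemma tensor_op_right_hermitean:
  assumes t: "hilbert_tensor t" and Y: "hermitean Y"
  shows "hermitean (tensor_op t id_blinfun Y)"
  by (rule hilbert_tensor_hermiteanI[OF t])
    (simp_all add: tensor_op_right[OF t] hermitean_bounded_ops[OF Y] hilbert_tensor_cinner[OF t] hermitean_cinner[OF Y])

section \<open>The uncertainty relation\<close>

lemma commutant_apply: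
  assumes "X \<in> commutant N" "Z \<in> N"
  shows "Z (X x) = X (blinfun_apply Z x)"
proof -
  have "Z o\<^sub>L X = X o\<^sub>L Z"
    using assms by (simp add: commutant_def)
  from arg_cong[OF this, of "\<lambda>T. blinfun_apply T x"] show ?thesis
    by simp
qed

lemma commutantI:
  assumes "X \<in> bounded_ops" "\<And>Z x. Z \<in> N \<Longrightarrow> blinfun_apply Z (X x) = X (Z x)"
  shows "X \<in> commutant N"
  using assms by (auto simp: commutant_def intro!: blinfun_eqI)

lemma commutant_id: "id_blinfun \<in> commutant N"
  by (rule commutantI) (auto simp: bounded_ops_id)

lemma commutant_in_bounded_ops: "X \<in> commutant N \<Longrightarrow> X \<in> bounded_ops"
  by (simp add: commutant_def)

lemma commutant_compose: "X \<in> commutant N \<Longrightarrow> Y \<in> commutant N \<Longrightarrow> X o\<^sub>L Y \<in> commutant N"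
  by (rule commutantI, auto simp: bounded_ops_compose commutant_in_bounded_ops) (metis commutant_apply)

lemma commutant_add: "X \<in> commutant N \<Longrightarrow> Y \<in> commutant N \<Longrightarrow> X + Y \<in> commutant N"
  by (rule commutantI, auto simp: bounded_ops_add commutant_in_bounded_ops blinfun.add_left blinfun.add_right)
    (metis commutant_apply)

lemma commutant_diff: "X \<in> commutant N \<Longrightarrow> Y \<in> commutant N \<Longrightarrow> X - Y \<in> commutant N"
  by (rule commutantI, auto simp: bounded_ops_diff commutant_in_bounded_ops blinfun.diff_left blinfun.diff_right)
    (metis commutant_apply)

lemma bicommutant_superset: "N \<subseteq> bounded_ops \<Longrightarrow> N \<subseteq> commutant (commutant N)"
  by (auto intro!: commutantI) (metis commutant_apply)

lemma cp_map_bounded_ops: "cp_map N bounded_ops T \<Longrightarrow> X \<in> N \<Longrightarrow> T X \<in> bounded_ops"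
  and cp_map_add: "cp_map N M T \<Longrightarrow> X \<in> N \<Longrightarrow> Y \<in> N \<Longrightarrow> T (X + Y) = T X + T Y"
  and cp_map_id: "cp_map N M T \<Longrightarrow> T id_blinfun = id_blinfun"
  unfolding cp_map_def by blast+

lemma cp_map_positive:
  assumes T: "cp_map N bounded_ops T" and X: "X \<in> N" "positive_op X"
  shows "positive_op (T X)"
proof -
  have "positive_op_matrix 1 (\<lambda>i j. X)"
    using X(2) by (simp add: positive_op_matrix_def positive_op_def)
  then have "positive_op_matrix 1 (\<lambda>i j. T X)"
    using T X(1) unfolding cp_map_def completely_positive_def by fastforce
  then have "cinner x (T X x) \<in> \<real>\<^sub>\<ge>\<^sub>0" for x
    unfolding positive_op_matrix_def by (auto dest: spec[of _ "\<lambda>_. x"])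
  then show ?thesis
    using cp_map_bounded_ops[OF T X(1)] by (simp add: positive_op_def)
qed

lemma cp_map_diff:
  assumes T: "cp_map (commutant N) M T" and X: "X \<in> commutant N" "Y \<in> commutant N"
  shows "T (X - Y) = T X - T Y"
  using cp_map_add[OF T commutant_diff[OF X] X(2)] by simp

text \<open>Positivity of \<open>1 + Z\<close> and \<open>1 - Z\<close> is preserved by the unital
  map \<open>T\<close>, so half of \<open>1 + T Z\<close> lies between 0 and 1 and
  \<open>1 + T Z\<close> has norm at most 2. The crude bound makes the suprema finite.\<close>

lemma cp_map_contraction_bound:
  assumes T: "cp_map (commutant N) bounded_ops T"
    and Z: "Z \<in> commutant N" "hermitean Z" "norm Z \<le> 1"
  shows "norm (T Z) \<le> 3"
proof -
  have bound: "\<bar>rinner x (Z x)\<bar> \<le> (norm x)\<^sup>2" for x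
  proof -
    have "\<bar>rinner x (Z x)\<bar> \<le> norm x * (norm Z * norm x)"
      by (rule order_trans[OF rinner_cauchy_schwarz mult_left_mono[OF norm_blinfun]]) simp
    also have "\<dots> \<le> norm x * (1 * norm x)"
      by (intro mult_left_mono mult_right_mono Z) auto
    finally show ?thesis
      by (simp add: power2_eq_square)
  qed
  have "positive_op (id_blinfun + Z)"
  proof (rule positive_opI)
    show "0 \<le> rinner x ((id_blinfun + Z) x)" for x
      using bound[of x] by (simp add: blinfun.add_left cinner_add_right rinner_same abs_le_iff)
  qed (intro hermitean_add hermitean_id Z)
  moreover have "positive_op (id_blinfun - Z)"
  proof (rule positive_opI)
    show "0 \<le> rinner x ((id_blinfun - Z) x)" for x
      using bound[of x] by (simp add: blinfun.diff_left cinner_diff_right rinner_same abs_le_iff)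
  qed (intro hermitean_diff hermitean_id Z)
  ultimately have "positive_op (T (id_blinfun + Z))" "positive_op (T (id_blinfun - Z))"
    by (auto intro!: cp_map_positive[OF T] commutant_add commutant_diff commutant_id Z)
  moreover have "T (id_blinfun + Z) = id_blinfun + T Z" "T (id_blinfun - Z) = id_blinfun - T Z"
    by (simp_all add: cp_map_add[OF T] cp_map_diff[OF T] commutant_id Z cp_map_id[OF T])
  ultimately have pos: "positive_op (id_blinfun + T Z)" "positive_op (id_blinfun - T Z)"
    by simp_all
  have "norm ((1/2) *\<^sub>R (id_blinfun + T Z)) \<le> 1"
  proof (rule positive_op_norm_le_one)
    show "positive_op ((1/2) *\<^sub>R (id_blinfun + T Z))"
      using positive_opD[OF pos(1)]
      by (intro positive_opI hermitean_scaleR positive_op_hermitean[OF pos(1)])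
        (simp add: blinfun.scaleR_left cinner_scaleR_right)
    show "rinner x (((1/2) *\<^sub>R (id_blinfun + T Z)) x) \<le> (norm x)\<^sup>2" for x
      using positive_opD[OF pos(2), of x]
      by (simp add: blinfun.scaleR_left blinfun.add_left blinfun.diff_left cinner_linear rinner_same)
  qed
  then have "norm (id_blinfun + T Z) \<le> 2"
    by simp
  moreover have "norm (T Z) \<le> norm (id_blinfun + T Z) + norm (id_blinfun :: 'b \<Rightarrow>\<^sub>L 'b)"
    using norm_triangle_ineq4[of "id_blinfun + T Z" id_blinfun] by simp
  moreover have "norm (id_blinfun :: 'b \<Rightarrow>\<^sub>L 'b) \<le> 1"
    by (rule norm_blinfun_bound) auto
  ultimately show ?thesis
    by linarith
qed

section \<open>Fidelity estimates\<close>

text \<open>Two-term Cauchy-Schwarz; read for outcome distributions, merging two outcomes does not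
  decrease the fidelity.\<close>

lemma sqrt_mult_add_le:
  assumes "0 \<le> a" "0 \<le> b" "0 \<le> c" "0 \<le> (d::real)"
  shows "sqrt (a * b) + sqrt (c * d) \<le> sqrt ((a + c) * (b + d))"
proof (rule real_le_rsqrt)
  have "0 \<le> (sqrt (a * d) - sqrt (c * b))\<^sup>2"
    by simp
  also have "\<dots> = a * d + c * b - 2 * (sqrt (a * d) * sqrt (c * b))"
    using assms by (simp add: power2_diff)
  also have "sqrt (a * d) * sqrt (c * b) = sqrt (a * b) * sqrt (c * d)"
    by (simp add: real_sqrt_mult mult.commute mult.left_commute)
  finally show "(sqrt (a * b) + sqrt (c * d))\<^sup>2 \<le> (a + c) * (b + d)"
    using assms by (simp add: power2_sum algebra_simps)
qed

text \<open>With a = cos^2 \<alpha> and b = cos^2 \<beta> the left side is cos^2 (\<alpha> -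
  \<beta>). Its complement to 1 is the square of
  \<open>sqrt (a * (1 - b)) - sqrt (b * (1 - a))\<close>, a sine, whose two terms are at least
  \<open>1 - \<delta>\<close> and at most \<open>\<delta>\<close>.\<close>

lemma fidelity_bound:
  fixes a b \<delta> :: real
  assumes "a \<le> 1" "0 \<le> b" "1 - \<delta> \<le> a" "b \<le> \<delta>" "0 \<le> \<delta>" "\<delta> \<le> 1/2"
  shows "(sqrt (a * b) + sqrt ((1 - a) * (1 - b)))\<^sup>2 \<le> 1 - (1 - 2 * \<delta>)\<^sup>2"
proof -
  have nn: "0 \<le> a" "0 \<le> 1 - a" "0 \<le> 1 - b"
    using assms by auto
  have "(1 - \<delta>) * (1 - \<delta>) \<le> a * (1 - b)" "b * (1 - a) \<le> \<delta> * \<delta>"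
    using assms nn by (auto intro!: mult_mono)
  then have "sqrt ((1 - \<delta>) * (1 - \<delta>)) \<le> sqrt (a * (1 - b))" "sqrt (b * (1 - a)) \<le> sqrt (\<delta> * \<delta>)"
    by (simp_all only: real_sqrt_le_mono)
  then have "1 - 2 * \<delta> \<le> sqrt (a * (1 - b)) - sqrt (b * (1 - a))"
    using assms by simp
  then have "(1 - 2 * \<delta>)\<^sup>2 \<le> (sqrt (a * (1 - b)) - sqrt (b * (1 - a)))\<^sup>2"
    using assms by (intro power_mono) auto
  moreover have "(sqrt (a * b) + sqrt ((1 - a) * (1 - b)))\<^sup>2 + (sqrt (a * (1 - b)) - sqrt (b * (1 - a)))\<^sup>2 = 1"
  proof -
    have "sqrt (a * b) * sqrt ((1 - a) * (1 - b)) = sqrt (a * (1 - b)) * sqrt (b * (1 - a))"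
      by (simp add: real_sqrt_mult)
    then show ?thesis
      using assms nn by (simp add: power2_sum power2_diff mult.assoc) (simp add: algebra_simps)
  qed
  ultimately show ?thesis
    by linarith
qed

lemma rank_one_projection:
  fixes \<psi> :: "'h::complex_hilbert_space"
  assumes "norm \<psi> = 1"
  obtains P where "projection_op P" "\<And>x. blinfun_apply P x = cinner \<psi> x *\<^sub>C \<psi>"
proof -
  have "bounded_linear (\<lambda>x. cinner \<psi> x *\<^sub>C \<psi>)"
  proof (rule bounded_linear_intro[where K=1])
    show "norm (cinner \<psi> x *\<^sub>C \<psi>) \<le> norm x * 1" for x
      using cinner_cauchy_schwarz[of \<psi> x] by (simp add: norm_scaleC assms)
  qed (simp_all add: cinner_linear scaleC_add_left scaleR_scaleC scaleC_scaleC)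
  then have P: "blinfun_apply (Blinfun (\<lambda>x. cinner \<psi> x *\<^sub>C \<psi>)) x = cinner \<psi> x *\<^sub>C \<psi>" for x
    by (simp add: bounded_linear_Blinfun_apply)
  have "projection_op (Blinfun (\<lambda>x. cinner \<psi> x *\<^sub>C \<psi>))"
    unfolding projection_op_def
  proof
    show "hermitean (Blinfun (\<lambda>x. cinner \<psi> x *\<^sub>C \<psi>))"
      by (auto simp: hermitean_def adjoint_ops_def P cinner_linear scaleC_scaleC mult.commute
          cinner_commute[symmetric] intro!: bounded_opsI)
    show "Blinfun (\<lambda>x. cinner \<psi> x *\<^sub>C \<psi>) o\<^sub>L Blinfun (\<lambda>x. cinner \<psi> x *\<^sub>C \<psi>) = Blinfun (\<lambda>x. cinner \<psi> x *\<^sub>C \<psi>)"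
      by (rule blinfun_eqI) (simp add: P cinner_linear cinner_same assms)
  qed
  then show thesis
    using that P by blast
qed

section \<open>Projections in the tensor algebra and bounds for the two suprema\<close>

lemma projection_op_compose:
  assumes P: "projection_op P" and Q: "projection_op Q" and PQ: "P o\<^sub>L Q = Q o\<^sub>L P"
  shows "projection_op (P o\<^sub>L Q)"
  unfolding projection_op_def
proof
  have c: "P (Q x) = Q (P x)" for x
    using arg_cong[OF PQ, of "\<lambda>T. blinfun_apply T x"] by simp
  note h = projection_op_hermitean[OF P] projection_op_hermitean[OF Q]
  show "hermitean (P o\<^sub>L Q)"
    by (rule hermiteanI)
      (simp_all add: bounded_ops_compose hermitean_bounded_ops h hermitean_cinner[OF h(1)] hermitean_cinner[OF h(2)] c)
  show "(P o\<^sub>L Q) o\<^sub>L (P o\<^sub>L Q) = P o\<^sub>L Q"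
    by (rule blinfun_eqI) (simp add: c[symmetric] projection_op_idem[OF P] projection_op_idem[OF Q])
qed

lemma projection_op_norm_le_one: "projection_op P \<Longrightarrow> norm P \<le> 1"
proof (rule positive_op_norm_le_one)
  assume P: "projection_op P"
  show "positive_op P"
    by (rule projection_op_positive[OF P])
  show "rinner x (P x) \<le> (norm x)\<^sup>2" for x
    using positive_opD[OF projection_op_positive[OF projection_op_complement[OF P]], of x]
    by (simp add: blinfun.diff_left cinner_linear rinner_same)
qed

lemma tensor_op_left_projection:
  assumes t: "hilbert_tensor t" and P: "projection_op P"
  shows "projection_op (tensor_op t P id_blinfun)"
  unfolding projection_op_def
proof
  note h = projection_op_hermitean[OF P]
  show "hermitean (tensor_op t P id_blinfun)"
    by (rule tensor_op_left_hermitean[OF t h])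
  show "tensor_op t P id_blinfun o\<^sub>L tensor_op t P id_blinfun = tensor_op t P id_blinfun"
    by (rule hilbert_tensor_op_eqI[OF t])
      (simp add: tensor_op_left[OF t hermitean_bounded_ops[OF h]] projection_op_idem[OF P])
qed

lemma tensor_op_right_projection:
  assumes t: "hilbert_tensor t" and P: "projection_op P"
  shows "projection_op (tensor_op t id_blinfun P)"
  unfolding projection_op_def
proof
  note h = projection_op_hermitean[OF P]
  show "hermitean (tensor_op t id_blinfun P)"
    by (rule tensor_op_right_hermitean[OF t h])
  show "tensor_op t id_blinfun P o\<^sub>L tensor_op t id_blinfun P = tensor_op t id_blinfun P"
    by (rule hilbert_tensor_op_eqI[OF t])
      (simp add: tensor_op_right[OF t hermitean_bounded_ops[OF h]] projection_op_idem[OF P])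
qed

lemma tensor_algebra_memI:
  assumes "tensor_op t X Y \<in> bounded_ops" "X \<in> M" "Y \<in> N"
  shows "tensor_op t X Y \<in> tensor_algebra t M N"
  unfolding tensor_algebra_def
proof (rule commutantI)
  show "Z (tensor_op t X Y x) = tensor_op t X Y (Z x)"
    if "Z \<in> commutant {tensor_op t X Y |X Y. X \<in> M \<and> Y \<in> N}" for Z x
    using commutant_apply[OF that, of "tensor_op t X Y" x] assms(2,3) by force
qed (rule assms)

lemma effect_norm_le_one:
  assumes "op_le 0 P" "op_le P id_blinfun"
  shows "norm P \<le> 1"
proof (rule positive_op_norm_le_one)
  show "positive_op P"
    using assms(1) by (simp add: op_le_def)
  show "rinner x (P x) \<le> (norm x)\<^sup>2" for x
    using positive_opD[of "id_blinfun - P" x] assms(2)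
    by (simp add: op_le_def blinfun.diff_left cinner_linear rinner_same)
qed

lemma projection_op_effect: "projection_op P \<Longrightarrow> op_le 0 P \<and> op_le P id_blinfun"
  by (simp add: op_le_def projection_op_positive projection_op_complement)

lemma disturbance_upper:
  assumes t: "hilbert_tensor t" and N: "id_blinfun \<in> N"
    and T: "cp_map (tensor_algebra t bounded_ops N) bounded_ops T"
    and P: "P \<in> bounded_ops" "op_le 0 P" "op_le P id_blinfun"
  shows "norm (T (tensor_op t P id_blinfun) - P) \<le> disturbance t T"
  unfolding disturbance_def
proof (rule cSUP_upper)
  show "bdd_above ((\<lambda>P. norm (T (tensor_op t P id_blinfun) - P)) ` {P \<in> bounded_ops. op_le 0 P \<and> op_le P id_blinfun})"
  \<comment> \<open>The image under \<open>T\<close> contributes at most 3 and the effect at most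
    1.\<close>
  proof (rule bdd_aboveI2[where M=4])
    fix Q :: "'a \<Rightarrow>\<^sub>L 'a" assume "Q \<in> {P \<in> bounded_ops. op_le 0 P \<and> op_le P id_blinfun}"
    then have Q: "Q \<in> bounded_ops" "op_le 0 Q" "op_le Q id_blinfun"
      by auto
    have nQ: "norm Q \<le> 1"
      by (rule effect_norm_le_one[OF Q(2,3)])
    have hQ: "hermitean Q"
      using Q(2) by (intro positive_op_hermitean) (simp add: op_le_def)
    have "norm (T (tensor_op t Q id_blinfun)) \<le> 3"
      using T unfolding tensor_algebra_def
      by (rule cp_map_contraction_bound)
        (use tensor_op_left[OF t Q(1)] nQ tensor_op_left_hermitean[OF t hQ]
          tensor_algebra_memI[of t Q id_blinfun bounded_ops N] Q(1) N in \<open>auto simp: tensor_algebra_def\<close>)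
    then show "norm (T (tensor_op t Q id_blinfun) - Q) \<le> 4"
      using nQ norm_triangle_ineq4[of "T (tensor_op t Q id_blinfun)" Q] by linarith
  qed
qed (use P in auto)

lemma transfer_error_upper:
  assumes t: "hilbert_tensor t" and N: "von_neumann_algebra N"
    and T: "cp_map (tensor_algebra t bounded_ops N) bounded_ops T"
    and A: "hermitean A" and B: "hermitean B" "B \<in> N" and S: "S \<in> sets borel"
  shows "norm (T (tensor_op t id_blinfun (spectral_projection B S)) - spectral_projection A S) \<le> transfer_error t T A B"
  unfolding transfer_error_def
proof (rule cSUP_upper[OF S])
  show "bdd_above ((\<lambda>S. norm (T (tensor_op t id_blinfun (spectral_projection B S)) - spectral_projection A S)) ` sets borel)"
  \<comment> \<open>Again 3 for the image under \<open>T\<close> and 1 for the projection;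
    membership of the spectral projection in \<open>N\<close> is what puts its ampliation into the
    domain of \<open>T\<close>.\<close>
  proof (rule bdd_aboveI2[where M=4])
    fix R :: "real set" assume R: "R \<in> sets borel"
    define Q where "Q = spectral_projection B R"
    have Q: "projection_op Q" "Q \<in> N"
      unfolding Q_def by (rule spectral_projection_properties[OF B(1) R]
          spectral_projection_in_von_neumann_algebra[OF N B(2,1) R])+
    note hQ = projection_op_hermitean[OF Q(1)]
    have "norm (T (tensor_op t id_blinfun Q)) \<le> 3"
      using T unfolding tensor_algebra_def
      by (rule cp_map_contraction_bound)
        (use tensor_op_right[OF t hermitean_bounded_ops[OF hQ]] projection_op_norm_le_one[OF Q(1)]
          tensor_op_right_hermitean[OF t hQ]
          tensor_algebra_memI[of t id_blinfun Q bounded_ops N] bounded_ops_id Q(2) in \<open>auto simp: tensor_algebra_def\<close>)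
    moreover have "norm (spectral_projection A R) \<le> 1"
      by (rule projection_op_norm_le_one[OF spectral_projection_properties(1)[OF A R]])
    ultimately show "norm (T (tensor_op t id_blinfun (spectral_projection B R)) - spectral_projection A R) \<le> 4"
      using norm_triangle_ineq4[of "T (tensor_op t id_blinfun Q)" "spectral_projection A R"]
      unfolding Q_def by linarith
  qed
qed

lemma cinner_op_bound:
  assumes "norm X \<le> r" "norm x = 1" "norm y = 1"
  shows "cmod (cinner x (blinfun_apply X y)) \<le> r"
proof -
  have "cmod (cinner x (X y)) \<le> norm x * (norm X * norm y)"
    by (rule order_trans[OF cinner_cauchy_schwarz mult_left_mono[OF norm_blinfun]]) simp
  then show ?thesis
    using assms by simp
qed

section \<open>The four-outcome argument\<close>

lemma uncertainty_relation:
  fixes t :: "'h::complex_hilbert_space \<Rightarrow> 'k::complex_hilbert_space \<Rightarrow> 'm::complex_hilbert_space"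
  assumes t: "hilbert_tensor t" and \<B>: "von_neumann_algebra \<B>"
    and T: "cp_map (tensor_algebra t bounded_ops \<B>) bounded_ops T"
    and A: "hermitean A" "A \<notin> range scalar_op" and B: "B \<in> \<B>" "hermitean B"
    and \<Delta>: "\<Delta> = disturbance t T" "\<Delta> \<le> 1/2" and \<delta>: "\<delta> = transfer_error t T A B" "0 \<le> \<delta>" "\<delta> \<le> 1/2"
  shows "(1/2 - \<delta>)\<^sup>2 + (1/2 - \<Delta>)\<^sup>2 \<le> 1/4"
proof -
  define N where "N = tensor_algebra t bounded_ops \<B>"
  define N' where "N' = commutant {tensor_op t X Y | X Y. X \<in> bounded_ops \<and> Y \<in> \<B>}"
  have N: "N = commutant N'"
    by (simp add: N_def N'_def tensor_algebra_def)
  have T': "cp_map (commutant N') bounded_ops T"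
    using T by (simp add: N_def[symmetric] N)
  have id\<B>: "id_blinfun \<in> \<B>"
    using \<B> commutant_id unfolding von_neumann_algebra_def by metis
  obtain S where S: "S \<in> sets borel" and p01: "spectral_projection A S \<noteq> 0" "spectral_projection A S \<noteq> id_blinfun"
    using nonscalar_spectral_projection[OF A] by blast
  define p where "p = spectral_projection A S"
  define Q where "Q = spectral_projection B S"
  have p: "projection_op p"
    unfolding p_def by (rule spectral_projection_properties[OF A(1) S])
  have Q: "projection_op Q" "Q \<in> \<B>"
    unfolding Q_def by (rule spectral_projection_properties[OF B(2) S]
        spectral_projection_in_von_neumann_algebra[OF \<B> B S])+
  obtain x1 where x1: "p x1 \<noteq> 0"
    using p01 by (metis blinfun.zero_left blinfun_eqI p_def)
  obtain x0 where x0: "x0 - p x0 \<noteq> 0"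
    using p01 by (metis blinfun_apply_id_blinfun blinfun_eqI eq_iff_diff_eq_0 id_apply p_def)
  define \<psi>1 where "\<psi>1 = inverse (norm (p x1)) *\<^sub>R p x1"
  define \<psi>0 where "\<psi>0 = inverse (norm (x0 - p x0)) *\<^sub>R (x0 - p x0)"
  have \<psi>1: "norm \<psi>1 = 1" "p \<psi>1 = \<psi>1"
    using x1 by (auto simp: \<psi>1_def blinfun.scaleR_right projection_op_idem[OF p])
  have \<psi>0: "norm \<psi>0 = 1" "p \<psi>0 = 0"
    using x0 by (auto simp: \<psi>0_def blinfun.scaleR_right blinfun.diff_right projection_op_idem[OF p])
  have orth: "cinner \<psi>1 \<psi>0 = 0" "cinner \<psi>0 \<psi>1 = 0"
    using hermitean_cinner[OF projection_op_hermitean[OF p], of \<psi>1 \<psi>0]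
      hermitean_cinner[OF projection_op_hermitean[OF p], of \<psi>0 \<psi>1]
    by (simp_all add: \<psi>1 \<psi>0 cinner_linear)
  \<comment> \<open>The equal superposition gives its projection the off-diagonal entry 1/2, the
    largest modulus an effect can have between orthogonal unit vectors.\<close>
  define \<psi> where "\<psi> = (1 / sqrt 2) *\<^sub>R (\<psi>1 + \<psi>0)"
  have "(norm \<psi>)\<^sup>2 = 1"
    by (simp add: \<psi>_def power_divide norm_add_sq orth \<psi>1 \<psi>0)
  then have "norm \<psi> = 1"
    using power2_eq_imp_eq[of "norm \<psi>" 1] by simp
  then obtain P where P: "projection_op P" and P_apply: "\<And>x. blinfun_apply P x = cinner \<psi> x *\<^sub>C \<psi>"
    using rank_one_projection by blast
  have P10: "cinner \<psi>1 (P \<psi>0) = 1/2"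
    by (simp add: P_apply \<psi>_def cinner_linear orth cinner_same \<psi>1 \<psi>0 flip: of_real_mult)
  note Pb = hermitean_bounded_ops[OF projection_op_hermitean[OF P]]
    and Qb = hermitean_bounded_ops[OF projection_op_hermitean[OF Q(1)]]
  define e where "e = tensor_op t P id_blinfun"
  define q where "q = tensor_op t id_blinfun Q"
  have e: "projection_op e" "e \<in> N"
    unfolding e_def N_def
    by (auto intro!: tensor_op_left_projection[OF t P] tensor_algebra_memI tensor_op_left(1)[OF t Pb] Pb id\<B>)
  have q: "projection_op q" "q \<in> N"
    unfolding q_def N_def
    by (auto intro!: tensor_op_right_projection[OF t Q(1)] tensor_algebra_memI tensor_op_right(1)[OF t Qb] bounded_ops_id Q)
  have eq: "e o\<^sub>L q = q o\<^sub>L e"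
    by (rule hilbert_tensor_op_eqI[OF t]) (simp add: e_def q_def tensor_op_left[OF t Pb] tensor_op_right[OF t Qb])
  note N_closed = commutant_compose[of _ N', folded N] commutant_diff[of _ N', folded N]
    commutant_add[of _ N', folded N] commutant_id[of N', folded N]
  note T_diff = cp_map_diff[OF T', folded N]
  note T_pos = cp_map_positive[OF T'[folded N]]
  \<comment> \<open>These are the images of \<open>e q\<close>, \<open>(1 - e) q\<close>,
    \<open>e (1 - q)\<close> and \<open>(1 - e) (1 - q)\<close>, written through \<open>T e\<close>,
    \<open>T q\<close> and \<open>Z1\<close> so that the marginal sums cancel algebraically.\<close>
  define Z1 where "Z1 = T (e o\<^sub>L q)"
  define Z2 where "Z2 = T q - Z1"
  define Z3 where "Z3 = T e - Z1"
  define Z4 where "Z4 = id_blinfun - T e - (T q - Z1)"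
  have eqN: "e o\<^sub>L q \<in> N"
    by (intro N_closed e q)
  have pos: "positive_op Z1" "positive_op Z2" "positive_op Z3" "positive_op Z4"
  proof -
    let ?e' = "id_blinfun - e" and ?q' = "id_blinfun - q"
    have c: "e o\<^sub>L ?q' = ?q' o\<^sub>L e" "?e' o\<^sub>L q = q o\<^sub>L ?e'" "?e' o\<^sub>L ?q' = ?q' o\<^sub>L ?e'"
      using arg_cong[OF eq, of "\<lambda>T. blinfun_apply T _"]
      by (auto intro!: blinfun_eqI simp: blinfun.diff_left blinfun.diff_right)
    have split: "?e' o\<^sub>L q = q - (e o\<^sub>L q)" "e o\<^sub>L ?q' = e - (e o\<^sub>L q)"
      "?e' o\<^sub>L ?q' = (id_blinfun - e) - (q - (e o\<^sub>L q))"
      by (auto intro!: blinfun_eqI simp: blinfun.diff_left blinfun.diff_right)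
    note e' = projection_op_complement[OF e(1)] and q' = projection_op_complement[OF q(1)]
    show "positive_op Z1"
      unfolding Z1_def by (intro T_pos eqN projection_op_positive projection_op_compose e q eq)
    have "positive_op (T (?e' o\<^sub>L q))"
      by (intro T_pos N_closed e q projection_op_positive projection_op_compose e' c)
    then show "positive_op Z2"
      unfolding split by (simp add: Z2_def Z1_def T_diff q eqN)
    have "positive_op (T (e o\<^sub>L ?q'))"
      by (intro T_pos N_closed e q projection_op_positive projection_op_compose q' c)
    then show "positive_op Z3"
      unfolding split by (simp add: Z3_def Z1_def T_diff e eqN)
    have "positive_op (T (?e' o\<^sub>L ?q'))"
      by (intro T_pos N_closed e q projection_op_positive projection_op_compose e' q' c)
    then show "positive_op Z4"
      unfolding split
      by (simp add: Z4_def Z1_def T_diff e q eqN N_closed cp_map_id[OF T'])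
  qed
  define a where "a Z = rinner \<psi>1 (blinfun_apply Z \<psi>1)" for Z
  define b where "b Z = rinner \<psi>0 (blinfun_apply Z \<psi>0)" for Z
  define c where "c Z = cinner \<psi>1 (blinfun_apply Z \<psi>0)" for Z
  have ab: "0 \<le> a Z" "0 \<le> b Z" "cmod (c Z) \<le> sqrt (a Z * b Z)" if "positive_op Z" for Z
    using that positive_op_cauchy_schwarz[OF that, of \<psi>1 \<psi>0]
    by (auto simp: a_def b_def c_def positive_opD intro: real_le_rsqrt)
  \<comment> \<open>The four operators add up to 1, and the entry of 1 between
    \<open>\<psi>1\<close> and \<open>\<psi>0\<close> is 0; this yields the minus sign in the third
    identity.\<close>
  have sums: "a Z1 + a Z2 + (a Z3 + a Z4) = 1" "b Z1 + b Z2 + (b Z3 + b Z4) = 1" "c Z1 + c Z3 = - (c Z2 + c Z4)"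
    "c Z1 + c Z3 = c (T e)" "a Z1 + a Z2 = a (T q)" "b Z1 + b Z2 = b (T q)"
    by (simp_all add: a_def b_def c_def Z2_def Z3_def Z4_def blinfun.add_left blinfun.diff_left cinner_linear
        cinner_same \<psi>1 \<psi>0 orth)
  have \<Delta>_bound: "1/2 - \<Delta> \<le> cmod (c Z1 + c Z3)"
  proof -
    have "norm (T e - P) \<le> \<Delta>"
      unfolding e_def \<Delta>(1) using projection_op_effect[OF P] by (intro disturbance_upper[OF t id\<B> T Pb]) auto
    from cinner_op_bound[OF this \<psi>1(1) \<psi>0(1)] have "cmod (c (T e) - 1/2) \<le> \<Delta>"
      by (simp add: c_def blinfun.diff_left cinner_diff_right P10)
    then show ?thesis
      using norm_triangle_ineq2[of "1/2" "c (T e)"] unfolding sums(4) by (simp add: norm_minus_commute)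
  qed
  have Tq: "norm (T q - p) \<le> \<delta>"
    unfolding q_def Q_def p_def \<delta>(1) by (rule transfer_error_upper[OF t \<B> T A(1) B(2,1) S])
  have "\<bar>a (T q) - 1\<bar> \<le> \<delta>" "\<bar>b (T q)\<bar> \<le> \<delta>"
    using order_trans[OF abs_Re_le_cmod cinner_op_bound[OF Tq \<psi>1(1) \<psi>1(1)]]
      order_trans[OF abs_Re_le_cmod cinner_op_bound[OF Tq \<psi>0(1) \<psi>0(1)]]
    by (simp_all add: a_def b_def blinfun.diff_left cinner_diff_right \<psi>1 \<psi>0 cinner_same cinner_zero_right)
  then have fid: "(sqrt (a (T q) * b (T q)) + sqrt ((1 - a (T q)) * (1 - b (T q))))\<^sup>2 \<le> 1 - (1 - 2 * \<delta>)\<^sup>2"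
    using sums(1,2,5,6) ab(1,2)[OF pos(1)] ab(1,2)[OF pos(2)] ab(1,2)[OF pos(3)] ab(1,2)[OF pos(4)] \<delta>(2,3)
    by (intro fidelity_bound; linarith)
  have "cmod (c Z1 + c Z3) = cmod (c Z2 + c Z4)"
    by (simp only: sums(3) norm_minus_cancel)
  \<comment> \<open>Each half of the off-diagonal sum is counted once, so all four terms enter the
    estimate.\<close>
  then have "2 * cmod (c Z1 + c Z3) = cmod (c Z1 + c Z3) + cmod (c Z2 + c Z4)"
    by simp
  also have "\<dots> \<le> (cmod (c Z1) + cmod (c Z3)) + (cmod (c Z2) + cmod (c Z4))"
    by (intro add_mono norm_triangle_ineq)
  also have "\<dots> \<le> (sqrt (a Z1 * b Z1) + sqrt (a Z2 * b Z2)) + (sqrt (a Z3 * b Z3) + sqrt (a Z4 * b Z4))"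
    using ab(3)[OF pos(1)] ab(3)[OF pos(2)] ab(3)[OF pos(3)] ab(3)[OF pos(4)] by linarith
  \<comment> \<open>Regrouped by the outcome of \<open>q\<close> rather than \<open>e\<close>:
    merging the outcomes of \<open>e\<close> leaves the distribution of \<open>q\<close> alone,
    which \<open>\<delta>\<close> controls.\<close>
  also have "\<dots> \<le> sqrt ((a Z1 + a Z2) * (b Z1 + b Z2)) + sqrt ((a Z3 + a Z4) * (b Z3 + b Z4))"
    by (intro add_mono sqrt_mult_add_le ab pos)
  also have "a Z3 + a Z4 = 1 - a (T q)"
    using sums(1,5) by linarith
  also have "b Z3 + b Z4 = 1 - b (T q)"
    using sums(2,6) by linarith
  finally have "1 - 2 * \<Delta> \<le> sqrt (a (T q) * b (T q)) + sqrt ((1 - a (T q)) * (1 - b (T q)))"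
    using \<Delta>_bound unfolding sums(5,6) by linarith
  then have "(1 - 2 * \<Delta>)\<^sup>2 \<le> (sqrt (a (T q) * b (T q)) + sqrt ((1 - a (T q)) * (1 - b (T q))))\<^sup>2"
    using \<Delta>(2) by (intro power_mono) auto
  \<comment> \<open>Four times the claim.\<close>
  then have "(1 - 2 * \<Delta>)\<^sup>2 + (1 - 2 * \<delta>)\<^sup>2 \<le> 1"
    using fid by linarith
  then show ?thesis
    by (simp add: power2_eq_square algebra_simps)
qed

section \<open>Compressions and normality\<close>

lemma op_le_rinner: "op_le X Y \<Longrightarrow> rinner x (X x) \<le> rinner x (blinfun_apply Y x)"
  using positive_opD[of "Y - X" x] by (simp add: op_le_def blinfun.diff_left cinner_linear)

lemma op_leI:
  assumes "hermitean X" "hermitean Y" "\<And>x. rinner x (X x) \<le> rinner x (blinfun_apply Y x)"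
  shows "op_le X Y"
  unfolding op_le_def
  by (rule positive_opI) (use assms in \<open>auto intro: hermitean_diff simp: blinfun.diff_left cinner_linear\<close>)

lemma op_le_refl: "hermitean X \<Longrightarrow> op_le X X"
  by (rule op_leI) auto

lemma op_le_trans: "op_le X Y \<Longrightarrow> op_le Y Z \<Longrightarrow> hermitean X \<Longrightarrow> hermitean Z \<Longrightarrow> op_le X Z"
  by (rule op_leI) (auto intro: order_trans op_le_rinner)

lemma positive_op_norm_le:
  assumes X: "positive_op X" and c: "0 < c" and le: "\<And>x. rinner x (X x) \<le> c * (norm x)\<^sup>2"
  shows "norm X \<le> c"
proof -
  have "norm ((1 / c) *\<^sub>R X) \<le> 1"
  proof (rule positive_op_norm_le_one)
    show "positive_op ((1 / c) *\<^sub>R X)"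
      by (rule positive_opI[OF hermitean_scaleR[OF positive_op_hermitean[OF X]]])
        (use positive_opD[OF X] c in \<open>simp add: blinfun.scaleR_left cinner_scaleR_right\<close>)
    show "rinner x (((1 / c) *\<^sub>R X) x) \<le> (norm x)\<^sup>2" for x
      using le[of x] c by (simp add: blinfun.scaleR_left cinner_scaleR_right field_simps)
  qed
  then show ?thesis
    using c by (simp add: field_simps)
qed

lemma blinfun_apply_tendsto: "F \<longlonglongrightarrow> L \<Longrightarrow> (\<lambda>n. blinfun_apply (F n) x) \<longlonglongrightarrow> blinfun_apply L x"
  by (rule bounded_bilinear.tendsto[OF bounded_bilinear_blinfun_apply _ tendsto_const])

lemma bounded_linear_scaleC: "bounded_linear (\<lambda>x. c *\<^sub>C x :: 'h::complex_hilbert_space)"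
  using blinfun.bounded_linear_right[of "scalar_op c"] by (simp add: scalar_op_apply[abs_def])

lemma closed_bounded_ops: "closed bounded_ops"
  unfolding closed_sequential_limits
proof (intro allI impI, elim conjE)
  fix F :: "nat \<Rightarrow> 'a \<Rightarrow>\<^sub>L 'a" and L assume F: "\<forall>n. F n \<in> bounded_ops" "F \<longlonglongrightarrow> L"
  show "L \<in> bounded_ops"
  proof (rule bounded_opsI)
    fix c x
    have "(\<lambda>n. F n (c *\<^sub>C x)) \<longlonglongrightarrow> L (c *\<^sub>C x)"
      by (rule blinfun_apply_tendsto[OF F(2)])
    moreover have "(\<lambda>n. c *\<^sub>C F n x) \<longlonglongrightarrow> c *\<^sub>C L x"
      by (rule bounded_linear.tendsto[OF bounded_linear_scaleC blinfun_apply_tendsto[OF F(2)]])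
    ultimately show "L (c *\<^sub>C x) = c *\<^sub>C L x"
      using F(1) by (simp add: bounded_ops_scaleC) (metis LIMSEQ_unique)
  qed
qed

text \<open>Cluster points are taken in norm below, so norm closedness keeps them inside the
  algebra.\<close>

lemma closed_commutant: "closed (commutant N)"
proof -
  have "closed {Y. Z o\<^sub>L Y = Y o\<^sub>L Z}" for Z :: "'a \<Rightarrow>\<^sub>L 'a"
    by (intro closed_Collect_eq continuous_intros)
  then have "closed (bounded_ops \<inter> (\<Inter>Z\<in>N. {Y. Z o\<^sub>L Y = Y o\<^sub>L Z}))"
    by (intro closed_Int closed_INT closed_bounded_ops) auto
  also have "bounded_ops \<inter> (\<Inter>Z\<in>N. {Y. Z o\<^sub>L Y = Y o\<^sub>L Z}) = commutant N"
    by (auto simp: commutant_def)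
  finally show ?thesis .
qed

lemma rinner_tendsto: "F \<longlonglongrightarrow> L \<Longrightarrow> (\<lambda>n. rinner x (blinfun_apply (F n) y)) \<longlonglongrightarrow> rinner x (blinfun_apply L y)"
  by (rule bounded_bilinear.tendsto[OF bounded_bilinear_rinner tendsto_const blinfun_apply_tendsto])

lemma closed_hermitean: "closed {X. hermitean X}"
  unfolding closed_sequential_limits
proof (intro allI impI, elim conjE)
  fix F :: "nat \<Rightarrow> 'a \<Rightarrow>\<^sub>L 'a" and L assume F: "\<forall>n. F n \<in> {X. hermitean X}" "F \<longlonglongrightarrow> L"
  have h: "hermitean (F n)" for n
    using F(1) by simp
  have "L \<in> bounded_ops"
    using closed_bounded_ops F(2) hermitean_bounded_ops[OF h] unfolding closed_sequential_limits by blast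
  moreover have "rinner (L x) y = rinner x (L y)" for x y
  proof -
    have "rinner y (F n x) = rinner x (F n y)" for n
      using hermitean_cinner[OF h[of n], of x y] rinner_commute[of y "F n x"] by simp
    then have "(\<lambda>n. rinner x (F n y)) \<longlonglongrightarrow> rinner y (L x)"
      using rinner_tendsto[OF F(2), of y x] by simp
    from LIMSEQ_unique[OF this rinner_tendsto[OF F(2)]] show ?thesis
      using rinner_commute[of y "L x"] by simp
  qed
  ultimately show "L \<in> {X. hermitean X}"
    by (auto intro: hermiteanI)
qed

lemma closed_rinner_le: "closed {X. rinner x (blinfun_apply X x) \<le> r}"
  and closed_rinner_ge: "closed {X. r \<le> rinner x (blinfun_apply X x)}"
  unfolding closed_sequential_limits
  by (auto intro: LIMSEQ_le_const2[OF rinner_tendsto] LIMSEQ_le_const[OF rinner_tendsto])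

text \<open>In finite dimension the tails of an order bounded directed set are relatively compact. A common
  cluster point of all tails is an upper bound, hence lies above \<open>S\<close>, and inherits \<open>r\<close> as a bound.\<close>

lemma op_lub_form_le:
  fixes S :: "'m::{complex_hilbert_space, euclidean_space} \<Rightarrow>\<^sub>L 'm"
  assumes N: "closed N" and D: "D \<noteq> {}" "D \<subseteq> N" "\<And>X. X \<in> D \<Longrightarrow> hermitean X"
    and dir: "\<And>X Y. X \<in> D \<Longrightarrow> Y \<in> D \<Longrightarrow> \<exists>Z\<in>D. op_le X Z \<and> op_le Y Z"
    and lub: "is_op_lub N D S" and r: "\<And>X. X \<in> D \<Longrightarrow> rinner y (X y) \<le> r"
  shows "rinner y (S y) \<le> r"
proof -
  obtain X0 where X0: "X0 \<in> D"
    using D by blast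
  have S: "hermitean S" "\<And>X. X \<in> D \<Longrightarrow> op_le X S"
    using lub by (auto simp: is_op_lub_def)
  define K where "K X = closure {Z \<in> D. op_le X Z}" for X
  have "bounded {Z \<in> D. op_le X0 Z}"
  proof (rule boundedI)
    fix Z assume "Z \<in> {Z \<in> D. op_le X0 Z}"
    then have Z: "Z \<in> D" "op_le X0 Z"
      by auto
    \<comment> \<open>Beyond \<open>X0\<close> the directed set lies between \<open>X0\<close> and
      \<open>S\<close>. The summand 1 keeps the constant positive when
      \<open>S = X0\<close>.\<close>
    have "norm (Z - X0) \<le> norm (S - X0) + 1"
    proof (rule positive_op_norm_le)
      show "positive_op (Z - X0)"
        using Z(2) by (simp add: op_le_def)
      fix x
      have "rinner x ((Z - X0) x) \<le> rinner x ((S - X0) x)"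
        using op_le_rinner[OF S(2)[OF Z(1)], of x] by (simp add: blinfun.diff_left cinner_linear)
      also have "\<dots> \<le> norm x * (norm (S - X0) * norm x)"
        by (rule order_trans[OF abs_ge_self order_trans[OF rinner_cauchy_schwarz mult_left_mono[OF norm_blinfun]]]) simp
      also have "\<dots> \<le> (norm (S - X0) + 1) * (norm x)\<^sup>2"
        by (simp add: power2_eq_square algebra_simps)
      finally show "rinner x ((Z - X0) x) \<le> (norm (S - X0) + 1) * (norm x)\<^sup>2" .
    qed (simp add: add_nonneg_pos)
    then show "norm Z \<le> norm (S - X0) + 1 + norm X0"
      using norm_triangle_ineq[of "Z - X0" X0] by simp
  qed
  then have "compact (K X0)"
    unfolding K_def by (simp add: compact_closure)
  \<comment> \<open>Directedness supplies a common member of finitely many tails.\<close>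
  then have "K X0 \<inter> \<Inter>(K ` D) \<noteq> {}"
  proof (rule compact_imp_fip)
    show "closed T" if "T \<in> K ` D" for T
      using that by (auto simp: K_def)
    fix \<F> assume "finite \<F>" "\<F> \<subseteq> K ` D"
    then obtain E where E: "E \<subseteq> D" "finite E" "\<F> = K ` E"
      by (meson finite_subset_image)
    have "\<exists>Z\<in>D. \<forall>X\<in>insert X0 E. op_le X Z"
      using E(2,1)
    proof (induction E rule: finite_induct)
      case empty
      then show ?case
        using X0 op_le_refl[OF D(3)] by auto
    next
      case (insert X E)
      then obtain Z where Z: "Z \<in> D" "\<And>Y. Y \<in> insert X0 E \<Longrightarrow> op_le Y Z"
        by auto
      obtain W where W: "W \<in> D" "op_le Z W" "op_le X W"
        using dir[of Z X] Z insert.prems by auto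
      have "op_le Y W" if "Y \<in> insert X0 E" for Y
        using op_le_trans[OF Z(2)[OF that] W(2) D(3) D(3)] that X0 insert.prems W by auto
      then show ?case
        using W by blast
    qed
    then obtain Z where "Z \<in> D" "\<forall>X\<in>insert X0 E. op_le X Z"
      by blast
    then have "Z \<in> K X" if "X \<in> insert X0 E" for X
      using that closure_subset[of "{Z \<in> D. op_le X Z}"] by (auto simp: K_def)
    then show "K X0 \<inter> \<Inter>\<F> \<noteq> {}"
      unfolding E by blast
  qed
  then obtain L where L: "\<And>X. X \<in> D \<Longrightarrow> L \<in> K X"
    by blast
  have in_closed: "L \<in> C" if "closed C" "{Z \<in> D. op_le X Z} \<subseteq> C" "X \<in> D" for C X
    using L[OF that(3)] closure_minimal[OF that(2,1)] by (auto simp: K_def)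
  have "L \<in> N"
    by (rule in_closed[OF N _ X0]) (use D in auto)
  have hL: "hermitean L"
    using in_closed[OF closed_hermitean _ X0] D(3) by auto
  have "op_le X L" if X: "X \<in> D" for X
  proof (rule op_leI[OF D(3)[OF X] hL])
    show "rinner x (X x) \<le> rinner x (L x)" for x
      by (rule in_closed[OF closed_rinner_ge _ X, THEN CollectD]) (auto intro: op_le_rinner)
  qed
  then have "op_le S L"
    using lub \<open>L \<in> N\<close> hL by (auto simp: is_op_lub_def)
  then have "rinner y (S y) \<le> rinner y (L y)"
    by (rule op_le_rinner)
  also have "\<dots> \<le> r"
    using in_closed[OF closed_rinner_le _ X0] r by auto
  finally show ?thesis .
qed

text \<open>Here \<open>W\<close> is the adjoint of the isometry \<open>V\<close>. For normality the
  compression must carry a least upper bound in the commutant to one among all bounded operators;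
  normality of \<open>\<omega>\<close> then applies to the compressed set.\<close>

lemma compression_cp_map:
  fixes V :: "'h::complex_hilbert_space \<Rightarrow>\<^sub>L 'm::{complex_hilbert_space, euclidean_space}" and W :: "'m \<Rightarrow>\<^sub>L 'h"
  assumes V: "\<And>c x. V (c *\<^sub>C x) = c *\<^sub>C V x" and W: "\<And>c z. W (c *\<^sub>C z) = c *\<^sub>C W z"
    and adj: "\<And>x z. cinner (V x) z = cinner x (W z)" and iso: "\<And>x. W (V x) = x"
  shows "cp_map (commutant N) bounded_ops (\<lambda>X. W o\<^sub>L X o\<^sub>L V)"
proof -
  define T where "T X = W o\<^sub>L X o\<^sub>L V" for X
  have T_apply: "T X x = W (X (V x))" for X x
    by (simp add: T_def)
  have T_cinner: "cinner x (T X y) = cinner (V x) (X (V y))" for X x y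
    by (simp add: T_apply adj)
  have Tb: "T X \<in> bounded_ops" if "X \<in> bounded_ops" for X
    by (rule bounded_opsI) (simp add: T_apply V W bounded_ops_scaleC[OF that])
  have T_add: "T (X + Y) = T X + T Y" for X Y
    by (rule blinfun_eqI) (simp add: T_apply blinfun.add_left blinfun.add_right)
  have T_diff: "T (X - Y) = T X - T Y" for X Y
    by (rule blinfun_eqI) (simp add: T_apply blinfun.diff_left blinfun.diff_right)
  have T_scale: "T (op_scaleC c X) = op_scaleC c (T X)" for c X
    by (rule blinfun_eqI) (simp add: T_apply op_scaleC_apply W)
  have T_id: "T id_blinfun = id_blinfun"
    by (rule blinfun_eqI) (simp add: T_apply iso)
  have T_pos: "positive_op (T X)" if "positive_op X" for X
    using that Tb by (auto simp: positive_op_def T_cinner)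
  have T_herm: "hermitean (T X)" if "hermitean X" for X
  proof (rule hermiteanI[OF Tb[OF hermitean_bounded_ops[OF that]]])
    fix x y
    show "rinner (T X x) y = rinner x (T X y)"
      using hermitean_cinner[OF that, of "V x" "V y"] rinner_commute[of "T X x" y]
        rinner_commute[of "V y" "X (V x)"] by (simp add: T_cinner)
  qed
  have T_le: "op_le (T X) (T Y)" if "op_le X Y" for X Y
    using T_pos that by (simp add: op_le_def T_diff[symmetric])
  have "cp_map (commutant N) bounded_ops T"
    unfolding cp_map_def
  proof (intro conjI ballI allI impI)
    show "T ` commutant N \<subseteq> bounded_ops"
      using Tb commutant_in_bounded_ops by blast
    show "completely_positive (commutant N) T"
      unfolding completely_positive_def positive_op_matrix_def T_cinner
    proof (intro allI impI, elim conjE)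
      fix n :: nat and X :: "nat \<Rightarrow> nat \<Rightarrow> 'm \<Rightarrow>\<^sub>L 'm" and x :: "nat \<Rightarrow> 'h"
      assume "\<forall>z. (\<Sum>i<n. \<Sum>j<n. cinner (z i) (X i j (z j))) \<in> \<real>\<^sub>\<ge>\<^sub>0"
      \<comment> \<open>Positivity of the matrix is tested on the vectors \<open>V (x i)\<close>, so
        complete positivity needs no inequality of its own.\<close>
      from spec[OF this, of "\<lambda>i. V (x i)"]
      show "(\<Sum>i<n. \<Sum>j<n. cinner (V (x i)) (X i j (V (x j)))) \<in> \<real>\<^sub>\<ge>\<^sub>0" .
    qed
    fix \<omega> :: "('h \<Rightarrow>\<^sub>L 'h) \<Rightarrow> complex"
    assume \<omega>: "normal_state_on bounded_ops \<omega>"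
    then have state: "state_on bounded_ops \<omega>"
      by (simp add: normal_state_on_def)
    have "state_on (commutant N) (\<lambda>X. \<omega> (T X))"
      using state unfolding state_on_def
      by (auto simp: T_add T_scale T_id T_pos Tb commutant_in_bounded_ops)
    moreover have "\<omega> (T S) = complex_of_real (SUP X\<in>D. Re (\<omega> (T X)))"
      if D: "D \<noteq> {}" "D \<subseteq> commutant N" "\<forall>X\<in>D. hermitean X"
        "\<forall>X\<in>D. \<forall>Y\<in>D. \<exists>Z\<in>D. op_le X Z \<and> op_le Y Z" and S: "is_op_lub (commutant N) D S" for D S
    proof -
      have S': "S \<in> commutant N" "hermitean S" "\<And>X. X \<in> D \<Longrightarrow> op_le X S"
        using S by (auto simp: is_op_lub_def)
      have "is_op_lub bounded_ops (T ` D) (T S)"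
        unfolding is_op_lub_def
      proof (intro conjI ballI impI)
        show "T S \<in> bounded_ops" "hermitean (T S)"
          using Tb[OF commutant_in_bounded_ops[OF S'(1)]] T_herm[OF S'(2)] by simp_all
        show "op_le X (T S)" if "X \<in> T ` D" for X
          using that S'(3) T_le by auto
        fix Y assume "hermitean Y \<and> (\<forall>X\<in>T ` D. op_le X Y)"
        then have Y: "hermitean Y" "\<forall>X\<in>T ` D. op_le X Y"
          by blast+
        show "op_le (T S) Y"
        proof (rule op_leI[OF T_herm[OF S'(2)] Y(1)])
          fix x
          \<comment> \<open>The bound \<open>Y\<close> lives on the smaller space and cannot be
            compared with \<open>S\<close> as an operator; it bounds the form of \<open>S\<close>
            one vector \<open>V x\<close> at a time.\<close>
          have "rinner (V x) (S (V x)) \<le> rinner x (Y x)"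
          proof (rule op_lub_form_le[OF closed_commutant D(1,2) _ _ S])
            show "rinner (V x) (X (V x)) \<le> rinner x (Y x)" if "X \<in> D" for X
              using op_le_rinner[of "T X" Y x] Y(2) that by (simp add: T_cinner)
          qed (use D in auto)
          then show "rinner x (T S x) \<le> rinner x (Y x)"
            by (simp add: T_cinner)
        qed
      qed
      moreover have "T ` D \<noteq> {}" "T ` D \<subseteq> bounded_ops" "\<forall>X\<in>T ` D. hermitean X"
        using D Tb[OF hermitean_bounded_ops] T_herm by auto
      moreover have "\<forall>X\<in>T ` D. \<forall>Y\<in>T ` D. \<exists>Z\<in>T ` D. op_le X Z \<and> op_le Y Z"
      proof (intro ballI)
        fix X' Y' assume "X' \<in> T ` D" "Y' \<in> T ` D"
        then obtain X Y where XY: "X \<in> D" "Y \<in> D" "X' = T X" "Y' = T Y"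
          by blast
        then obtain Z where "Z \<in> D" "op_le X Z" "op_le Y Z"
          using D(4) by blast
        then show "\<exists>Z\<in>T ` D. op_le X' Z \<and> op_le Y' Z"
          unfolding XY by (intro bexI[of _ "T Z"]) (auto intro: T_le)
      qed
      ultimately have "\<omega> (T S) = complex_of_real (SUP X\<in>T ` D. Re (\<omega> X))"
        using \<omega> unfolding normal_state_on_def by (elim conjE) (erule allE[of _ "T ` D"], erule allE[of _ "T S"], simp)
      then show ?thesis
        by (simp add: image_image)
    qed
    ultimately show "normal_state_on (commutant N) (\<lambda>X. \<omega> (T X))"
      unfolding normal_state_on_def by simp
  qed (auto simp: T_add T_scale T_id)
  then show ?thesis
    by (simp add: T_def[abs_def])
qed

section \<open>The full operator algebra and the spectrum of a projection\<close>

lemma von_neumann_algebra_bounded_ops: "von_neumann_algebra bounded_ops"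
  unfolding von_neumann_algebra_def
proof (intro conjI ballI)
  fix X :: "'a \<Rightarrow>\<^sub>L 'a" assume X: "X \<in> bounded_ops"
  obtain Z where Z: "Z \<in> bounded_ops" "\<And>x y. rinner (X x) y = rinner x (blinfun_apply Z y)"
    using adjoint_exists[OF X] by metis
  have "cinner (X x) y = cinner x (Z y)" for x y
  proof -
    have "rinner (X (\<i> *\<^sub>C x)) y = rinner (\<i> *\<^sub>C x) (Z y)"
      by (rule Z(2))
    then show ?thesis
      using Z(2)[of x y] by (simp add: bounded_ops_scaleC[OF X] cinner_scaleC_left complex_eq_iff)
  qed
  then show "\<exists>Y\<in>bounded_ops. adjoint_ops X Y"
    using Z(1) by (auto simp: adjoint_ops_def)
next
  show "commutant (commutant bounded_ops) = bounded_ops"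
    using bicommutant_superset[of bounded_ops] by (auto simp: commutant_in_bounded_ops)
qed simp

text \<open>The eigenvalues are 1 on the range and 0 on the kernel, so each Borel set is seen only
  through which of these two points it contains.\<close>

lemma projection_spectral_measure:
  assumes P: "projection_op P"
  shows "is_spectral_measure P (\<lambda>S. indicator S 1 *\<^sub>R P + indicator S 0 *\<^sub>R (id_blinfun - P))"
    (is "is_spectral_measure P ?E")
proof -
  have E_apply: "?E S x = indicator S 1 *\<^sub>R P x + indicator S 0 *\<^sub>R (x - P x)" for S x
    by (simp add: blinfun.add_left blinfun.scaleR_left blinfun.diff_left)
  have E_int: "?E (S \<inter> S') = ?E S o\<^sub>L ?E S'" for S S'
    by (rule blinfun_eqI) (auto simp: blinfun.add_left blinfun.scaleR_left blinfun.diff_left blinfun.add_right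
        blinfun.scaleR_right blinfun.diff_right projection_op_idem[OF P] indicator_def)
  have pvm: "projection_valued_measure ?E"
    unfolding projection_valued_measure_def
  proof (intro conjI ballI allI impI)
    show "projection_op (?E S)" for S
      unfolding projection_op_def
      by (intro conjI hermitean_add hermitean_scaleR hermitean_diff hermitean_id projection_op_hermitean[OF P])
        (simp only: E_int[symmetric] Int_absorb)
    fix F :: "nat \<Rightarrow> real set" and x assume F: "range F \<subseteq> sets borel \<and> disjoint_family F"
    have "(\<lambda>n. indicator (F n) t :: real) sums indicator (\<Union>n. F n) t" for t
      by (rule indicator_sums) (use F in \<open>auto simp: disjoint_family_on_def\<close>)
    then show "(\<lambda>n. ?E (F n) x) sums ?E (\<Union>n. F n) x"
      unfolding E_apply by (intro sums_add bounded_linear.sums[OF bounded_linear_scaleR_left])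
  qed (auto simp: E_int intro!: blinfun_eqI)
  show ?thesis
    unfolding is_spectral_measure_def
  proof (intro conjI allI pvm)
    fix x
    interpret finite_measure "pvm_measure ?E x"
      by (rule finite_measure_pvm_measure[OF pvm])
    \<comment> \<open>On the two eigenvalues the identity function is an indicator, which turns its
      integral into the mass of a point.\<close>
    have ae: "AE t in pvm_measure ?E x. t = indicator {1} t"
    proof (rule AE_I)
      show "{t \<in> space (pvm_measure ?E x). t \<noteq> indicator {1} t} \<subseteq> - {0, 1}"
        by (auto simp: indicator_def)
      show "- {0, 1} \<in> sets (pvm_measure ?E x)"
        by simp
      show "emeasure (pvm_measure ?E x) (- {0, 1}) = 0"
        by (simp add: emeasure_pvm_measure[OF pvm] blinfun.add_left cinner_linear)
    qed
    have "integrable (pvm_measure ?E x) (indicator {1} :: real \<Rightarrow> real)"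
      by (intro integrable_real_indicator) (auto simp: emeasure_pvm_measure[OF pvm])
    then show "integrable (pvm_measure ?E x) (\<lambda>t. t)"
      using ae by (subst integrable_cong_AE) auto
    have "(\<integral>t. t \<partial>pvm_measure ?E x) = (\<integral>t. indicator {1} t \<partial>pvm_measure ?E x)"
      using ae by (intro integral_cong_AE) auto
    also have "\<dots> = measure (pvm_measure ?E x) {1}"
      by simp
    also have "\<dots> = rinner x (P x)"
      by (subst measure_pvm_measure[OF pvm]) (simp_all add: blinfun.add_left)
    finally show "cinner x (P x) = complex_of_real (\<integral>t. t \<partial>pvm_measure ?E x)"
      using cinner_hermitean_real[OF projection_op_hermitean[OF P], of x] by (simp add: complex_eq_iff)
  qed
qed

lemma spectral_projection_of_projection:
  assumes "projection_op P" "S \<in> sets borel"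
  shows "spectral_projection P S = indicator S 1 *\<^sub>R P + indicator S 0 *\<^sub>R (id_blinfun - P)"
  by (rule spectral_projection_eq[OF projection_op_hermitean projection_spectral_measure]) (rule assms)+

text \<open>For orthogonal vectors \<open>P\<close> and \<open>1 - P\<close> have off-diagonal
  entries of equal modulus. Cauchy-Schwarz for both, added up, bounds twice that modulus by
  1.\<close>

lemma effect_off_diagonal_le_half:
  assumes P: "op_le 0 P" "op_le P id_blinfun" and xy: "norm x = 1" "norm y = 1" "cinner x y = 0"
  shows "cmod (cinner x (blinfun_apply P y)) \<le> 1/2"
proof -
  have pos: "positive_op P" "positive_op (id_blinfun - P)"
    using P by (simp_all add: op_le_def)
  have 1: "cmod (cinner x (P y)) \<le> sqrt (rinner x (P x) * rinner y (P y))"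
    by (rule real_le_rsqrt[OF positive_op_cauchy_schwarz[OF pos(1)]])
  have "cmod (cinner x ((id_blinfun - P) y)) \<le> sqrt (rinner x ((id_blinfun - P) x) * rinner y ((id_blinfun - P) y))"
    by (rule real_le_rsqrt[OF positive_op_cauchy_schwarz[OF pos(2)]])
  then have 2: "cmod (cinner x (P y)) \<le> sqrt ((1 - rinner x (P x)) * (1 - rinner y (P y)))"
    by (simp add: blinfun.diff_left cinner_diff_right xy cinner_same)
  have "sqrt (rinner x (P x) * rinner y (P y)) + sqrt ((1 - rinner x (P x)) * (1 - rinner y (P y)))
      \<le> sqrt ((rinner x (P x) + (1 - rinner x (P x))) * (rinner y (P y) + (1 - rinner y (P y))))"
    using positive_opD[OF pos(1)] positive_opD[OF pos(2), of x] positive_opD[OF pos(2), of y]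
    by (intro sqrt_mult_add_le) (simp_all add: blinfun.diff_left cinner_diff_right xy cinner_same)
  then show ?thesis
    using 1 2 by simp
qed

section \<open>Sharpness\<close>

lemma scaleC_vec_nth: "(c *\<^sub>C x) $ i = c *\<^sub>C (x $ i)"
  by (simp add: scaleC_vec_def)

lemma scaleR_scaleC_assoc: "(r *\<^sub>R a) *\<^sub>C x = r *\<^sub>R (a *\<^sub>C (x :: 'h::complex_hilbert_space))"
  unfolding scaleR_conv_of_real[of r a] by (simp add: scaleR_scaleC[of r] scaleC_scaleC)

text \<open>A tensor is stored as the column of its blocks, so every vector is a finite sum of
  elementary tensors along the coordinate axes.\<close>

lemma hilbert_tensor_vec: "hilbert_tensor (\<lambda>(x :: complex ^ 'n) (y :: 'k::complex_hilbert_space). (\<chi> i. (x $ i) *\<^sub>C y) :: 'k ^ 'n)"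
  (is "hilbert_tensor ?t")
  unfolding hilbert_tensor_def
proof (intro conjI allI)
  have "z \<in> span (range (\<lambda>(x, y). ?t x y))" for z :: "'k ^ 'n"
  proof -
    have "(axis i 1 $ j) *\<^sub>C z $ i = (if i = j then z $ i else 0)" for i j
      by (simp add: axis_def scaleC_one scaleC_zero)
    then have "z = (\<Sum>i\<in>UNIV. ?t (axis i 1) (z $ i))"
      by (simp add: vec_eq_iff)
    also have "\<dots> \<in> span (range (\<lambda>(x, y). ?t x y))"
      by (intro span_sum span_base) (auto simp: image_iff)
    finally show ?thesis .
  qed
  then show "closure (span (range (\<lambda>(x, y). ?t x y))) = UNIV"
    using closure_subset by blast
  fix x x' :: "complex ^ 'n" and y y' :: 'k
  have "cinner (?t x y) (?t x' y') = (\<Sum>i\<in>UNIV. cnj (x $ i) * x' $ i * cinner y y')"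
    by (simp add: cinner_vec_def cinner_scaleC_left cinner_scaleC_right mult_ac)
  then show "cinner (?t x y) (?t x' y') = cinner x x' * cinner y y'"
    by (simp add: cinner_vec_def cinner_complex_def sum_distrib_right)
qed (auto simp: vec_eq_iff scaleC_add_left scaleC_add_right scaleC_scaleC scaleC_vec_nth scaleC_complex_def mult.commute)

lemma norm_sq_complex_2: "(norm (x :: complex ^ 2))\<^sup>2 = (cmod (x $ 1))\<^sup>2 + (cmod (x $ 2))\<^sup>2"
  by (simp add: norm_vec_def L2_set_def sum_2)

lemma norm_axis_complex_2: "norm (axis j a :: complex ^ 2) = cmod a"
proof (rule power2_eq_imp_eq)
  show "(norm (axis j a :: complex ^ 2))\<^sup>2 = (cmod a)\<^sup>2"
    using exhaust_2[of j] by (auto simp: norm_sq_complex_2 axis_def)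
qed simp_all

lemma cinner_complex_2: "cinner (x :: complex ^ 2) y = cnj (x $ 1) * y $ 1 + cnj (x $ 2) * y $ 2"
  by (simp add: cinner_vec_def cinner_complex_def sum_2)

lemma blinfun_norm_le_complex_2:
  fixes D :: "(complex ^ 2) \<Rightarrow>\<^sub>L (complex ^ 2)"
  assumes r: "0 \<le> r" and le: "\<And>x. (cmod (D x $ 1))\<^sup>2 + (cmod (D x $ 2))\<^sup>2 \<le> (r * cmod (x $ 1))\<^sup>2 + (r * cmod (x $ 2))\<^sup>2"
  shows "norm D \<le> r"
proof (rule norm_blinfun_bound[OF r])
  fix x
  have "(norm (D x))\<^sup>2 \<le> (r * norm x)\<^sup>2"
    using le[of x] by (simp add: norm_sq_complex_2 power_mult_distrib distrib_left)
  then show "norm (D x) \<le> r * norm x"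
    by (rule power2_le_imp_le) (simp add: r)
qed

lemma blinfun_norm_diagonal_le:
  fixes D :: "(complex ^ 2) \<Rightarrow>\<^sub>L (complex ^ 2)"
  assumes "\<And>x. D x $ 1 = a * x $ 1" "\<And>x. D x $ 2 = b * x $ 2" "cmod a \<le> r" "cmod b \<le> r"
  shows "norm D \<le> r"
proof (rule blinfun_norm_le_complex_2)
  show "0 \<le> r"
    using order_trans[OF norm_ge_zero assms(3)] .
  fix x
  show "(cmod (D x $ 1))\<^sup>2 + (cmod (D x $ 2))\<^sup>2 \<le> (r * cmod (x $ 1))\<^sup>2 + (r * cmod (x $ 2))\<^sup>2"
    unfolding assms norm_mult by (intro add_mono power_mono mult_right_mono assms norm_ge_zero mult_nonneg_nonneg)
qed

lemma blinfun_norm_off_diagonal_le: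
  fixes D :: "(complex ^ 2) \<Rightarrow>\<^sub>L (complex ^ 2)"
  assumes D: "\<And>x. D x $ 1 = a * x $ 2" "\<And>x. D x $ 2 = b * x $ 1" and ab: "cmod a \<le> r" "cmod b \<le> r"
  shows "norm D \<le> r"
proof (rule blinfun_norm_le_complex_2)
  show "0 \<le> r"
    using order_trans[OF norm_ge_zero ab(1)] .
  fix x
  have "(cmod (D x $ 1))\<^sup>2 \<le> (r * cmod (x $ 2))\<^sup>2" "(cmod (D x $ 2))\<^sup>2 \<le> (r * cmod (x $ 1))\<^sup>2"
    unfolding D norm_mult by (intro power_mono mult_right_mono ab norm_ge_zero mult_nonneg_nonneg)+
  then show "(cmod (D x $ 1))\<^sup>2 + (cmod (D x $ 2))\<^sup>2 \<le> (r * cmod (x $ 1))\<^sup>2 + (r * cmod (x $ 2))\<^sup>2"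
    by linarith
qed

lemma axis_nth_if: "axis i a $ j = (if j = i then a else 0)"
  by (simp add: axis_def)

lemma uncertainty_relation_sharp:
  fixes \<Delta> :: real
  assumes \<Delta>: "\<Delta> \<in> {0..1/2}"
  defines "t \<equiv> (\<lambda>x y. \<chi> i. (x $ i) *\<^sub>C y) :: complex ^ 2 \<Rightarrow> complex ^ 2 \<Rightarrow> complex ^ 2 ^ 2"
  obtains T :: "((complex ^ 2 ^ 2) \<Rightarrow>\<^sub>L (complex ^ 2 ^ 2)) \<Rightarrow> ((complex ^ 2) \<Rightarrow>\<^sub>L (complex ^ 2))"
    and A :: "(complex ^ 2) \<Rightarrow>\<^sub>L (complex ^ 2)" and \<delta> :: real
  where "cp_map (tensor_algebra t bounded_ops bounded_ops) bounded_ops T" "hermitean A" "A \<notin> range scalar_op"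
    "disturbance t T = \<Delta>" "transfer_error t T A A = \<delta>" "\<delta> \<in> {0..1/2}"
    "(1/2 - \<delta>)\<^sup>2 + (1/2 - \<Delta>)\<^sup>2 = 1/4"
proof -
  have t: "hilbert_tensor t"
    unfolding t_def by (rule hilbert_tensor_vec)
  have t_nth: "t x y $ i = (x $ i) *\<^sub>C y" for x y i
    by (simp add: t_def)
  \<comment> \<open>The overlap of the two probe vectors; off-diagonal matrix entries of an effect
    will be multiplied by it.\<close>
  define c where "c = 1 - 2 * \<Delta>"
  have c: "0 \<le> c" "c \<le> 1"
    using \<Delta> by (auto simp: c_def)
  \<comment> \<open>The smaller root of \<open>\<delta> * (1 - \<delta>) = (c / 2)\<^sup>2\<close>,
    which lies in the required range.\<close>
  define \<delta> where "\<delta> = (1 - sqrt (1 - c\<^sup>2)) / 2"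
  have c2: "0 \<le> 1 - c\<^sup>2" "1 - c\<^sup>2 \<le> 1"
    using c by (auto simp: power_le_one)
  then have \<delta>: "0 \<le> \<delta>" "\<delta> \<le> 1/2"
    by (auto simp: \<delta>_def)
  have "1 - 2 * \<delta> = sqrt (1 - c\<^sup>2)"
    by (simp add: \<delta>_def field_simps)
  then have "(1 - 2 * \<delta>)\<^sup>2 = 1 - c\<^sup>2"
    using c2 by simp
  then have circle: "(1/2 - \<delta>)\<^sup>2 + (1/2 - \<Delta>)\<^sup>2 = 1/4" and \<delta>c: "\<delta> * (1 - \<delta>) = (c / 2)\<^sup>2"
    by (simp_all add: c_def power2_eq_square field_simps)
  \<comment> \<open>The probe vectors are (k, s) and (s, k). Normalization is
    \<open>k * k + s * s = 1\<close> and their overlap is \<open>2 * s * k = c\<close>.\<close>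
  define s where "s = sqrt \<delta>"
  define k where "k = sqrt (1 - \<delta>)"
  have sk: "s * s = \<delta>" "k * k = 1 - \<delta>" "s * k = c / 2"
    using \<delta> c \<delta>c by (simp_all add: s_def k_def real_sqrt_mult[symmetric] real_sqrt_unique)
  define \<phi> :: "2 \<Rightarrow> complex ^ 2" where "\<phi> i = (if i = 1 then vector [of_real k, of_real s] else vector [of_real s, of_real k])" for i
  have \<phi>: "cinner (\<phi> i) (\<phi> j) = (if i = j then 1 else of_real c)" for i j
    using exhaust_2[of i] exhaust_2[of j] sk
    by (auto simp: \<phi>_def cinner_complex_2 mult.commute[of "of_real k"] simp flip: of_real_mult of_real_add)
  have \<phi>1: "cinner (\<phi> i) (\<phi> i) = 1" for i
    by (simp add: \<phi>)
  have "linear (\<lambda>x :: complex ^ 2. (\<chi> i. (x $ i) *\<^sub>C \<phi> i) :: complex ^ 2 ^ 2)"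
    by (rule linearI) (simp_all add: vec_eq_iff scaleC_add_left scaleR_scaleC_assoc)
  then have blV: "bounded_linear (\<lambda>x :: complex ^ 2. (\<chi> i. (x $ i) *\<^sub>C \<phi> i) :: complex ^ 2 ^ 2)"
    by (simp add: linear_conv_bounded_linear)
  define V where "V = Blinfun (\<lambda>x :: complex ^ 2. (\<chi> i. (x $ i) *\<^sub>C \<phi> i) :: complex ^ 2 ^ 2)"
  have V: "V x $ i = (x $ i) *\<^sub>C \<phi> i" for x i
    by (simp add: V_def bounded_linear_Blinfun_apply[OF blV])
  have "linear (\<lambda>z :: complex ^ 2 ^ 2. (\<chi> i. cinner (\<phi> i) (z $ i)) :: complex ^ 2)"
    by (rule linearI) (simp_all add: vec_eq_iff cinner_add_right cinner_scaleR_right scaleR_conv_of_real[where 'a=complex])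
  then have blW: "bounded_linear (\<lambda>z :: complex ^ 2 ^ 2. (\<chi> i. cinner (\<phi> i) (z $ i)) :: complex ^ 2)"
    by (simp add: linear_conv_bounded_linear)
  define W where "W = Blinfun (\<lambda>z :: complex ^ 2 ^ 2. (\<chi> i. cinner (\<phi> i) (z $ i)) :: complex ^ 2)"
  have W: "W z $ i = cinner (\<phi> i) (z $ i)" for z i
    by (simp add: W_def bounded_linear_Blinfun_apply[OF blW])
  define T where "T X = W o\<^sub>L X o\<^sub>L V" for X
  have T: "cp_map (tensor_algebra t bounded_ops bounded_ops) bounded_ops T"
    unfolding tensor_algebra_def T_def[abs_def]
  proof (rule compression_cp_map)
    show "cinner (V x) z = cinner x (W z)" for x z
      unfolding cinner_vec_def[of "V x" z] cinner_vec_def[of x "W z"]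
      by (simp add: V W cinner_scaleC_left cinner_complex_def)
  qed (simp_all add: vec_eq_iff V W scaleC_vec_nth scaleC_scaleC scaleC_complex_def cinner_scaleC_right \<phi>1)
  have V_t: "V x = (\<Sum>j\<in>UNIV. t (axis j (x $ j)) (\<phi> j))" for x
    using exhaust_2 by (auto simp: vec_eq_iff V t_nth sum_2 axis_nth_if scaleC_zero)
  \<comment> \<open>On the first factor \<open>T\<close> is the entrywise product with the Gram
    matrix of the probe vectors.\<close>
  have T_left: "T (tensor_op t P id_blinfun) x $ i = (\<Sum>j\<in>UNIV. (P (axis j (x $ j)) $ i) * cinner (\<phi> i) (\<phi> j))"
    if "P \<in> bounded_ops" for P x i
    by (simp add: T_def W V_t blinfun.sum_right tensor_op_left(2)[OF t that] sum_component t_nth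
        cinner_sum_right cinner_scaleC_right)
  \<comment> \<open>On the second factor the image is diagonal, with the expectations of
    \<open>Q\<close> in the two probe states.\<close>
  have T_right: "T (tensor_op t id_blinfun Q) x $ i = x $ i * cinner (\<phi> i) (Q (\<phi> i))"
    if "Q \<in> bounded_ops" for Q x i
  proof -
    have "T (tensor_op t id_blinfun Q) x $ i
        = (\<Sum>j\<in>UNIV. cinner (\<phi> i) ((axis j (x $ j) $ i) *\<^sub>C Q (\<phi> j)))"
      by (simp add: T_def W V_t blinfun.sum_right tensor_op_right(2)[OF t that] sum_component t_nth cinner_sum_right)
    also have "\<dots> = (\<Sum>j\<in>UNIV. if j = i then x $ i * cinner (\<phi> i) (Q (\<phi> i)) else 0)"
      by (intro sum.cong) (auto simp: axis_nth_if scaleC_zero cinner_zero_right cinner_scaleC_right)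
    finally show ?thesis
      by simp
  qed
  have axis: "axis j (x $ j) = (x $ j) *\<^sub>C axis j 1" for j and x :: "complex ^ 2"
    by (auto simp: vec_eq_iff scaleC_vec_nth axis_nth_if scaleC_complex_def)
  have sum_axis: "x = (\<Sum>j\<in>UNIV. (x $ j) *\<^sub>C axis j 1)" for x :: "complex ^ 2"
    using exhaust_2 by (auto simp: vec_eq_iff scaleC_vec_nth axis_nth_if scaleC_complex_def sum_2)
  have e: "norm (axis j 1 :: complex ^ 2) = 1" for j
    by (simp add: norm_axis_complex_2)
  have nth: "cinner (axis j 1) x = x $ j" for x :: "complex ^ 2" and j
    using exhaust_2[of j] by (auto simp: cinner_complex_2 axis_nth_if)
  have D_left: "(T (tensor_op t P id_blinfun) - P) x $ i
      = (\<Sum>j\<in>UNIV. (P (axis j 1) $ i) * x $ j * (if i = j then 0 else of_real (c - 1)))"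
    if P: "P \<in> bounded_ops" for P x i
  proof -
    have "P x = (\<Sum>j\<in>UNIV. P ((x $ j) *\<^sub>C axis j 1))"
      by (subst sum_axis) (rule blinfun.sum_right)
    then have "P x $ i = (\<Sum>j\<in>UNIV. (P (axis j 1) $ i) * x $ j)"
      by (simp add: sum_component bounded_ops_scaleC[OF P] scaleC_vec_nth scaleC_complex_def mult.commute)
    then show ?thesis
      using exhaust_2[of i]
      by (auto simp: blinfun.diff_left T_left[OF P] axis bounded_ops_scaleC[OF P] scaleC_vec_nth scaleC_complex_def
          \<phi> sum_2 algebra_simps)
  qed
  \<comment> \<open>The projection onto the first axis serves both as the measured observable and as
    the pointer, because the first probe vector leans to that axis.\<close>
  obtain A :: "(complex ^ 2) \<Rightarrow>\<^sub>L (complex ^ 2)"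
    where A: "projection_op A" and A_apply: "\<And>x. A x = cinner (axis 1 1) x *\<^sub>C axis 1 1"
    by (rule rank_one_projection[OF e[of 1]]) (rule that)
  have A_nth: "A x $ 1 = x $ 1" "A x $ 2 = 0" for x
    by (simp_all add: A_apply nth scaleC_vec_nth scaleC_complex_def axis_nth_if)
  have hA: "hermitean A"
    by (rule projection_op_hermitean[OF A])
  have "A \<notin> range scalar_op"
  proof
    assume "A \<in> range scalar_op"
    then obtain a where a: "A = scalar_op a"
      by blast
    have "a = 1"
      using A_nth(1)[of "axis 1 1"] by (simp add: a scalar_op_apply scaleC_vec_nth scaleC_complex_def)
    moreover have "a = 0"
      using A_nth(2)[of "axis 2 1"] by (simp add: a scalar_op_apply scaleC_vec_nth scaleC_complex_def)
    ultimately show False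
      by simp
  qed
  moreover have "disturbance t T = \<Delta>"
    unfolding disturbance_def
  proof (rule cSup_eq_maximum)
    let ?d = "\<lambda>P. norm (T (tensor_op t P id_blinfun) - P)"
    let ?P = "{P \<in> bounded_ops. op_le 0 P \<and> op_le P id_blinfun}"
    have upper: "norm (T (tensor_op t P id_blinfun) - P) \<le> \<Delta>"
      if P: "P \<in> bounded_ops" "op_le 0 P" "op_le P id_blinfun" for P
    proof -
      have off: "cmod (P (axis j 1) $ i) \<le> 1/2" if "i \<noteq> j" for i j
        using effect_off_diagonal_le_half[OF P(2,3) e e, of i j] that by (simp add: nth axis_nth_if)
      have bound: "cmod (P (axis j 1) $ i * of_real (c - 1)) \<le> \<Delta>" if "i \<noteq> j" for i j
      proof -
        have "cmod (P (axis j 1) $ i * of_real (c - 1)) = cmod (P (axis j 1) $ i) * (1 - c)"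
          using c by (simp only: norm_mult norm_of_real) simp
        also have "\<dots> \<le> 1/2 * (1 - c)"
          using off[OF that] c by (intro mult_right_mono) auto
        finally show ?thesis
          by (simp add: c_def)
      qed
      show ?thesis
      proof (rule blinfun_norm_off_diagonal_le)
        show "(T (tensor_op t P id_blinfun) - P) x $ 1 = P (axis 2 1) $ 1 * of_real (c - 1) * x $ 2"
          "(T (tensor_op t P id_blinfun) - P) x $ 2 = P (axis 1 1) $ 2 * of_real (c - 1) * x $ 1" for x
          unfolding D_left[OF P(1)] by (simp_all add: sum_2)
      qed (rule bound, simp)+
    qed
    then show "z \<le> \<Delta>" if "z \<in> ?d ` ?P" for z
      using that by auto
    \<comment> \<open>All entries of the projection onto this vector are 1/2, so the bound for
      off-diagonal entries is attained.\<close>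
    define \<psi> :: "complex ^ 2" where "\<psi> = (\<chi> i. of_real (1 / sqrt 2))"
    have "(norm \<psi>)\<^sup>2 = 1"
      by (simp add: norm_sq_complex_2 \<psi>_def norm_divide power_divide)
    then have "norm \<psi> = 1"
      using power2_eq_imp_eq[of "norm \<psi>" 1] by simp
    then obtain P where P: "projection_op P" and P_apply: "\<And>x. blinfun_apply P x = cinner \<psi> x *\<^sub>C \<psi>"
      by (rule rank_one_projection) (rule that)
    note Pb = hermitean_bounded_ops[OF projection_op_hermitean[OF P]]
    have \<psi>_nth: "\<psi> $ i = of_real (1 / sqrt 2)" for i
      by (simp add: \<psi>_def)
    have "cinner \<psi> (axis j 1) = of_real (1 / sqrt 2)" for j
      using cinner_commute[of \<psi> "axis j 1"] by (simp only: nth \<psi>_nth complex_cnj_complex_of_real)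
    then have "P (axis j 1) $ i = of_real (1 / sqrt 2 * (1 / sqrt 2))" for i j
      by (simp only: P_apply scaleC_vec_nth scaleC_complex_def \<psi>_nth of_real_mult)
    then have P_nth: "P (axis j 1) $ i = 1/2" for i j
      by simp
    have "(T (tensor_op t P id_blinfun) - P) (axis 2 1) = axis 1 (of_real (- \<Delta>))"
      by (simp add: vec_eq_iff forall_2 D_left[OF Pb] P_nth sum_2 axis_nth_if c_def)
    then have "\<Delta> = norm ((T (tensor_op t P id_blinfun) - P) (axis 2 1))"
      using \<Delta> by (simp add: norm_axis_complex_2)
    also have "\<dots> \<le> norm (T (tensor_op t P id_blinfun) - P)"
      using norm_blinfun[of "T (tensor_op t P id_blinfun) - P" "axis 2 1"] by (simp add: e)
    finally show "\<Delta> \<in> ?d ` ?P"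
      using upper[OF Pb] projection_op_effect[OF P] Pb by (auto intro!: image_eqI[of _ _ P])
  qed
  moreover have "transfer_error t T A A = \<delta>"
    unfolding transfer_error_def
  proof (rule cSup_eq_maximum)
    let ?e = "\<lambda>S. norm (T (tensor_op t id_blinfun (spectral_projection A S)) - spectral_projection A S)"
    define D where "D S = T (tensor_op t id_blinfun (spectral_projection A S)) - spectral_projection A S" for S
    \<comment> \<open>A set containing both or neither of 0 and 1 gives no error; otherwise both
      diagonal errors have modulus \<open>\<delta>\<close>.\<close>
    have D1: "D S x $ 1 = of_real (\<delta> * (indicator S 0 - indicator S 1)) * x $ 1"
      and D2: "D S x $ 2 = of_real (\<delta> * (indicator S 1 - indicator S 0)) * x $ 2"
      if S: "S \<in> sets borel" for S x
    proof -
      define Q where "Q = spectral_projection A S"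
      have Q: "Q = indicator S 1 *\<^sub>R A + indicator S 0 *\<^sub>R (id_blinfun - A)"
        unfolding Q_def by (rule spectral_projection_of_projection[OF A S])
      have Qb: "Q \<in> bounded_ops"
        unfolding Q_def
        by (rule hermitean_bounded_ops[OF projection_op_hermitean[OF spectral_projection_properties(1)[OF hA S]]])
      have Q_nth: "Q x $ 1 = of_real (indicator S 1) * x $ 1" "Q x $ 2 = of_real (indicator S 0) * x $ 2" for x
        by (simp_all add: Q blinfun.add_left blinfun.scaleR_left blinfun.diff_left A_nth scaleR_conv_of_real[where 'a=complex])
      have Q_\<phi>: "cinner (\<phi> 1) (Q (\<phi> 1)) = of_real (indicator S 1 * (1 - \<delta>) + indicator S 0 * \<delta>)"
        "cinner (\<phi> 2) (Q (\<phi> 2)) = of_real (indicator S 1 * \<delta> + indicator S 0 * (1 - \<delta>))"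
        unfolding cinner_complex_2 Q_nth by (auto simp: \<phi>_def indicator_def sk simp flip: of_real_mult of_real_add)
      show "D S x $ 1 = of_real (\<delta> * (indicator S 0 - indicator S 1)) * x $ 1"
        "D S x $ 2 = of_real (\<delta> * (indicator S 1 - indicator S 0)) * x $ 2"
        unfolding D_def Q_def[symmetric]
        by (simp_all add: blinfun.diff_left T_right[OF Qb] Q_nth Q_\<phi> algebra_simps)
    qed
    have upper: "norm (D S) \<le> \<delta>" if "S \<in> sets borel" for S
      by (rule blinfun_norm_diagonal_le[OF D1[OF that] D2[OF that]])
        (use \<delta> in \<open>auto simp: indicator_def\<close>)
    then show "z \<le> \<delta>" if "z \<in> ?e ` sets borel" for z
      using that by (auto simp: D_def)
    \<comment> \<open>The set \<open>{1}\<close> separates the eigenvalues, and its error already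
      shows on the first basis vector.\<close>
    have "D {1} (axis 1 1) = axis 1 (of_real (- \<delta>))"
      by (simp add: vec_eq_iff forall_2 D1 D2 axis_nth_if)
    then have "\<delta> = norm (D {1} (axis 1 1))"
      using \<delta> by (simp add: norm_axis_complex_2)
    also have "\<dots> \<le> norm (D {1})"
      using norm_blinfun[of "D {1}" "axis 1 1"] by (simp add: e)
    finally show "\<delta> \<in> ?e ` sets borel"
      using upper[of "{1}"] by (intro image_eqI[of _ _ "{1}"]) (auto simp: D_def)
  qed
  ultimately show thesis
    using that T hA \<delta> circle by auto
qed

theorem mainTheorem6:
  shows "(\<forall>(t :: 'h :: complex_hilbert_space \<Rightarrow> 'k :: complex_hilbert_space \<Rightarrow>
              'm :: complex_hilbert_space)
            (\<B> :: ('k \<Rightarrow>\<^sub>L 'k) set)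
            (T :: ('m \<Rightarrow>\<^sub>L 'm) \<Rightarrow> ('h \<Rightarrow>\<^sub>L 'h))
            (A :: 'h \<Rightarrow>\<^sub>L 'h) (B :: 'k \<Rightarrow>\<^sub>L 'k) (\<Delta> :: real) (\<delta> :: real).
            hilbert_tensor t \<and> von_neumann_algebra \<B> \<and>
            cp_map (tensor_algebra t bounded_ops \<B>) bounded_ops T \<and>
            A \<in> bounded_ops \<and> hermitean A \<and> B \<in> \<B> \<and> hermitean B \<and>
            A \<notin> range scalar_op \<and>
            \<Delta> = disturbance t T \<and> \<delta> = transfer_error t T A B \<and>
            \<delta> \<in> {0..1/2} \<and> \<Delta> \<in> {0..1/2}
            \<longrightarrow> (1/2 - \<delta>)\<^sup>2 + (1/2 - \<Delta>)\<^sup>2 \<le> 1/4) \<and>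
         (\<forall>\<Delta> \<in> {0..1/2 :: real}.
            \<exists>(t :: complex ^ 2 \<Rightarrow> complex ^ 2 \<Rightarrow> complex ^ 2 ^ 2)
             (\<B> :: ((complex ^ 2) \<Rightarrow>\<^sub>L (complex ^ 2)) set)
             (T :: ((complex ^ 2 ^ 2) \<Rightarrow>\<^sub>L (complex ^ 2 ^ 2)) \<Rightarrow> ((complex ^ 2) \<Rightarrow>\<^sub>L (complex ^ 2)))
             (A :: (complex ^ 2) \<Rightarrow>\<^sub>L (complex ^ 2)) (B :: (complex ^ 2) \<Rightarrow>\<^sub>L (complex ^ 2)) (\<delta> :: real).
            hilbert_tensor t \<and> von_neumann_algebra \<B> \<and>
            cp_map (tensor_algebra t bounded_ops \<B>) bounded_ops T \<and>
            A \<in> bounded_ops \<and> hermitean A \<and> B \<in> \<B> \<and> hermitean B \<and>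
            A \<notin> range scalar_op \<and>
            disturbance t T = \<Delta> \<and> \<delta> = transfer_error t T A B \<and>
            \<delta> \<in> {0..1/2} \<and>
            (1/2 - \<delta>)\<^sup>2 + (1/2 - \<Delta>)\<^sup>2 = 1/4)"
proof (intro conjI allI impI ballI, goal_cases)
  case (1 t \<B> T A B \<Delta> \<delta>)
  then show ?case
    by (intro uncertainty_relation[of t \<B> T A B]) auto
next
  case (2 \<Delta>)
  define t :: "complex ^ 2 \<Rightarrow> complex ^ 2 \<Rightarrow> complex ^ 2 ^ 2" where "t = (\<lambda>x y. \<chi> i. (x $ i) *\<^sub>C y)"
  have t: "hilbert_tensor t"
    unfolding t_def by (rule hilbert_tensor_vec)
  show ?case
  proof (rule uncertainty_relation_sharp[OF 2, folded t_def])
    fix T :: "((complex ^ 2 ^ 2) \<Rightarrow>\<^sub>L (complex ^ 2 ^ 2)) \<Rightarrow> ((complex ^ 2) \<Rightarrow>\<^sub>L (complex ^ 2))"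
      and A :: "(complex ^ 2) \<Rightarrow>\<^sub>L (complex ^ 2)" and \<delta> :: real
    assume "cp_map (tensor_algebra t bounded_ops bounded_ops) bounded_ops T" and A: "hermitean A"
      and "A \<notin> range scalar_op" "disturbance t T = \<Delta>" "transfer_error t T A A = \<delta>" "\<delta> \<in> {0..1/2}"
      "(1/2 - \<delta>)\<^sup>2 + (1/2 - \<Delta>)\<^sup>2 = 1/4"
    then show ?thesis
      using t von_neumann_algebra_bounded_ops hermitean_bounded_ops[OF A]
      by (intro exI[of _ t] exI[of _ bounded_ops] exI[of _ T] exI[of _ A] exI[of _ \<delta>] conjI) simp_all
  qed
qed

end
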